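(* Let $(M,\langle\cdot,\cdot\rangle)$ be a Riemannian manifold, $k\ge1$, and let $\nabla^{(k)}$ be the Levi--Civita connection of $(T^{(k)}M,g^{(k)})$, where $g^{(k)}$ is the $k$-Sasaki metric. Then \begin{align*} K_k\circ\big(\nabla^{(k)}_{X^{v_k}}Y^{v_k}\big)&=K_k\circ\big(\nabla^{(k)}_{X^{h_1}}Y^{v_k}\big)=\cdots=K_k\circ\big(\nabla^{(k)}_{X^{h_{k-1}}}Y^{v_k}\big)=0,\\ K_k\circ\big(\nabla^{(k)}_{X^{h_0}}Y^{v_k}\big)&=(\nabla_XY)\circ\tau_k,\\ K_\mu\circ\big(\nabla^{(k)}_{X^{v_k}}Y^{v_k}\big)&=0,\qquad\mu=0,1,\ldots,k-1, \end{align*} for all $X,Y\in\mathfrak X(M)$.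
   Context: $\nabla$ is the Levi--Civita connection of $M$. $T^{(k)}M$ is the manifold of $k$-jets $u=j^k_0(q)$ at $0$ of smooth curves $q$ in $M$, with projection $\tau_k(j^k_0q)=q(0)$. For $W\in T_uT^{(k)}M$ choose a family of curves $\gamma_s(t)=\gamma(s,t)$ on $M$ such that $s\mapsto j^k_0(\gamma_s)$ passes through $u$ at $s=0$ with velocity $W$, and set $K_0(W)=\tau_{k*}W$ and $K_\alpha(W)=\frac1{\alpha!}\nabla^\alpha_{\partial\gamma/\partial t}\frac{\partial\gamma}{\partial s}\big|_{(s,t)=(0,0)}$ for $\alpha=1,\ldots,k$. These are well defined and $(K_0,\ldots,K_k):T_uT^{(k)}M\to(T_{\tau_k(u)}M)^{k+1}$ is a linear isomorphism. The $k$-Sasaki metric $g^{(k)}$ on $T^{(k)}M$ is $g^{(k)}_u(W,W')=\sum_{\alpha=0}^k\langle K_\alpha(W),K_\alpha(W')\rangle$. For $X\in\mathfrak X(M)$ and $\alpha=0,\ldots,k$, the lift $X^{h_\alpha}\in\mathfrak X(T^{(k)}M)$ is the unique vector field with $K_\alpha\circ X^{h_\alpha}=X\circ\tau_k$ and $K_\beta\circ X^{h_\alpha}=0$ for $\beta\ne\alpha$; one writes $v_k:=h_k$. *)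

theory Defs
  imports "HOL-Analysis.Analysis"
begin

text \<open>\<open>Ck n S f\<close> is only used for open \<open>S\<close>. The domain is finite-dimensional, so
  continuity of all directional derivatives is continuity of the derivative.\<close>

primrec Ck :: "nat \<Rightarrow> 'p::euclidean_space set \<Rightarrow> ('p \<Rightarrow> 'b::real_normed_vector) \<Rightarrow> bool" where
  "Ck 0 S f \<longleftrightarrow> continuous_on S f"
| "Ck (Suc n) S f \<longleftrightarrow>
     (\<forall>x\<in>S. f differentiable (at x)) \<and> (\<forall>v. Ck n S (\<lambda>x. frechet_derivative f (at x) v))"

definition smooth_on :: "'p::euclidean_space set \<Rightarrow> ('p \<Rightarrow> 'b::real_normed_vector) \<Rightarrow> bool" where
  "smooth_on S f \<longleftrightarrow> (\<forall>n. Ck n S f)"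

definition higher_vderiv :: "nat \<Rightarrow> (real \<Rightarrow> 'b::real_normed_vector) \<Rightarrow> real \<Rightarrow> 'b" where
  "higher_vderiv n f = ((\<lambda>h t. vector_derivative h (at t)) ^^ n) f"

text \<open>A manifold is given by an atlas, a set of charts \<open>(U, \<phi>)\<close>. Only the values of \<open>\<phi>\<close> on
  \<open>U\<close> matter. The underlying set is the union of the chart domains and its topology is
  the one determined by the charts.\<close>

type_synonym ('a, 'e) atlas = "('a set \<times> ('a \<Rightarrow> 'e)) set"

definition carr :: "('a, 'e) atlas \<Rightarrow> 'a set" where
  "carr A = \<Union>(fst ` A)"

definition manifold_topology :: "('a, 'e::euclidean_space) atlas \<Rightarrow> 'a topology" where
  "manifold_topology A = topology (\<lambda>W. W \<subseteq> carr A \<and> (\<forall>(U, \<phi>)\<in>A. open (\<phi> ` (W \<inter> U))))"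

definition smooth_manifold :: "('a, 'e::euclidean_space) atlas \<Rightarrow> bool" where
  "smooth_manifold A \<longleftrightarrow>
     (\<forall>(U, \<phi>)\<in>A. inj_on \<phi> U \<and> open (\<phi> ` U)) \<and>
     (\<forall>(U, \<phi>)\<in>A. \<forall>(V, \<psi>)\<in>A.
        open (\<phi> ` (U \<inter> V)) \<and> smooth_on (\<phi> ` (U \<inter> V)) (\<psi> \<circ> inv_into U \<phi>)) \<and>
     Hausdorff_space (manifold_topology A) \<and> second_countable (manifold_topology A)"

lemma openin_manifold_topology:
  assumes "smooth_manifold A"
  shows "openin (manifold_topology A) W \<longleftrightarrow>
           W \<subseteq> carr A \<and> (\<forall>(U, \<phi>)\<in>A. open (\<phi> ` (W \<inter> U)))"
proof -
  let ?L = "\<lambda>W. W \<subseteq> carr A \<and> (\<forall>(U, \<phi>)\<in>A. open (\<phi> ` (W \<inter> U)))"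
  have inj: "inj_on \<phi> U" if "(U, \<phi>) \<in> A" for U \<phi>
    using assms that by (auto simp: smooth_manifold_def)
  have "istopology ?L"
    unfolding istopology_def
  proof (intro conjI allI impI)
    fix S T assume S: "?L S" and T: "?L T"
    show "S \<inter> T \<subseteq> carr A" using S by blast
    show "\<forall>(U, \<phi>)\<in>A. open (\<phi> ` (S \<inter> T \<inter> U))"
    proof clarify
      fix U \<phi> assume c: "(U, \<phi>) \<in> A"
      have "\<phi> ` (S \<inter> T \<inter> U) = \<phi> ` (S \<inter> U) \<inter> \<phi> ` (T \<inter> U)"
        using inj[OF c] by (auto simp: inj_on_def)
      then show "open (\<phi> ` (S \<inter> T \<inter> U))" using S T c by fastforce
    qed
  next
    fix \<K> assume K: "\<forall>K\<in>\<K>. ?L K"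
    show "\<Union>\<K> \<subseteq> carr A" using K by blast
    show "\<forall>(U, \<phi>)\<in>A. open (\<phi> ` (\<Union>\<K> \<inter> U))"
    proof clarify
      fix U \<phi> assume c: "(U, \<phi>) \<in> A"
      have "\<phi> ` (\<Union>\<K> \<inter> U) = (\<Union>K\<in>\<K>. \<phi> ` (K \<inter> U))" by blast
      then show "open (\<phi> ` (\<Union>\<K> \<inter> U))" using K c by fastforce
    qed
  qed
  then show ?thesis by (simp add: manifold_topology_def)
qed

text \<open>The values of a smooth function off the manifold are irrelevant.\<close>

definition smooth_fun :: "('a, 'e::euclidean_space) atlas \<Rightarrow> ('a \<Rightarrow> real) set" where
  "smooth_fun A = {f. \<forall>(U, \<phi>)\<in>A. smooth_on (\<phi> ` U) (f \<circ> inv_into U \<phi>)}"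

definition smooth_into ::
  "('a, 'e::euclidean_space) atlas \<Rightarrow> 'p::euclidean_space set \<Rightarrow> ('p \<Rightarrow> 'a) \<Rightarrow> bool" where
  "smooth_into A S F \<longleftrightarrow> open S \<and> F ` S \<subseteq> carr A \<and>
     (\<forall>(U, \<phi>)\<in>A. open (S \<inter> F -` U) \<and> smooth_on (S \<inter> F -` U) (\<phi> \<circ> F))"

text \<open>Curves and families of curves only need to be defined near the point of interest:\<close>

definition smooth_near ::
  "('a, 'e::euclidean_space) atlas \<Rightarrow> 'p::euclidean_space \<Rightarrow> ('p \<Rightarrow> 'a) \<Rightarrow> bool" where
  "smooth_near A x F \<longleftrightarrow> (\<exists>S. x \<in> S \<and> smooth_into A S F)"

text \<open>Tangent vectors are velocities of curves, viewed as derivations of the algebra of smooth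
  functions. To have one HOL function per tangent vector, they are set to \<open>0\<close> on functions that
  are not smooth. Likewise, vector fields vanish off the manifold.\<close>

type_synonym 'a tvec = "('a \<Rightarrow> real) \<Rightarrow> real"
type_synonym 'a vfield = "'a \<Rightarrow> 'a tvec"
type_synonym 'a metric_field = "'a \<Rightarrow> 'a tvec \<Rightarrow> 'a tvec \<Rightarrow> real"
type_synonym 'a conn = "'a vfield \<Rightarrow> 'a vfield \<Rightarrow> 'a vfield"

definition tv_zero :: "'a tvec" where
  "tv_zero = (\<lambda>f. 0)"

definition tv_add :: "'a tvec \<Rightarrow> 'a tvec \<Rightarrow> 'a tvec" where
  "tv_add v w = (\<lambda>f. v f + w f)"

definition tv_scale :: "real \<Rightarrow> 'a tvec \<Rightarrow> 'a tvec" where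
  "tv_scale c v = (\<lambda>f. c * v f)"

definition velocity :: "('a, 'e::euclidean_space) atlas \<Rightarrow> (real \<Rightarrow> 'a) \<Rightarrow> real \<Rightarrow> 'a tvec" where
  "velocity A c t = (\<lambda>f. if f \<in> smooth_fun A then deriv (\<lambda>s. f (c s)) t else 0)"

definition tangent_space :: "('a, 'e::euclidean_space) atlas \<Rightarrow> 'a \<Rightarrow> 'a tvec set" where
  "tangent_space A p = {velocity A c 0 | c. smooth_near A 0 c \<and> c 0 = p}"

definition pushforward ::
  "('a, 'e::euclidean_space) atlas \<Rightarrow> ('b \<Rightarrow> 'a) \<Rightarrow> 'b tvec \<Rightarrow> 'a tvec" where
  "pushforward A F v = (\<lambda>f. if f \<in> smooth_fun A then v (f \<circ> F) else 0)"

definition vector_fields :: "('a, 'e::euclidean_space) atlas \<Rightarrow> 'a vfield set" where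
  "vector_fields A = {X. (\<forall>p\<in>carr A. X p \<in> tangent_space A p) \<and>
     (\<forall>p. p \<notin> carr A \<longrightarrow> X p = tv_zero) \<and>
     (\<forall>f\<in>smooth_fun A. (\<lambda>p. X p f) \<in> smooth_fun A)}"

definition vf_add :: "'a vfield \<Rightarrow> 'a vfield \<Rightarrow> 'a vfield" where
  "vf_add X Y = (\<lambda>p. tv_add (X p) (Y p))"

definition vf_scale :: "('a \<Rightarrow> real) \<Rightarrow> 'a vfield \<Rightarrow> 'a vfield" where
  "vf_scale h X = (\<lambda>p. tv_scale (h p) (X p))"

definition lie_bracket :: "'a vfield \<Rightarrow> 'a vfield \<Rightarrow> 'a vfield" where
  "lie_bracket X Y = (\<lambda>p f. X p (\<lambda>q. Y q f) - Y p (\<lambda>q. X q f))"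

definition riemannian_metric :: "('a, 'e::euclidean_space) atlas \<Rightarrow> 'a metric_field \<Rightarrow> bool" where
  "riemannian_metric A g \<longleftrightarrow>
     (\<forall>p\<in>carr A. \<forall>u\<in>tangent_space A p. \<forall>v\<in>tangent_space A p. \<forall>w\<in>tangent_space A p. \<forall>c.
        g p u v = g p v u \<and>
        g p (tv_add u v) w = g p u w + g p v w \<and>
        g p (tv_scale c u) w = c * g p u w \<and>
        (u \<noteq> tv_zero \<longrightarrow> g p u u > 0)) \<and>
     (\<forall>X\<in>vector_fields A. \<forall>Y\<in>vector_fields A. (\<lambda>p. g p (X p) (Y p)) \<in> smooth_fun A)"

definition affine_connection :: "('a, 'e::euclidean_space) atlas \<Rightarrow> 'a conn \<Rightarrow> bool" where
  "affine_connection A D \<longleftrightarrow>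
     (\<forall>X\<in>vector_fields A. \<forall>Y\<in>vector_fields A. D X Y \<in> vector_fields A) \<and>
     (\<forall>X\<in>vector_fields A. \<forall>Y\<in>vector_fields A. \<forall>Z\<in>vector_fields A. \<forall>h\<in>smooth_fun A.
        D (vf_add X Y) Z = vf_add (D X Z) (D Y Z) \<and>
        D (vf_scale h X) Z = vf_scale h (D X Z) \<and>
        D X (vf_add Y Z) = vf_add (D X Y) (D X Z) \<and>
        D X (vf_scale h Z) = vf_add (vf_scale (\<lambda>p. X p h) Z) (vf_scale h (D X Z)))"

definition levi_civita ::
  "('a, 'e::euclidean_space) atlas \<Rightarrow> 'a metric_field \<Rightarrow> 'a conn \<Rightarrow> bool" where
  "levi_civita A g D \<longleftrightarrow> affine_connection A D \<and>
     (\<forall>X\<in>vector_fields A. \<forall>Y\<in>vector_fields A.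
        vf_add (D X Y) (vf_scale (\<lambda>p. -1) (D Y X)) = lie_bracket X Y) \<and>
     (\<forall>X\<in>vector_fields A. \<forall>Y\<in>vector_fields A. \<forall>Z\<in>vector_fields A. \<forall>p\<in>carr A.
        X p (\<lambda>q. g q (Y q) (Z q)) = g p (D X Y p) (Z p) + g p (Y p) (D X Z p))"

text \<open>Covariant derivative at \<open>t\<close> of a vector field \<open>V\<close> along the curve \<open>c\<close>: writing \<open>V\<close> near \<open>t\<close>
  as a finite sum of \<open>a\<^sub>i \<sqdot> (Z\<^sub>i \<circ> c)\<close> with \<open>Z\<^sub>i\<close> vector fields on the manifold, it is the sum of
  \<open>a\<^sub>i'(t) Z\<^sub>i(c(t)) + a\<^sub>i(t) \<nabla>\<^bsub>c'(t)\<^esub> Z\<^sub>i\<close>, and \<open>\<nabla>\<^bsub>v\<^esub> Z\<close> is \<open>(\<nabla>\<^bsub>X\<^esub> Z)(p)\<close> for any vector field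
  \<open>X\<close> with \<open>X(p) = v\<close>.\<close>

definition cov_deriv_along ::
  "('a, 'e::euclidean_space) atlas \<Rightarrow> 'a conn \<Rightarrow> (real \<Rightarrow> 'a) \<Rightarrow> (real \<Rightarrow> 'a tvec) \<Rightarrow> real \<Rightarrow> 'a tvec"
  where
  "cov_deriv_along A D c V t = (THE \<xi>. \<exists>(m::nat) a Z X.
     (\<forall>i<m. Z i \<in> vector_fields A \<and> (\<exists>S. open S \<and> t \<in> S \<and> smooth_on S (a i))) \<and>
     (\<forall>\<^sub>F r in nhds t. V r = (\<lambda>f. \<Sum>i<m. a i r * Z i (c r) f)) \<and>
     X \<in> vector_fields A \<and> X (c t) = velocity A c t \<and>
     \<xi> = (\<lambda>f. \<Sum>i<m. deriv (a i) t * Z i (c t) f + a i t * D X (Z i) (c t) f))"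

text \<open>A jet is an equivalence class of curves that are smooth near \<open>0\<close>.\<close>

type_synonym 'a jet = "(real \<Rightarrow> 'a) set"

definition jet_of :: "('a, 'e::euclidean_space) atlas \<Rightarrow> nat \<Rightarrow> (real \<Rightarrow> 'a) \<Rightarrow> 'a jet" where
  "jet_of A k q = {r. smooth_near A 0 r \<and> r 0 = q 0 \<and>
     (\<forall>(U, \<phi>)\<in>A. q 0 \<in> U \<longrightarrow>
        (\<forall>\<alpha>\<le>k. higher_vderiv \<alpha> (\<phi> \<circ> r) 0 = higher_vderiv \<alpha> (\<phi> \<circ> q) 0))}"

definition jets :: "('a, 'e::euclidean_space) atlas \<Rightarrow> nat \<Rightarrow> 'a jet set" where
  "jets A k = {jet_of A k q | q. smooth_near A 0 q}"

definition jet_rep :: "'a jet \<Rightarrow> real \<Rightarrow> 'a" where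
  "jet_rep u = (SOME q. q \<in> u)"

definition jet_proj :: "'a jet \<Rightarrow> 'a" where
  "jet_proj u = jet_rep u 0"

text \<open>In the chart induced by \<open>(U, \<phi>)\<close>, the jet of \<open>q\<close> has as coordinates the derivatives of
  \<open>\<phi> \<circ> q\<close> at \<open>0\<close> of order \<open>0, \<dots>, k\<close>. The bijection \<open>\<iota>\<close> from the index type onto \<open>{0..k}\<close>
  names these orders, so that the model space is the Euclidean space \<open>'e ^ 'i\<close>.\<close>

definition jet_chart :: "('i::finite \<Rightarrow> nat) \<Rightarrow> ('a \<Rightarrow> 'e::euclidean_space) \<Rightarrow> 'a jet \<Rightarrow> 'e ^ 'i" where
  "jet_chart \<iota> \<phi> u = (\<chi> i. higher_vderiv (\<iota> i) (\<phi> \<circ> jet_rep u) 0)"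

definition jet_atlas ::
  "('a, 'e::euclidean_space) atlas \<Rightarrow> nat \<Rightarrow> ('i::finite \<Rightarrow> nat) \<Rightarrow> ('a jet, 'e ^ 'i) atlas" where
  "jet_atlas A k \<iota> = (\<lambda>(U, \<phi>). ({u \<in> jets A k. jet_proj u \<in> U}, jet_chart \<iota> \<phi>)) ` A"

text \<open>The vector \<open>W\<close> is tangent to the jet manifold at \<open>u\<close>. In \<open>\<gamma> (s, t)\<close>, the first
  argument is the family parameter. Only the curve \<open>t \<mapsto> \<gamma> (0, t)\<close> and the field
  \<open>\<partial>\<gamma>/\<partial>s\<close> along it enter the iterated covariant derivative at \<open>(0, 0)\<close>.\<close>

definition Kmap ::
  "('a, 'e::euclidean_space) atlas \<Rightarrow> 'a conn \<Rightarrow> nat \<Rightarrow> ('i::finite \<Rightarrow> nat)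
    \<Rightarrow> nat \<Rightarrow> 'a jet \<Rightarrow> 'a jet tvec \<Rightarrow> 'a tvec" where
  "Kmap A D k \<iota> \<alpha> u W =
     (if \<alpha> = 0 then pushforward A jet_proj W
      else (THE \<xi>. \<exists>\<gamma>. smooth_near A (0::real, 0::real) \<gamma> \<and>
        jet_of A k (\<lambda>t. \<gamma> (0, t)) = u \<and>
        velocity (jet_atlas A k \<iota>) (\<lambda>s. jet_of A k (\<lambda>t. \<gamma> (s, t))) 0 = W \<and>
        \<xi> = tv_scale (1 / fact \<alpha>)
             (((cov_deriv_along A D (\<lambda>t. \<gamma> (0, t))) ^^ \<alpha>)
                (\<lambda>t. velocity A (\<lambda>s. \<gamma> (s, t)) 0) 0)))"

definition sasaki ::
  "('a, 'e::euclidean_space) atlas \<Rightarrow> 'a metric_field \<Rightarrow> 'a conn \<Rightarrow> nat \<Rightarrow> ('i::finite \<Rightarrow> nat)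
    \<Rightarrow> 'a jet metric_field" where
  "sasaki A g D k \<iota> u W W' =
     (\<Sum>\<alpha>\<le>k. g (jet_proj u) (Kmap A D k \<iota> \<alpha> u W) (Kmap A D k \<iota> \<alpha> u W'))"

definition lift ::
  "('a, 'e::euclidean_space) atlas \<Rightarrow> 'a conn \<Rightarrow> nat \<Rightarrow> ('i::finite \<Rightarrow> nat)
    \<Rightarrow> nat \<Rightarrow> 'a vfield \<Rightarrow> 'a jet vfield" where
  "lift A D k \<iota> \<alpha> X = (THE V. V \<in> vector_fields (jet_atlas A k \<iota>) \<and>
     (\<forall>u\<in>jets A k. Kmap A D k \<iota> \<alpha> u (V u) = X (jet_proj u) \<and>
        (\<forall>\<beta>\<le>k. \<beta> \<noteq> \<alpha> \<longrightarrow> Kmap A D k \<iota> \<beta> u (V u) = tv_zero)))"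

end

theory Submission
  imports Defs "HOL-Computational_Algebra.Polynomial"
begin

text \<open>On the jet manifold, use as coordinates the derivatives \<open>y\<^sub>0, \<dots>, y\<^sub>k\<close> at \<open>0\<close> of a curve in a chart.
  Let \<open>\<Omega>\<^sub>j\<close> be the \<open>j\<close>-th covariant derivative along the curve of the differentials of the coordinate functions.
  The Leibniz rule for \<open>V \<mapsto> dx(V)\<close> shows that a tangent vector with components \<open>w\<close> satisfies
  \<open>w\<^sub>\<beta> = (\<Sum>j\<le>\<beta>. \<beta>!/(\<beta>-j)! \<Omega>\<^bsub>\<beta>-j\<^esub>(K\<^sub>j))\<close>. Hence the \<open>K\<^sub>j\<close> are well defined and jointly bijective, and
  the lift \<open>X\<^bsup>h\<alpha>\<^esup>\<close> has the explicit components \<open>\<beta>!/(\<beta>-\<alpha>)! \<Omega>\<^bsub>\<beta>-\<alpha>\<^esub>(X)\<close>. Since \<open>\<Omega>\<^sub>j\<close> only involves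
  \<open>y\<^sub>0, \<dots>, y\<^sub>j\<close>, and \<open>y\<^sub>j\<close> only through the term \<open>-\<Gamma>(y\<^sub>j, \<cdot>)\<close>, the bracket of \<open>X\<^bsup>h\<alpha>\<^esup>\<close> and \<open>Y\<^bsup>hk\<^esup>\<close>
  vanishes for \<open>\<alpha> \<ge> 1\<close> and is \<open>(\<nabla>\<^sub>X Y)\<^bsup>hk\<^esup>\<close> for \<open>\<alpha> = 0\<close>. The claim follows with the Koszul formula.\<close>

section \<open>Smooth maps between Euclidean spaces\<close>

text \<open>Lifts of different levels are orthogonal for the Sasaki metric, so pairing with the lift
  of level \<open>j\<close> of a field reads off \<open>K j\<close>. In the Koszul formula for a top
  lift differentiated along any lift and tested against a top lift, every bracket contains a top
  lift; the same holds for two top lifts tested against any lift. These cases give exactly the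
  claimed components and avoid brackets of lower lifts, where curvature enters. A second point
  shapes the text: tangent vectors act on globally defined functions, and connections on globally
  defined fields. Local computations on \<open>A\<close> therefore pass through cutoff functions
  that extend coordinates and coordinate fields from a small ball; Hausdorffness makes the
  extensions smooth. On the jets no cutoffs are built: the derivatives along curves of the cut-off
  coordinates of \<open>A\<close> are global functions there and serve as coordinates. That the
  bracket of two fields on the jets is tangent is taken from torsion-freeness of the given
  connection: it is a difference of two covariant derivatives.\<close>

abbreviation dd :: "('p::euclidean_space \<Rightarrow> 'b::real_normed_vector) \<Rightarrow> 'p \<Rightarrow> 'p \<Rightarrow> 'b" where
  "dd f x \<equiv> frechet_derivative f (at x)"

lemma dd_cong:
  assumes "open S" "x \<in> S" "\<And>y. y \<in> S \<Longrightarrow> f y = g y"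
  shows "dd f x = dd g x" "f differentiable (at x) \<longleftrightarrow> g differentiable (at x)"
proof -
  have "(f has_derivative D) (at x) \<longleftrightarrow> (g has_derivative D) (at x)" for D
    using has_derivative_transform_within_open[OF _ assms(1,2), of f D UNIV g]
      has_derivative_transform_within_open[OF _ assms(1,2), of g D UNIV f] assms(3) by auto
  then show "dd f x = dd g x" "f differentiable (at x) \<longleftrightarrow> g differentiable (at x)"
    by (simp_all add: frechet_derivative_def differentiable_def)
qed

lemma dd_has_derivative: "f differentiable (at x) \<Longrightarrow> (f has_derivative dd f x) (at x)"
  by (simp add: frechet_derivative_works)

lemma dd_eq: "(f has_derivative D) (at x) \<Longrightarrow> dd f x = D"
  using frechet_derivative_at by metis

lemma Ck_cong:
  assumes "open S" "\<And>x. x \<in> S \<Longrightarrow> f x = g x"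
  shows "Ck n S f \<longleftrightarrow> Ck n S g"
  using assms(2)
proof (induction n arbitrary: f g)
  case 0
  then show ?case using continuous_on_cong[OF refl, of S f g] by simp
next
  case (Suc n)
  have eq: "dd f x = dd g x" "f differentiable (at x) \<longleftrightarrow> g differentiable (at x)" if "x \<in> S" for x
    using dd_cong[OF assms(1) that] Suc.prems by blast+
  have "Ck n S (\<lambda>x. dd f x v) \<longleftrightarrow> Ck n S (\<lambda>x. dd g x v)" for v
    by (rule Suc.IH) (simp add: eq)
  then show ?case using eq by simp
qed

lemma Ck_subset: "Ck n S f \<Longrightarrow> T \<subseteq> S \<Longrightarrow> Ck n T f"
  by (induction n arbitrary: f) (auto intro: continuous_on_subset)

lemma Ck_SucD: "Ck (Suc n) S f \<Longrightarrow> Ck n S f"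
proof (induction n arbitrary: f)
  case 0
  then show ?case
    by (auto intro!: continuous_at_imp_continuous_on differentiable_imp_continuous_within)
next
  case (Suc n)
  from Suc.prems have f: "\<forall>x\<in>S. f differentiable (at x)" "\<And>v. Ck (Suc n) S (\<lambda>x. dd f x v)"
    unfolding Ck.simps(2)[of "Suc n"] by blast+
  show ?case
    unfolding Ck.simps(2)[of n] using f(1) Suc.IH[OF f(2)] by blast
qed

lemma Ck_differentiable: "Ck (Suc n) S f \<Longrightarrow> x \<in> S \<Longrightarrow> f differentiable (at x)"
  by simp

text \<open>Differentiability at a point and continuity on an open set are local conditions. This
  allows smoothness on a chart image to be checked on small balls, where cut-off coordinates agree
  with the true ones.\<close>

lemma Ck_local:
  assumes "\<And>x. x \<in> S \<Longrightarrow> \<exists>T. open T \<and> x \<in> T \<and> Ck n T f"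
  shows "Ck n S f"
  using assms
proof (induction n arbitrary: f)
  case 0
  show ?case unfolding Ck.simps
  proof (rule continuous_at_imp_continuous_on, rule ballI)
    fix x assume "x \<in> S"
    with 0 obtain T where "open T" "x \<in> T" "continuous_on T f" by auto
    then show "isCont f x" by (simp add: continuous_on_eq_continuous_at)
  qed
next
  case (Suc n)
  then have "f differentiable (at x)" if "x \<in> S" for x using that by fastforce
  moreover have "Ck n S (\<lambda>x. dd f x v)" for v
    using Suc.prems by (intro Suc.IH) force
  ultimately show ?case by simp
qed

text \<open>The induction step of all closure lemmas below: an explicit derivative formula is
  enough, provided that for each fixed direction it is \<open>Ck n\<close> in the point.\<close>

lemma Ck_SucI:
  assumes "open S" "\<And>x. x \<in> S \<Longrightarrow> (f has_derivative D x) (at x)" "\<And>v. Ck n S (\<lambda>x. D x v)"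
  shows "Ck (Suc n) S f"
proof -
  have "Ck n S (\<lambda>x. dd f x v)" for v
    by (rule iffD2[OF Ck_cong assms(3)]) (simp_all add: assms(1) dd_eq[OF assms(2)])
  then show ?thesis using differentiableI[OF assms(2)] by simp
qed

lemma Ck_const [simp]: "Ck n S (\<lambda>x. c)"
  by (induction n arbitrary: c) auto

lemma Ck_bounded_linear:
  assumes "bounded_linear L" "open S" "Ck n S f"
  shows "Ck n S (\<lambda>x. L (f x))"
  using assms(3)
proof (induction n arbitrary: f)
  case 0
  then show ?case using bounded_linear.continuous_on[OF assms(1)] by auto
next
  case (Suc n)
  have D: "((\<lambda>x. L (f x)) has_derivative (\<lambda>v. L (dd f x v))) (at x)" if "x \<in> S" for x
    by (rule bounded_linear.has_derivative[OF assms(1) dd_has_derivative[OF Ck_differentiable[OF Suc.prems that]]])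
  have "Ck n S (\<lambda>x. L (dd f x v))" for v using Suc by simp
  then show ?case using Ck_SucI[OF assms(2) D] by blast
qed

lemma Ck_add:
  assumes "open S" "Ck n S f" "Ck n S g"
  shows "Ck n S (\<lambda>x. f x + g x)"
  using assms(2,3)
proof (induction n arbitrary: f g)
  case 0
  then show ?case by (auto intro: continuous_intros)
next
  case (Suc n)
  have D: "((\<lambda>x. f x + g x) has_derivative (\<lambda>v. dd f x v + dd g x v)) (at x)" if "x \<in> S" for x
    using Suc.prems that by (intro has_derivative_add dd_has_derivative) auto
  have "Ck n S (\<lambda>x. dd f x v + dd g x v)" for v using Suc by simp
  then show ?case using Ck_SucI[OF assms(1) D] by blast
qed

lemma Ck_sum:
  assumes "open S" "\<And>i. i \<in> I \<Longrightarrow> Ck n S (f i)"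
  shows "Ck n S (\<lambda>x. \<Sum>i\<in>I. f i x)"
  using assms(2) by (induction I rule: infinite_finite_induct) (auto intro: Ck_add[OF assms(1)])

lemma Ck_bilinear:
  assumes P: "bounded_bilinear P" and "open S" "Ck n S f" "Ck n S g"
  shows "Ck n S (\<lambda>x. P (f x) (g x))"
  using assms(3,4)
proof (induction n arbitrary: f g)
  case 0
  then show ?case using bounded_bilinear.continuous_on[OF P] by auto
next
  case (Suc n)
  have D: "((\<lambda>x. P (f x) (g x)) has_derivative (\<lambda>v. P (f x) (dd g x v) + P (dd f x v) (g x))) (at x)"
    if "x \<in> S" for x
    by (rule bounded_bilinear.FDERIV[OF P] dd_has_derivative Ck_differentiable Suc.prems that)+
  have "Ck n S (\<lambda>x. P (f x) (dd g x v) + P (dd f x v) (g x))" for v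
    using Suc.prems Suc.prems[THEN Ck_SucD] by (intro Ck_add[OF assms(2)] Suc.IH) auto
  then show ?case using Ck_SucI[OF assms(2) D] by blast
qed

lemma dd_linear: "f differentiable (at x) \<Longrightarrow> linear (dd f x)"
  using dd_has_derivative has_derivative_linear by blast

lemma dd_basis:
  assumes "f differentiable (at x)"
  shows "dd f x v = (\<Sum>b\<in>Basis. (v \<bullet> b) *\<^sub>R dd f x b)"
proof -
  interpret linear "dd f x" using dd_linear[OF assms] .
  have "dd f x v = dd f x (\<Sum>b\<in>Basis. (v \<bullet> b) *\<^sub>R b)" by (simp add: euclidean_representation)
  then show ?thesis by (simp add: sum scale)
qed

text \<open>In the chain rule the direction \<open>dd f x v\<close> varies with \<open>x\<close>,
  whereas \<open>Ck\<close> speaks of fixed directions. Expanding it in the basis leaves products of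
  scalars with \<open>dd g (f x) b\<close> for fixed \<open>b\<close>, to which the induction
  hypothesis applies.\<close>

lemma Ck_compose:
  fixes f :: "'p::euclidean_space \<Rightarrow> 'q::euclidean_space" and g :: "'q \<Rightarrow> 'b::real_normed_vector"
  assumes "open S" "open T" "f ` S \<subseteq> T" "Ck n T g" "Ck n S f"
  shows "Ck n S (\<lambda>x. g (f x))"
  using assms(4,5)
proof (induction n arbitrary: g)
  case 0
  then show ?case using continuous_on_compose2[of T g S f] assms(3) by auto
next
  case (Suc n)
  have D: "((\<lambda>x. g (f x)) has_derivative (\<lambda>v. \<Sum>b\<in>Basis. (dd f x v \<bullet> b) *\<^sub>R dd g (f x) b)) (at x)"
    if "x \<in> S" for x
  proof -
    have f: "f differentiable (at x)" and g: "g differentiable (at (f x))"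
      using Suc.prems that assms(3) by auto
    have "((\<lambda>x. g (f x)) has_derivative (\<lambda>v. dd g (f x) (dd f x v))) (at x)"
      using has_derivative_compose[OF dd_has_derivative[OF f] dd_has_derivative[OF g]] .
    moreover have "(\<lambda>v. dd g (f x) (dd f x v)) = (\<lambda>v. \<Sum>b\<in>Basis. (dd f x v \<bullet> b) *\<^sub>R dd g (f x) b)"
      by (rule ext, rule dd_basis[OF g])
    ultimately show ?thesis by simp
  qed
  have "Ck n S (\<lambda>x. \<Sum>b\<in>Basis. (dd f x v \<bullet> b) *\<^sub>R dd g (f x) b)" for v
    using Suc.prems
    by (intro Ck_sum Ck_bilinear[OF bounded_bilinear_scaleR] Suc.IH assms(1)
        Ck_bounded_linear[OF bounded_linear_inner_left] Ck_SucD[OF Suc.prems(2)]) auto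
  then show ?case using Ck_SucI[OF assms(1) D] by blast
qed

lemma Ck_inverse:
  fixes f :: "'p::euclidean_space \<Rightarrow> real"
  assumes "open S" "\<And>x. x \<in> S \<Longrightarrow> f x \<noteq> 0" "Ck n S f"
  shows "Ck n S (\<lambda>x. inverse (f x))"
  using assms(3)
proof (induction n)
  case 0
  then show ?case using assms(2) by (auto intro: continuous_intros)
next
  case (Suc n)
  have D: "((\<lambda>x. inverse (f x)) has_derivative (\<lambda>v. - (inverse (f x) * dd f x v * inverse (f x)))) (at x)"
    if "x \<in> S" for x
    using Deriv.has_derivative_inverse[OF assms(2)[OF that] dd_has_derivative[OF Ck_differentiable[OF Suc.prems that]]] .
  have "Ck n S (\<lambda>x. - (inverse (f x) * dd f x v * inverse (f x)))" for v
    using Suc.prems Suc.IH[OF Ck_SucD[OF Suc.prems]]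
    by (intro Ck_bounded_linear[OF bounded_linear_minus[OF bounded_linear_ident]]
       Ck_bilinear[OF bounded_bilinear_mult] assms(1)) auto
  then show ?case using Ck_SucI[OF assms(1) D] by blast
qed

lemma smooth_onI: "(\<And>n. Ck n S f) \<Longrightarrow> smooth_on S f"
  by (simp add: smooth_on_def)

lemma smooth_onD: "smooth_on S f \<Longrightarrow> Ck n S f"
  by (simp add: smooth_on_def)

lemma smooth_on_cong:
  "open S \<Longrightarrow> (\<And>x. x \<in> S \<Longrightarrow> f x = g x) \<Longrightarrow> smooth_on S f \<longleftrightarrow> smooth_on S g"
  unfolding smooth_on_def using Ck_cong by blast

lemma smooth_on_subset: "smooth_on S f \<Longrightarrow> T \<subseteq> S \<Longrightarrow> smooth_on T f"
  unfolding smooth_on_def using Ck_subset by blast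

lemma smooth_on_local:
  "(\<And>x. x \<in> S \<Longrightarrow> \<exists>T. open T \<and> x \<in> T \<and> smooth_on T f) \<Longrightarrow> smooth_on S f"
  unfolding smooth_on_def by (meson Ck_local)

lemma smooth_on_differentiable: "smooth_on S f \<Longrightarrow> x \<in> S \<Longrightarrow> f differentiable (at x)"
  using smooth_onD Ck_differentiable by blast

lemma smooth_on_continuous: "smooth_on S f \<Longrightarrow> continuous_on S f"
  using smooth_onD[of S f 0] by simp

lemma smooth_on_const [simp]: "smooth_on S (\<lambda>x. c)"
  by (simp add: smooth_on_def)

lemma smooth_on_bounded_linear:
  "bounded_linear L \<Longrightarrow> open S \<Longrightarrow> smooth_on S f \<Longrightarrow> smooth_on S (\<lambda>x. L (f x))"
  by (simp add: smooth_on_def Ck_bounded_linear)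

lemma smooth_on_id [simp]: "smooth_on S (\<lambda>x. x)"
proof (rule smooth_onI)
  fix n show "Ck n S (\<lambda>x. x)"
  proof (cases n)
    case (Suc m)
    have "dd (\<lambda>x. x) x = (\<lambda>v. v)" for x :: 'a by (rule dd_eq) simp
    then show ?thesis using Suc by simp
  qed simp
qed

lemma smooth_on_linear: "bounded_linear L \<Longrightarrow> open S \<Longrightarrow> smooth_on S L"
  using smooth_on_bounded_linear[of L S "\<lambda>x. x"] by simp

lemma smooth_on_add:
  "open S \<Longrightarrow> smooth_on S f \<Longrightarrow> smooth_on S g \<Longrightarrow> smooth_on S (\<lambda>x. f x + g x)"
  by (simp add: smooth_on_def Ck_add)

lemma smooth_on_sum:
  "open S \<Longrightarrow> (\<And>i. i \<in> I \<Longrightarrow> smooth_on S (f i)) \<Longrightarrow> smooth_on S (\<lambda>x. \<Sum>i\<in>I. f i x)"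
  by (simp add: smooth_on_def Ck_sum)

lemma smooth_on_bilinear:
  "bounded_bilinear P \<Longrightarrow> open S \<Longrightarrow> smooth_on S f \<Longrightarrow> smooth_on S g \<Longrightarrow>
    smooth_on S (\<lambda>x. P (f x) (g x))"
  by (simp add: smooth_on_def Ck_bilinear)

lemmas smooth_on_scaleR = smooth_on_bilinear[OF bounded_bilinear_scaleR]
  and smooth_on_mult = smooth_on_bilinear[OF bounded_bilinear_mult]
  and smooth_on_inner = smooth_on_bilinear[OF bounded_bilinear_inner]
  and smooth_on_uminus = smooth_on_bounded_linear[OF bounded_linear_minus[OF bounded_linear_ident]]

lemma smooth_on_diff:
  "open S \<Longrightarrow> smooth_on S f \<Longrightarrow> smooth_on S g \<Longrightarrow> smooth_on S (\<lambda>x. f x - g x)"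
  using smooth_on_add[of S f "\<lambda>x. - g x"] smooth_on_uminus[of S g] by simp

lemma smooth_on_compose:
  fixes f :: "'p::euclidean_space \<Rightarrow> 'q::euclidean_space" and g :: "'q \<Rightarrow> 'b::real_normed_vector"
  shows "smooth_on T g \<Longrightarrow> smooth_on S f \<Longrightarrow> open S \<Longrightarrow> open T \<Longrightarrow> f ` S \<subseteq> T \<Longrightarrow>
    smooth_on S (\<lambda>x. g (f x))"
  by (simp add: smooth_on_def Ck_compose)

lemma smooth_on_inverse:
  fixes f :: "'p::euclidean_space \<Rightarrow> real"
  shows "open S \<Longrightarrow> (\<And>x. x \<in> S \<Longrightarrow> f x \<noteq> 0) \<Longrightarrow> smooth_on S f \<Longrightarrow> smooth_on S (\<lambda>x. inverse (f x))"
  by (simp add: smooth_on_def Ck_inverse)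

lemma smooth_on_power:
  fixes f :: "'p::euclidean_space \<Rightarrow> real"
  shows "open S \<Longrightarrow> smooth_on S f \<Longrightarrow> smooth_on S (\<lambda>x. f x ^ n)"
  by (induction n) (auto intro: smooth_on_mult)

lemma bounded_linear_axis: "bounded_linear (\<lambda>v. axis i v :: 'b::real_normed_vector ^ 'i::finite)"
proof (rule bounded_linear_intro[where K = 1])
  show "norm (axis i x :: 'b ^ 'i) \<le> norm x * 1" for x :: 'b
    by (simp add: norm_vec_def L2_set_def axis_def if_distrib[of norm] if_distrib[of "\<lambda>a. a\<^sup>2"] sum.delta cong: if_cong)
qed (simp_all add: axis_def vec_eq_iff)

text \<open>Reduces statements about vectors of functions to sums and the bounded linear maps
  \<open>axis i\<close>.\<close>

lemma vec_lambda_eq_sum_axis: "(\<chi> i. v i) = (\<Sum>i\<in>UNIV. axis i (v i))"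
  by (simp add: vec_eq_iff axis_def if_distrib sum.delta cong: if_cong)

lemma smooth_on_vec_lambda:
  fixes f :: "'i::finite \<Rightarrow> 'p::euclidean_space \<Rightarrow> 'b::real_normed_vector"
  assumes "open S" "\<And>i. smooth_on S (f i)"
  shows "smooth_on S (\<lambda>x. \<chi> i. f i x)"
  unfolding vec_lambda_eq_sum_axis
  by (intro smooth_on_sum smooth_on_bounded_linear[OF bounded_linear_axis] assms)

lemma has_vector_derivative_vec_lambda:
  fixes f :: "'i::finite \<Rightarrow> real \<Rightarrow> 'b::real_normed_vector"
  assumes "\<And>i. (f i has_vector_derivative f' i) (at t)"
  shows "((\<lambda>t. \<chi> i. f i t) has_vector_derivative (\<chi> i. f' i)) (at t)"
  unfolding vec_lambda_eq_sum_axis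
  by (intro has_vector_derivative_sum bounded_linear.has_vector_derivative[OF bounded_linear_axis] assms)

lemma smooth_on_vec_nth: "open S \<Longrightarrow> smooth_on S f \<Longrightarrow> smooth_on S (\<lambda>x. f x $ i)"
  by (rule smooth_on_bounded_linear[OF bounded_linear_vec_nth])

lemma smooth_on_euclidean:
  fixes f :: "'p::euclidean_space \<Rightarrow> 'b::euclidean_space"
  assumes "open S" "\<And>b. b \<in> Basis \<Longrightarrow> smooth_on S (\<lambda>x. f x \<bullet> b)"
  shows "smooth_on S f"
proof -
  have "smooth_on S (\<lambda>x. \<Sum>b\<in>Basis. (f x \<bullet> b) *\<^sub>R b)"
    using assms by (intro smooth_on_sum smooth_on_scaleR) auto
  then show ?thesis by (simp add: euclidean_representation)
qed

lemma smooth_on_Pair: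
  assumes "open S" "smooth_on S f" "smooth_on S g"
  shows "smooth_on S (\<lambda>x. (f x, g x))"
proof -
  have "smooth_on S (\<lambda>x. (f x, 0) + (0, g x))"
    using smooth_on_bounded_linear[OF bounded_linear_Pair[OF bounded_linear_ident bounded_linear_zero] assms(1,2)]
      smooth_on_bounded_linear[OF bounded_linear_Pair[OF bounded_linear_zero bounded_linear_ident] assms(1,3)]
    by (intro smooth_on_add assms(1))
  then show ?thesis by simp
qed

lemma smooth_on_dd_const: "smooth_on S f \<Longrightarrow> smooth_on S (\<lambda>x. dd f x v)"
  unfolding smooth_on_def using Ck.simps(2) by blast

lemma smooth_on_dd:
  assumes "open S" "smooth_on S f" "smooth_on S v"
  shows "smooth_on S (\<lambda>x. dd f x (v x))"
proof -
  have "smooth_on S (\<lambda>x. \<Sum>b\<in>Basis. (v x \<bullet> b) *\<^sub>R dd f x b)"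
    using assms
    by (intro smooth_on_sum smooth_on_scaleR smooth_on_dd_const
        smooth_on_bounded_linear[OF bounded_linear_inner_left]) auto
  then show ?thesis
    by (rule iffD2[OF smooth_on_cong[OF assms(1) dd_basis[OF smooth_on_differentiable[OF assms(2)]]], rotated])
qed

lemma dd_compose:
  assumes "g differentiable (at (f x))" "f differentiable (at x)"
  shows "dd (\<lambda>x. g (f x)) x v = dd g (f x) (dd f x v)"
  using dd_eq[OF has_derivative_compose[OF assms(2,1)[THEN dd_has_derivative]]] by simp

lemma dd_inner:
  assumes "f differentiable (at x)"
  shows "dd (\<lambda>x. f x \<bullet> b) x v = dd f x v \<bullet> b"
  using dd_eq[OF has_derivative_inner_left[OF dd_has_derivative[OF assms]]] by simp

lemma vector_derivative_compose_dd:
  fixes c :: "real \<Rightarrow> 'p::euclidean_space"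
  assumes "F differentiable (at (c t))" "(c has_vector_derivative c') (at t)"
  shows "((\<lambda>t. F (c t)) has_vector_derivative dd F (c t) c') (at t)"
proof -
  have "((\<lambda>t. F (c t)) has_derivative (\<lambda>h. dd F (c t) (h *\<^sub>R c'))) (at t)"
    using has_derivative_compose[OF assms(2)[unfolded has_vector_derivative_def] dd_has_derivative[OF assms(1)]] .
  then show ?thesis
    using linear_scale[OF dd_linear[OF assms(1)]] by (simp add: has_vector_derivative_def)
qed

lemma smooth_on_vderiv:
  fixes c :: "real \<Rightarrow> 'b::real_normed_vector"
  assumes "smooth_on S c" "t \<in> S"
  shows "(c has_vector_derivative dd c t 1) (at t)" "vector_derivative c (at t) = dd c t 1"
proof -
  have d: "c differentiable (at t)" using smooth_on_differentiable[OF assms] .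
  have "dd c t h = h *\<^sub>R dd c t 1" for h
    using linear_scale[OF dd_linear[OF d], of h 1] by (simp only: real_scaleR_def mult_1_right)
  then have "(c has_derivative (\<lambda>h. h *\<^sub>R dd c t 1)) (at t)"
    by (rule subst[of "dd c t" "\<lambda>h. h *\<^sub>R dd c t 1" "\<lambda>D. (c has_derivative D) (at t)", OF ext dd_has_derivative[OF d]])
  then show "(c has_vector_derivative dd c t 1) (at t)" by (simp add: has_vector_derivative_def)
  then show "vector_derivative c (at t) = dd c t 1" by (rule vector_derivative_at)
qed

lemma smooth_on_vector_derivative:
  fixes c :: "real \<Rightarrow> 'b::real_normed_vector"
  assumes "open S" "smooth_on S c"
  shows "smooth_on S (\<lambda>t. vector_derivative c (at t))"
  by (rule iffD2[OF smooth_on_cong[OF assms(1) smooth_on_vderiv(2)[OF assms(2)]] smooth_on_dd_const[OF assms(2)]])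

section \<open>Mixed partial derivatives, bump functions and curves\<close>

lemma dd_line:
  fixes f :: "'p::euclidean_space \<Rightarrow> real"
  assumes "f differentiable (at (a + s *\<^sub>R v))"
  shows "((\<lambda>s. f (a + s *\<^sub>R v)) has_real_derivative dd f (a + s *\<^sub>R v) v) (at s)"
proof -
  have "((\<lambda>s. a + s *\<^sub>R v) has_vector_derivative v) (at s)"
    by (auto intro!: derivative_eq_intros)
  from vector_derivative_compose_dd[OF assms this] show ?thesis
    by (simp add: has_real_derivative_iff_has_vector_derivative)
qed

text \<open>The mean value theorem is applied twice: in \<open>s\<close> to the increment of
  \<open>f\<close> by \<open>h *\<^sub>R w\<close>, then in \<open>t\<close> to the resulting
  derivative. Exchanging \<open>v\<close> and \<open>w\<close> leaves the second difference
  unchanged, which is the source of symmetry.\<close>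

lemma second_difference_mean_value:
  fixes f :: "'p::euclidean_space \<Rightarrow> real"
  assumes f: "smooth_on S f" and h: "h > 0"
    and S: "\<And>s t. 0 \<le> s \<Longrightarrow> s \<le> h \<Longrightarrow> 0 \<le> t \<Longrightarrow> t \<le> h \<Longrightarrow> x + s *\<^sub>R v + t *\<^sub>R w \<in> S"
  shows "\<exists>s t. 0 < s \<and> s < h \<and> 0 < t \<and> t < h \<and>
    f (x + h *\<^sub>R v + h *\<^sub>R w) - f (x + h *\<^sub>R v) - f (x + h *\<^sub>R w) + f x
      = h * h * dd (\<lambda>y. dd f y v) (x + s *\<^sub>R v + t *\<^sub>R w) w"
proof -
  have d: "f differentiable (at (x + s *\<^sub>R v + t *\<^sub>R w))"
    "(\<lambda>y. dd f y v) differentiable (at (x + s *\<^sub>R v + t *\<^sub>R w))"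
    if "0 \<le> s" "s \<le> h" "0 \<le> t" "t \<le> h" for s t
    using smooth_on_differentiable[OF f S] smooth_on_differentiable[OF smooth_on_dd_const[OF f] S] that
    by blast+
  have "((\<lambda>s. f (x + s *\<^sub>R v + h *\<^sub>R w) - f (x + s *\<^sub>R v)) has_real_derivative
      dd f (x + s *\<^sub>R v + h *\<^sub>R w) v - dd f (x + s *\<^sub>R v) v) (at s)"
    if "0 \<le> s" "s \<le> h" for s
    using dd_line[of f "x + h *\<^sub>R w" s v] dd_line[of f x s v] d(1)[of s h] d(1)[of s 0] that h
    by (intro DERIV_diff) (simp_all add: algebra_simps)
  from MVT2[OF h this] obtain s where s: "0 < s" "s < h"
    "f (x + h *\<^sub>R v + h *\<^sub>R w) - f (x + h *\<^sub>R v) - (f (x + h *\<^sub>R w) - f x)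
      = h * (dd f (x + s *\<^sub>R v + h *\<^sub>R w) v - dd f (x + s *\<^sub>R v) v)"
    by auto
  have "((\<lambda>t. dd f (x + s *\<^sub>R v + t *\<^sub>R w) v) has_real_derivative
      dd (\<lambda>y. dd f y v) (x + s *\<^sub>R v + t *\<^sub>R w) w) (at t)"
    if "0 \<le> t" "t \<le> h" for t
    using dd_line[of "\<lambda>y. dd f y v" "x + s *\<^sub>R v" t w] d(2)[of s t] that s by simp
  from MVT2[OF h this] obtain t where t: "0 < t" "t < h"
    "dd f (x + s *\<^sub>R v + h *\<^sub>R w) v - dd f (x + s *\<^sub>R v) v
      = h * dd (\<lambda>y. dd f y v) (x + s *\<^sub>R v + t *\<^sub>R w) w" by auto
  show ?thesis using s t by (intro exI[of _ s] exI[of _ t]) simp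
qed

text \<open>Schwarz's theorem: both mixed derivatives take the same value, the second difference
  quotient, at points arbitrarily close to \<open>x\<close>, and both are continuous at
  \<open>x\<close>.\<close>

lemma dd_symmetric_real:
  fixes f :: "'p::euclidean_space \<Rightarrow> real"
  assumes "open S" "smooth_on S f" "x \<in> S"
  shows "dd (\<lambda>y. dd f y v) x w = dd (\<lambda>y. dd f y w) x v"
proof -
  define A where "A v w y = dd (\<lambda>y. dd f y v) y w" for v w y
  have "\<bar>A v w x - A w v x\<bar> \<le> e" if "e > 0" for e
  proof -
    have near: "\<exists>d>0. \<forall>y. dist y x < d \<longrightarrow> y \<in> S \<and> \<bar>A v w y - A v w x\<bar> < e / 2" for v w
    proof -
      have "isCont (A v w) x"
        using smooth_on_continuous[OF smooth_on_dd_const[OF smooth_on_dd_const[OF assms(2)]]]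
          assms(1,3) unfolding A_def by (simp add: continuous_on_eq_continuous_at)
      then obtain d1 where "d1 > 0" "\<forall>y. dist y x < d1 \<longrightarrow> dist (A v w y) (A v w x) < e / 2"
        using \<open>e > 0\<close> unfolding continuous_at_eps_delta by (meson half_gt_zero)
      moreover obtain d2 where "d2 > 0" "\<forall>y. dist y x < d2 \<longrightarrow> y \<in> S"
        using assms(1,3) by (auto simp: open_dist)
      ultimately show ?thesis by (intro exI[of _ "min d1 d2"]) (auto simp: dist_real_def)
    qed
    obtain d1 where d1: "d1 > 0" "\<And>y. dist y x < d1 \<Longrightarrow> y \<in> S \<and> \<bar>A v w y - A v w x\<bar> < e / 2"
      using near by blast
    obtain d2 where d2: "d2 > 0" "\<And>y. dist y x < d2 \<Longrightarrow> y \<in> S \<and> \<bar>A w v y - A w v x\<bar> < e / 2"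
      using near by blast
    define d where "d = min d1 d2"
    \<comment> \<open>Chosen so that the whole parallelogram of side \<open>h\<close> lies within
      distance \<open>d\<close> of \<open>x\<close>; the added 1 makes the bound strict and covers
      \<open>v = w = 0\<close>.\<close>
    define h where "h = d / (norm v + norm w + 1)"
    have nz: "norm v + norm w + 1 > 0" using norm_ge_zero[of v] norm_ge_zero[of w] by linarith
    have h: "h > 0" using d1 d2 nz by (simp add: h_def d_def)
    have close: "dist (x + s *\<^sub>R v + t *\<^sub>R w) x < d" if "0 \<le> s" "s \<le> h" "0 \<le> t" "t \<le> h" for s t
    proof -
      have "dist (x + s *\<^sub>R v + t *\<^sub>R w) x = norm (s *\<^sub>R v + t *\<^sub>R w)" by (simp add: dist_norm add.assoc)
      also have "\<dots> \<le> s * norm v + t * norm w"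
        using norm_triangle_ineq[of "s *\<^sub>R v" "t *\<^sub>R w"] that by simp
      also have "\<dots> \<le> h * norm v + h * norm w"
        using that by (intro add_mono mult_right_mono) auto
      also have "\<dots> < h * (norm v + norm w + 1)" using h by (simp add: algebra_simps)
      also have "\<dots> = d" using nz by (simp add: h_def)
      finally show ?thesis .
    qed
    have close': "dist (x + s *\<^sub>R w + t *\<^sub>R v) x < d" if "0 \<le> s" "s \<le> h" "0 \<le> t" "t \<le> h" for s t
      using close[of t s] that by (simp add: algebra_simps)
    obtain s t where st: "0 < s" "s < h" "0 < t" "t < h"
      "f (x + h *\<^sub>R v + h *\<^sub>R w) - f (x + h *\<^sub>R v) - f (x + h *\<^sub>R w) + f x
        = h * h * A v w (x + s *\<^sub>R v + t *\<^sub>R w)"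
      using second_difference_mean_value[OF assms(2) h, of x v w] close d1(2) unfolding A_def d_def
      by (metis (no_types, lifting) min_less_iff_conj)
    obtain s' t' where st': "0 < s'" "s' < h" "0 < t'" "t' < h"
      "f (x + h *\<^sub>R w + h *\<^sub>R v) - f (x + h *\<^sub>R w) - f (x + h *\<^sub>R v) + f x
        = h * h * A w v (x + s' *\<^sub>R w + t' *\<^sub>R v)"
      using second_difference_mean_value[OF assms(2) h, of x w v] close' d1(2) unfolding A_def d_def
      by (metis (no_types, lifting) min_less_iff_conj)
    have "h * h * A v w (x + s *\<^sub>R v + t *\<^sub>R w) = h * h * A w v (x + s' *\<^sub>R w + t' *\<^sub>R v)"
      using st(5) st'(5) by (simp add: algebra_simps)
    then have "A v w (x + s *\<^sub>R v + t *\<^sub>R w) = A w v (x + s' *\<^sub>R w + t' *\<^sub>R v)" using h by simp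
    moreover have "\<bar>A v w (x + s *\<^sub>R v + t *\<^sub>R w) - A v w x\<bar> < e / 2"
      using close[of s t] st d1(2) by (simp add: d_def)
    moreover have "\<bar>A w v (x + s' *\<^sub>R w + t' *\<^sub>R v) - A w v x\<bar> < e / 2"
      using close'[of s' t'] st' d2(2) by (simp add: d_def)
    ultimately show ?thesis by linarith
  qed
  then have "\<bar>A v w x - A w v x\<bar> \<le> 0" by (rule field_le_epsilon) simp
  then show ?thesis by (simp add: A_def)
qed

lemma dd_symmetric:
  fixes f :: "'p::euclidean_space \<Rightarrow> 'b::euclidean_space"
  assumes "open S" "smooth_on S f" "x \<in> S"
  shows "dd (\<lambda>y. dd f y v) x w = dd (\<lambda>y. dd f y w) x v"
proof (rule euclidean_eqI)
  fix b :: 'b assume "b \<in> Basis"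
  have eq: "dd (\<lambda>y. dd f y v) x w \<bullet> b = dd (\<lambda>y. dd (\<lambda>z. f z \<bullet> b) y v) x w" for v w
  proof -
    have "dd (\<lambda>y. dd f y v) x w \<bullet> b = dd (\<lambda>y. dd f y v \<bullet> b) x w"
      by (rule dd_inner[symmetric]) (rule smooth_on_differentiable[OF smooth_on_dd_const[OF assms(2)] assms(3)])
    also have "\<dots> = dd (\<lambda>y. dd (\<lambda>z. f z \<bullet> b) y v) x w"
      by (rule fun_cong[OF dd_cong(1)[OF assms(1,3)]])
        (simp add: dd_inner smooth_on_differentiable[OF assms(2)])
    finally show ?thesis .
  qed
  have "smooth_on S (\<lambda>z. f z \<bullet> b)"
    by (rule smooth_on_bounded_linear[OF bounded_linear_inner_left assms(1,2)])
  from dd_symmetric_real[OF assms(1) this assms(3)] show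
    "dd (\<lambda>y. dd f y v) x w \<bullet> b = dd (\<lambda>y. dd f y w) x v \<bullet> b" unfolding eq .
qed

text \<open>The space of these functions is closed under differentiation, whence smoothness at \<open>0\<close>.\<close>

definition flat :: "real poly \<Rightarrow> real \<Rightarrow> real" where
  "flat p x = (if x > 0 then poly p (1 / x) * exp (- (1 / x)) else 0)"

lemma flat_tendsto_0: "(flat p \<longlongrightarrow> 0) (at 0)"
proof -
  have "((\<lambda>x. poly p x * exp (- x)) \<longlongrightarrow> 0) at_top"
  proof -
    have "((\<lambda>x. \<Sum>i\<le>degree p. coeff p i * (x ^ i / exp x)) \<longlongrightarrow> (\<Sum>i\<le>degree p. coeff p i * 0)) at_top"
      by (intro tendsto_sum tendsto_mult tendsto_const tendsto_power_div_exp_0)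
    then show ?thesis
      by (simp add: poly_altdef exp_minus divide_inverse sum_distrib_right mult.assoc)
  qed
  then have "((\<lambda>x. poly p (1 / x) * exp (- (1 / x))) \<longlongrightarrow> 0) (at_right 0)"
    using filterlim_compose[OF _ filterlim_inverse_at_top_right] by (simp add: divide_inverse)
  then have "(flat p \<longlongrightarrow> 0) (at_right 0)"
    by (rule Lim_transform_eventually) (auto simp: flat_def intro: eventually_mono[OF eventually_at_right_less])
  moreover have "(flat p \<longlongrightarrow> 0) (at_left 0)"
    by (rule Lim_transform_eventually[OF tendsto_const])
      (auto simp: flat_def eventually_at_filter)
  ultimately show ?thesis by (simp add: filterlim_at_split)
qed

text \<open>With \<open>s = 1 / x\<close> the derivative for \<open>x > 0\<close> is
  \<open>s^2 * (p(s) - p'(s)) * exp (-s)\<close>, and \<open>[:0, 0, 1:]\<close> is the square of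
  the variable.\<close>

lemma flat_deriv: "(flat p has_real_derivative flat ([:0, 0, 1:] * (p - pderiv p)) x) (at x)"
proof -
  consider "x > 0" | "x < 0" | "x = 0" by linarith
  then show ?thesis
  proof cases
    case 1
    have "((\<lambda>x. poly p (1 / x) * exp (- (1 / x))) has_real_derivative
        flat ([:0, 0, 1:] * (p - pderiv p)) x) (at x)"
      using 1 by (auto simp: flat_def field_simps power2_eq_square
          intro!: derivative_eq_intros DERIV_chain'[of "\<lambda>x. 1 / x" _ _ _ "poly p"])
    then show ?thesis
      by (rule has_field_derivative_transform_within_open[where S = "{0<..}"]) (use 1 in \<open>auto simp: flat_def\<close>)
  next
    case 2
    have "((\<lambda>x. 0) has_real_derivative flat ([:0, 0, 1:] * (p - pderiv p)) x) (at x)"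
      using 2 by (simp add: flat_def)
    then show ?thesis
      by (rule has_field_derivative_transform_within_open[where S = "{..<0}"]) (use 2 in \<open>auto simp: flat_def\<close>)
  next
    case 3
    \<comment> \<open>At 0 the difference quotient is again a function of this kind: dividing by
      \<open>h\<close> multiplies the polynomial in \<open>1 / h\<close> by its variable.\<close>
    have "flat (pCons 0 p) = (\<lambda>h. (flat p (0 + h) - flat p 0) / h)"
      by (auto simp: flat_def)
    then have "((\<lambda>h. (flat p (0 + h) - flat p 0) / h) \<longlongrightarrow> 0) (at 0)"
      using flat_tendsto_0[of "pCons 0 p"] by (simp only:)
    then show ?thesis unfolding 3 by (simp add: DERIV_def flat_def)
  qed
qed

lemma smooth_on_flat: "smooth_on S (flat p)"
proof (rule smooth_onI)
  fix n have "Ck n UNIV (flat p)"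
  proof (induction n arbitrary: p)
    case 0
    have "isCont (flat p) x" for x using DERIV_isCont[OF flat_deriv] .
    then show ?case by (simp add: continuous_at_imp_continuous_on)
  next
    case (Suc n)
    have "Ck n UNIV (\<lambda>x. flat ([:0, 0, 1:] * (p - pderiv p)) x * v)" for v
      by (rule Ck_bounded_linear[OF bounded_linear_mult_left open_UNIV Suc])
    then show ?case
      by (rule Ck_SucI[OF open_UNIV flat_deriv[unfolded has_field_derivative_def]])
  qed
  then show "Ck n S (flat p)" by (rule Ck_subset) simp
qed

lemma bump_function:
  fixes x0 :: "'p::euclidean_space"
  assumes r: "r > 0"
  obtains \<eta> :: "'p \<Rightarrow> real" where "smooth_on UNIV \<eta>" "\<And>x. x \<in> ball x0 r \<Longrightarrow> \<eta> x = 1"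
    "\<And>x. x \<notin> ball x0 (2 * r) \<Longrightarrow> \<eta> x = 0"
proof -
  define n where "n x = (x - x0) \<bullet> (x - x0)" for x
  \<comment> \<open>\<open>u\<close> is positive exactly at distance less than \<open>2 * r\<close>
    from \<open>x0\<close>, and \<open>w\<close> exactly at distance greater than \<open>r\<close>.
    Hence \<open>u + w\<close> never vanishes and \<open>u / (u + w)\<close> is the cutoff. The
    squared distance is used because it is smooth at \<open>x0\<close>.\<close>
  define u w where "u x = flat 1 (4 * r\<^sup>2 - n x)" and "w x = flat 1 (n x - r\<^sup>2)" for x
  have n: "smooth_on UNIV n" unfolding n_def
    by (intro smooth_on_inner smooth_on_diff) auto
  have u: "smooth_on UNIV u" and w: "smooth_on UNIV w" unfolding u_def w_def
    by (intro smooth_on_compose[OF smooth_on_flat[of UNIV]] smooth_on_diff n; simp)+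
  have pos: "u x + w x \<noteq> 0" for x
  proof -
    have "0 < 4 * r\<^sup>2 - n x \<or> 0 < n x - r\<^sup>2" using r by (smt (verit) zero_less_power)
    then show ?thesis by (auto simp: u_def w_def flat_def add_pos_pos[THEN less_imp_neq[THEN not_sym]] less_imp_neq[THEN not_sym])
  qed
  have nn: "n x = (dist x0 x)\<^sup>2" for x by (simp add: n_def dist_norm norm_minus_commute dot_square_norm)
  show thesis
  proof
    show "smooth_on UNIV (\<lambda>x. u x * inverse (u x + w x))"
      using pos by (intro smooth_on_mult smooth_on_inverse smooth_on_add u w) auto
    fix x
    show "u x * inverse (u x + w x) = 1" if "x \<in> ball x0 r"
    proof -
      have "n x \<le> r\<^sup>2" unfolding nn using that by (simp add: power_mono)
      then have "w x = 0" by (simp add: w_def flat_def)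
      then show ?thesis using pos[of x] by simp
    qed
    show "u x * inverse (u x + w x) = 0" if "x \<notin> ball x0 (2 * r)"
    proof -
      have "(2 * r)\<^sup>2 \<le> n x" unfolding nn using that r by (intro power_mono) auto
      then show ?thesis by (simp add: u_def flat_def power_mult_distrib)
    qed
  qed
qed

section \<open>Iterated derivatives of curves and families, Taylor polynomials\<close>

lemma higher_vderiv_0 [simp]: "higher_vderiv 0 f = f"
  by (simp add: higher_vderiv_def)

lemma higher_vderiv_Suc: "higher_vderiv (Suc n) f t = vector_derivative (higher_vderiv n f) (at t)"
  by (simp add: higher_vderiv_def)

lemma vector_derivative_cong_open:
  assumes "open S" "t \<in> S" "\<And>r. r \<in> S \<Longrightarrow> f r = g r"
  shows "vector_derivative f (at t) = vector_derivative g (at t)"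
  using assms by (intro vector_derivative_cong_eq) (auto simp: eventually_nhds)

lemma higher_vderiv_cong:
  assumes "open S" "t \<in> S" "\<And>r. r \<in> S \<Longrightarrow> f r = g r"
  shows "higher_vderiv n f t = higher_vderiv n g t"
  using assms(2)
proof (induction n arbitrary: t)
  case 0
  then show ?case using assms(3) by simp
next
  case (Suc n)
  then show ?case unfolding higher_vderiv_Suc
    by (intro vector_derivative_cong_open[OF assms(1)])
qed

lemma smooth_on_higher_vderiv:
  assumes "open S" "smooth_on S c"
  shows "smooth_on S (higher_vderiv n c)"
proof (induction n)
  case (Suc n)
  then show ?case unfolding higher_vderiv_Suc[abs_def] by (rule smooth_on_vector_derivative[OF assms(1)])
qed (simp add: assms)

lemma higher_vderiv_has_derivative:
  assumes "open S" "smooth_on S c" "t \<in> S"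
  shows "(higher_vderiv n c has_vector_derivative higher_vderiv (Suc n) c t) (at t)"
  using smooth_on_vderiv[OF smooth_on_higher_vderiv[OF assms(1,2)] assms(3)]
  by (simp add: higher_vderiv_Suc)

abbreviation iterated_dd :: "nat \<Rightarrow> 'p \<Rightarrow> ('p::euclidean_space \<Rightarrow> 'b::real_normed_vector) \<Rightarrow> 'p \<Rightarrow> 'b" where
  "iterated_dd n v F \<equiv> ((\<lambda>G p. dd G p v) ^^ n) F"

lemma smooth_on_iterated_dd: "smooth_on S F \<Longrightarrow> smooth_on S (iterated_dd n v F)"
  by (induction n) (simp_all add: smooth_on_dd_const)

lemma iterated_dd_commute:
  fixes F :: "'p::euclidean_space \<Rightarrow> 'b::euclidean_space"
  assumes "open S" "smooth_on S F" "x \<in> S"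
  shows "dd (iterated_dd n e F) x v = iterated_dd n e (\<lambda>y. dd F y v) x"
  using assms(3)
proof (induction n arbitrary: x)
  case (Suc n)
  have "dd (iterated_dd (Suc n) e F) x v = dd (\<lambda>y. dd (iterated_dd n e F) y v) x e"
    using dd_symmetric[OF assms(1) smooth_on_iterated_dd[OF assms(2)] Suc.prems] by simp
  also have "\<dots> = dd (iterated_dd n e (\<lambda>y. dd F y v)) x e"
    by (rule fun_cong[OF dd_cong(1)[OF assms(1) Suc.prems]]) (rule Suc.IH)
  finally show ?case by simp
qed simp

lemma higher_vderiv_snd:
  fixes F :: "'p::euclidean_space \<times> real \<Rightarrow> 'b::real_normed_vector"
  assumes "open S" "smooth_on S F" "(p, t) \<in> S"
  shows "higher_vderiv n (\<lambda>t. F (p, t)) t = iterated_dd n (0, 1) F (p, t)"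
  using assms(3)
proof (induction n arbitrary: t)
  case (Suc n)
  have o: "open {t. (p, t) \<in> S}"
    using open_vimage[OF assms(1), of "Pair p"] by (simp add: vimage_def continuous_on_Pair)
  have "vector_derivative (\<lambda>t. iterated_dd n (0, 1) F (p, t)) (at t) = dd (iterated_dd n (0, 1) F) (p, t) (0, 1)"
    by (intro vector_derivative_at vector_derivative_compose_dd has_vector_derivative_Pair has_vector_derivative_const
        has_vector_derivative_id smooth_on_differentiable[OF smooth_on_iterated_dd[OF assms(2)] Suc.prems])
  then show ?case
    using vector_derivative_cong_open[OF o, of t "higher_vderiv n (\<lambda>t. F (p, t))"] Suc
    by (simp add: higher_vderiv_Suc)
qed simp

lemma vector_derivative_fst:
  assumes "F differentiable (at (s, t))"
  shows "((\<lambda>s. F (s, t)) has_vector_derivative dd F (s, t) (1, 0)) (at s)"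
  using assms by (intro vector_derivative_compose_dd has_vector_derivative_Pair has_vector_derivative_const
        has_vector_derivative_id)

lemma open_slice:
  assumes "open S"
  shows "open {t. (p, t) \<in> S}" "open {s. (s, q) \<in> S}"
  using open_vimage[OF assms, of "Pair p"] open_vimage[OF assms, of "\<lambda>s. (s, q)"]
  by (simp_all add: vimage_def continuous_on_Pair)

text \<open>Differentiation in the family parameter commutes with the iterated derivative in
  \<open>t\<close>, by symmetry of second derivatives. This makes the velocity of a family of jets
  the jet of the variation field.\<close>

lemma higher_vderiv_family:
  fixes F :: "real \<times> real \<Rightarrow> 'b::euclidean_space"
  assumes "open S" "smooth_on S F" "(s, t) \<in> S"
  shows "((\<lambda>s. higher_vderiv n (\<lambda>t. F (s, t)) t) has_vector_derivative
    higher_vderiv n (\<lambda>t. vector_derivative (\<lambda>s. F (s, t)) (at s)) t) (at s)"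
proof -
  have "((\<lambda>s. iterated_dd n (0, 1) F (s, t)) has_vector_derivative
      dd (iterated_dd n (0, 1) F) (s, t) (1, 0)) (at s)"
    by (intro vector_derivative_fst smooth_on_differentiable[OF smooth_on_iterated_dd[OF assms(2)] assms(3)])
  moreover have "dd (iterated_dd n (0, 1) F) (s, t) (1, 0)
      = higher_vderiv n (\<lambda>t. dd F (s, t) (1, 0)) t"
    unfolding iterated_dd_commute[OF assms]
    by (rule higher_vderiv_snd[OF assms(1) smooth_on_dd_const[OF assms(2)] assms(3), symmetric])
  moreover have "higher_vderiv n (\<lambda>t. dd F (s, t) (1, 0)) t
      = higher_vderiv n (\<lambda>t. vector_derivative (\<lambda>s. F (s, t)) (at s)) t"
    by (rule higher_vderiv_cong[OF open_slice(1)[OF assms(1), of s]])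
      (use assms in \<open>auto simp: vector_derivative_at[OF vector_derivative_fst] smooth_on_differentiable\<close>)
  ultimately have "((\<lambda>s. iterated_dd n (0, 1) F (s, t)) has_vector_derivative
      higher_vderiv n (\<lambda>t. vector_derivative (\<lambda>s. F (s, t)) (at s)) t) (at s)" by simp
  then show ?thesis
    by (rule has_vector_derivative_transform_within_open[OF _ open_slice(2)[OF assms(1), of t]])
      (use assms in \<open>auto simp: higher_vderiv_snd\<close>)
qed

text \<open>A curve with prescribed derivatives at 0, which realises any given jet
  coordinates.\<close>

definition taylor :: "nat \<Rightarrow> (nat \<Rightarrow> 'b::real_normed_vector) \<Rightarrow> real \<Rightarrow> 'b" where
  "taylor k a t = (\<Sum>j\<le>k. (t ^ j / fact j) *\<^sub>R a j)"

lemma taylor_deriv: "(taylor (Suc k) a has_vector_derivative taylor k (\<lambda>j. a (Suc j)) t) (at t)"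
proof -
  have "((\<lambda>t. (t ^ Suc j / fact (Suc j)) *\<^sub>R a (Suc j)) has_vector_derivative
      (t ^ j / fact j) *\<^sub>R a (Suc j)) (at t)" for j
  proof -
    have "((\<lambda>t. t ^ Suc j / fact (Suc j)) has_real_derivative real (Suc j) * t ^ j / fact (Suc j)) (at t)"
      by (rule DERIV_cdivide) (use DERIV_pow[of "Suc j" t] in simp)
    from has_vector_derivative_scaleR[OF this has_vector_derivative_const, of "a (Suc j)"]
    show ?thesis by (simp del: of_nat_Suc)
  qed
  then have "((\<lambda>t. (\<Sum>j\<le>k. (t ^ Suc j / fact (Suc j)) *\<^sub>R a (Suc j))) has_vector_derivative
      taylor k (\<lambda>j. a (Suc j)) t) (at t)"
    unfolding taylor_def by (intro has_vector_derivative_sum)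
  then have "((\<lambda>t. a 0 + (\<Sum>j\<le>k. (t ^ Suc j / fact (Suc j)) *\<^sub>R a (Suc j))) has_vector_derivative
      0 + taylor k (\<lambda>j. a (Suc j)) t) (at t)"
    by (intro has_vector_derivative_add has_vector_derivative_const)
  then show ?thesis unfolding taylor_def[of "Suc k"] sum.atMost_Suc_shift by simp
qed

lemma higher_vderiv_taylor:
  "\<alpha> \<le> k \<Longrightarrow> higher_vderiv \<alpha> (taylor k a) t = taylor (k - \<alpha>) (\<lambda>j. a (\<alpha> + j)) t"
proof (induction \<alpha> arbitrary: t)
  case (Suc \<alpha>)
  then have "higher_vderiv \<alpha> (taylor k a) = taylor (Suc (k - Suc \<alpha>)) (\<lambda>j. a (\<alpha> + j))"
    by (intro ext) (simp add: Suc_diff_Suc)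
  then show ?case
    using vector_derivative_at[OF taylor_deriv[of "k - Suc \<alpha>" "\<lambda>j. a (\<alpha> + j)" t]]
    by (simp add: higher_vderiv_Suc)
qed simp

lemma taylor_at_0: "taylor k a 0 = a 0"
  by (auto simp: taylor_def sum.remove[of _ 0] intro!: sum.neutral)

lemma higher_vderiv_taylor_0: "\<alpha> \<le> k \<Longrightarrow> higher_vderiv \<alpha> (taylor k a) 0 = a \<alpha>"
  by (simp add: higher_vderiv_taylor taylor_at_0)

section \<open>Charts, tangent vectors and vector fields\<close>

text \<open>The value 0 off \<open>smooth_fun A\<close> matches the convention in
  \<open>velocity\<close>, so that chart vectors and velocities are equal as functions.\<close>

definition chart_vec ::
  "('a, 'e::euclidean_space) atlas \<Rightarrow> 'a set \<Rightarrow> ('a \<Rightarrow> 'e) \<Rightarrow> 'a \<Rightarrow> 'e \<Rightarrow> 'a tvec" where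
  "chart_vec A U \<phi> p w = (\<lambda>f. if f \<in> smooth_fun A then dd (f \<circ> inv_into U \<phi>) (\<phi> p) w else 0)"

text \<open>Keeps the compatibility of charts apart from the topological conditions, so that the
  results apply both to \<open>A\<close> and to the jet atlas.\<close>

locale smooth_atlas =
  fixes A :: "('a, 'e::euclidean_space) atlas"
  assumes chart_inj: "(U, \<phi>) \<in> A \<Longrightarrow> inj_on \<phi> U"
    and chart_open: "(U, \<phi>) \<in> A \<Longrightarrow> open (\<phi> ` U)"
    and overlap_open: "(U, \<phi>) \<in> A \<Longrightarrow> (V, \<psi>) \<in> A \<Longrightarrow> open (\<phi> ` (U \<inter> V))"
    and transition_smooth:
      "(U, \<phi>) \<in> A \<Longrightarrow> (V, \<psi>) \<in> A \<Longrightarrow> smooth_on (\<phi> ` (U \<inter> V)) (\<psi> \<circ> inv_into U \<phi>)"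
begin

lemma inv_chart: "(U, \<phi>) \<in> A \<Longrightarrow> q \<in> U \<Longrightarrow> inv_into U \<phi> (\<phi> q) = q"
  by (simp add: chart_inj)

lemma chart_inv: "y \<in> \<phi> ` U \<Longrightarrow> \<phi> (inv_into U \<phi> y) = y" "y \<in> \<phi> ` U \<Longrightarrow> inv_into U \<phi> y \<in> U"
  by (simp_all add: f_inv_into_f inv_into_into)

lemma carrI: "(U, \<phi>) \<in> A \<Longrightarrow> p \<in> U \<Longrightarrow> p \<in> carr A"
  by (force simp: carr_def)

lemma carrE:
  assumes "p \<in> carr A"
  obtains U \<phi> where "(U, \<phi>) \<in> A" "p \<in> U"
  using assms by (auto simp: carr_def)

lemma smooth_funD: "f \<in> smooth_fun A \<Longrightarrow> (U, \<phi>) \<in> A \<Longrightarrow> smooth_on (\<phi> ` U) (f \<circ> inv_into U \<phi>)"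
  by (auto simp: smooth_fun_def)

lemma smooth_fun_differentiable:
  "f \<in> smooth_fun A \<Longrightarrow> (U, \<phi>) \<in> A \<Longrightarrow> p \<in> U \<Longrightarrow> (f \<circ> inv_into U \<phi>) differentiable (at (\<phi> p))"
  by (rule smooth_on_differentiable[OF smooth_funD]) auto

lemma smooth_fun_cong:
  assumes "\<And>p. p \<in> carr A \<Longrightarrow> f p = g p"
  shows "f \<in> smooth_fun A \<longleftrightarrow> g \<in> smooth_fun A"
proof -
  have "smooth_on (\<phi> ` U) (f \<circ> inv_into U \<phi>) \<longleftrightarrow> smooth_on (\<phi> ` U) (g \<circ> inv_into U \<phi>)"
    if "(U, \<phi>) \<in> A" for U \<phi>
    by (rule smooth_on_cong[OF chart_open[OF that]]) (auto simp: inv_chart[OF that] assms carrI[OF that])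
  then show ?thesis by (auto simp: smooth_fun_def)
qed

text \<open>Smooth transition maps carry smoothness from one chart at a point to every other chart
  near that point, so a single chart per point suffices.\<close>

lemma smooth_fun_localI:
  assumes "\<And>p. p \<in> carr A \<Longrightarrow> \<exists>U \<phi> T. (U, \<phi>) \<in> A \<and> p \<in> U \<and> open T \<and> \<phi> p \<in> T \<and> T \<subseteq> \<phi> ` U \<and>
    smooth_on T (f \<circ> inv_into U \<phi>)"
  shows "f \<in> smooth_fun A"
proof -
  have "smooth_on (\<psi> ` V) (f \<circ> inv_into V \<psi>)" if V: "(V, \<psi>) \<in> A" for V \<psi>
  proof (rule smooth_on_local)
    fix z assume "z \<in> \<psi> ` V"
    then obtain p where p: "p \<in> V" "z = \<psi> p" by blast
    obtain U \<phi> T where U: "(U, \<phi>) \<in> A" "p \<in> U" "open T" "\<phi> p \<in> T" "T \<subseteq> \<phi> ` U"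
      "smooth_on T (f \<circ> inv_into U \<phi>)"
      using assms[OF carrI[OF V p(1)]] by blast
    define h where "h = \<phi> \<circ> inv_into V \<psi>"
    have h: "smooth_on (\<psi> ` (V \<inter> U)) h" unfolding h_def by (rule transition_smooth[OF V U(1)])
    define N where "N = \<psi> ` (V \<inter> U) \<inter> h -` T"
    have N: "open N" unfolding N_def
      by (rule continuous_open_preimage[OF smooth_on_continuous[OF h] overlap_open[OF V U(1)] U(3)])
    have "smooth_on N (\<lambda>x. (f \<circ> inv_into U \<phi>) (h x))"
      by (rule smooth_on_compose[OF U(6) smooth_on_subset[OF h] N U(3)]) (auto simp: N_def)
    moreover have "(f \<circ> inv_into U \<phi>) (h x) = (f \<circ> inv_into V \<psi>) x" if "x \<in> N" for x
      using that by (auto simp: N_def h_def inv_chart[OF V] inv_chart[OF U(1)])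
    ultimately have "smooth_on N (f \<circ> inv_into V \<psi>)"
      using iffD1[OF smooth_on_cong[OF N, of "\<lambda>x. (f \<circ> inv_into U \<phi>) (h x)" "f \<circ> inv_into V \<psi>"]] by simp
    moreover have "z \<in> N" using p U by (auto simp: N_def h_def inv_chart[OF V])
    ultimately show "\<exists>T. open T \<and> z \<in> T \<and> smooth_on T (f \<circ> inv_into V \<psi>)" using N by blast
  qed
  then show ?thesis by (auto simp: smooth_fun_def)
qed

lemma smooth_intoD:
  assumes "smooth_into A S F" "(U, \<phi>) \<in> A"
  shows "open S" "open (S \<inter> F -` U)" "smooth_on (S \<inter> F -` U) (\<lambda>x. \<phi> (F x))"
  using assms by (auto simp: smooth_into_def comp_def)

lemma smooth_into_chart:
  assumes U: "(U, \<phi>) \<in> A" and S: "open S" and G: "smooth_on S G" "G ` S \<subseteq> \<phi> ` U"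
  shows "smooth_into A S (\<lambda>x. inv_into U \<phi> (G x))"
proof -
  have U': "inv_into U \<phi> (G x) \<in> U" "\<phi> (inv_into U \<phi> (G x)) = G x" if "x \<in> S" for x
  proof -
    have "G x \<in> \<phi> ` U" using G(2) that by blast
    then show "inv_into U \<phi> (G x) \<in> U" "\<phi> (inv_into U \<phi> (G x)) = G x" using chart_inv by simp_all
  qed
  have "open (S \<inter> (\<lambda>x. inv_into U \<phi> (G x)) -` V) \<and>
     smooth_on (S \<inter> (\<lambda>x. inv_into U \<phi> (G x)) -` V) (\<psi> \<circ> (\<lambda>x. inv_into U \<phi> (G x)))"
    if V: "(V, \<psi>) \<in> A" for V \<psi>
  proof -
    have eq: "S \<inter> (\<lambda>x. inv_into U \<phi> (G x)) -` V = S \<inter> G -` (\<phi> ` (U \<inter> V))"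
    proof (intro set_eqI iffI)
      fix x assume x: "x \<in> S \<inter> (\<lambda>x. inv_into U \<phi> (G x)) -` V"
      then have "inv_into U \<phi> (G x) \<in> U \<inter> V" "G x = \<phi> (inv_into U \<phi> (G x))" using U' by auto
      then show "x \<in> S \<inter> G -` (\<phi> ` (U \<inter> V))" using x by blast
    next
      fix x assume x: "x \<in> S \<inter> G -` (\<phi> ` (U \<inter> V))"
      then show "x \<in> S \<inter> (\<lambda>x. inv_into U \<phi> (G x)) -` V" by (auto simp: inv_chart[OF U])
    qed
    have o: "open (S \<inter> G -` (\<phi> ` (U \<inter> V)))"
      by (rule continuous_open_preimage[OF smooth_on_continuous[OF G(1)] S overlap_open[OF U V]])
    show ?thesis unfolding eq
      using smooth_on_compose[OF transition_smooth[OF U V] smooth_on_subset[OF G(1)] o overlap_open[OF U V]] o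
      by (auto simp: comp_def)
  qed
  then show ?thesis using S U' carrI[OF U] by (auto simp: smooth_into_def)
qed

lemma velocity_chart_deriv:
  assumes U: "(U, \<phi>) \<in> A" "c t \<in> U" and N: "open N" "t \<in> N" "c ` N \<subseteq> U"
    and d: "((\<lambda>r. \<phi> (c r)) has_vector_derivative w) (at t)"
  shows "velocity A c t = chart_vec A U \<phi> (c t) w"
proof
  fix f
  show "velocity A c t f = chart_vec A U \<phi> (c t) w f"
  proof (cases "f \<in> smooth_fun A")
    case True
    have "((\<lambda>r. (f \<circ> inv_into U \<phi>) (\<phi> (c r))) has_vector_derivative
        dd (f \<circ> inv_into U \<phi>) (\<phi> (c t)) w) (at t)"
      by (rule vector_derivative_compose_dd[OF smooth_fun_differentiable[OF True U] d])
    then have "((\<lambda>r. f (c r)) has_vector_derivative dd (f \<circ> inv_into U \<phi>) (\<phi> (c t)) w) (at t)"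
      by (rule has_vector_derivative_transform_within_open[OF _ N(1,2)])
        (use N(3) in \<open>auto simp: inv_chart[OF U(1)]\<close>)
    then show ?thesis
      using True by (simp add: velocity_def chart_vec_def DERIV_imp_deriv has_real_derivative_iff_has_vector_derivative)
  qed (simp add: velocity_def chart_vec_def)
qed

lemma velocity_chart:
  assumes "smooth_into A S c" "t \<in> S" "(U, \<phi>) \<in> A" "c t \<in> U"
  shows "velocity A c t = chart_vec A U \<phi> (c t) (vector_derivative (\<lambda>r. \<phi> (c r)) (at t))"
    "((\<lambda>r. \<phi> (c r)) has_vector_derivative vector_derivative (\<lambda>r. \<phi> (c r)) (at t)) (at t)"
proof -
  note s = smooth_intoD[OF assms(1,3)]
  have t: "t \<in> S \<inter> c -` U" using assms by simp
  show d: "((\<lambda>r. \<phi> (c r)) has_vector_derivative vector_derivative (\<lambda>r. \<phi> (c r)) (at t)) (at t)"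
    using smooth_on_vderiv[OF s(3) t] by simp
  show "velocity A c t = chart_vec A U \<phi> (c t) (vector_derivative (\<lambda>r. \<phi> (c r)) (at t))"
    by (rule velocity_chart_deriv[OF assms(3,4) s(2) t _ d]) auto
qed

lemma chart_vec_add:
  assumes "(U, \<phi>) \<in> A" "p \<in> U"
  shows "chart_vec A U \<phi> p (v + w) = tv_add (chart_vec A U \<phi> p v) (chart_vec A U \<phi> p w)"
  using linear_add[OF dd_linear[OF smooth_fun_differentiable[OF _ assms]]]
  by (auto simp: chart_vec_def tv_add_def)

lemma chart_vec_scale:
  assumes "(U, \<phi>) \<in> A" "p \<in> U"
  shows "chart_vec A U \<phi> p (c *\<^sub>R v) = tv_scale c (chart_vec A U \<phi> p v)"
  using linear_scale[OF dd_linear[OF smooth_fun_differentiable[OF _ assms]]]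
  by (auto simp: chart_vec_def tv_scale_def)

lemma chart_vec_sum:
  assumes "(U, \<phi>) \<in> A" "p \<in> U"
  shows "chart_vec A U \<phi> p (\<Sum>i\<in>I. a i *\<^sub>R v i) = (\<lambda>f. \<Sum>i\<in>I. a i * chart_vec A U \<phi> p (v i) f)"
proof
  fix f
  show "chart_vec A U \<phi> p (\<Sum>i\<in>I. a i *\<^sub>R v i) f = (\<Sum>i\<in>I. a i * chart_vec A U \<phi> p (v i) f)"
  proof (cases "f \<in> smooth_fun A")
    case True
    interpret linear "dd (f \<circ> inv_into U \<phi>) (\<phi> p)"
      by (rule dd_linear[OF smooth_fun_differentiable[OF True assms]])
    show ?thesis using True by (simp add: chart_vec_def sum scale)
  qed (simp add: chart_vec_def)
qed

lemma chart_vec_0: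
  assumes "(U, \<phi>) \<in> A" "p \<in> U"
  shows "chart_vec A U \<phi> p 0 = tv_zero"
  using chart_vec_scale[OF assms, of 0 0] by (simp add: tv_scale_def tv_zero_def)

lemma tangent_space_chart:
  assumes U: "(U, \<phi>) \<in> A" "p \<in> U"
  shows "tangent_space A p = range (chart_vec A U \<phi> p)"
proof
  show "tangent_space A p \<subseteq> range (chart_vec A U \<phi> p)"
  proof
    fix v assume "v \<in> tangent_space A p"
    then obtain c S where "v = velocity A c 0" "smooth_into A S c" "0 \<in> S" "c 0 = p"
      by (auto simp: tangent_space_def smooth_near_def)
    then show "v \<in> range (chart_vec A U \<phi> p)" using velocity_chart(1)[of S c 0 U \<phi>] U by auto
  qed
  show "range (chart_vec A U \<phi> p) \<subseteq> tangent_space A p"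
  proof
    fix v assume "v \<in> range (chart_vec A U \<phi> p)"
    then obtain w where v: "v = chart_vec A U \<phi> p w" by blast
    define G where "G t = \<phi> p + t *\<^sub>R w" for t :: real
    define S where "S = G -` (\<phi> ` U)"
    have o: "open S" unfolding S_def G_def
      by (intro open_vimage[OF chart_open[OF U(1)]] continuous_intros)
    have G: "smooth_on S G" unfolding G_def
      by (intro smooth_on_add smooth_on_const o smooth_on_bounded_linear[OF bounded_linear_scaleR_left]
          smooth_on_id)
    define c where "c t = inv_into U \<phi> (G t)" for t
    have c: "smooth_into A S c" unfolding c_def
      by (rule smooth_into_chart[OF U(1) o G]) (auto simp: S_def)
    have 0: "0 \<in> S" "c 0 = p" using U by (auto simp: S_def G_def c_def inv_chart)
    have "(G has_vector_derivative w) (at 0)" unfolding G_def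
      by (auto intro!: derivative_eq_intros)
    then have "((\<lambda>r. \<phi> (c r)) has_vector_derivative w) (at 0)"
      by (rule has_vector_derivative_transform_within_open[OF _ o 0(1)]) (auto simp: c_def S_def chart_inv)
    then have "velocity A c 0 = v"
      using velocity_chart_deriv[OF U(1) _ o 0(1), of c w] 0(2) U(2) chart_inv(2)[of _ \<phi> U]
      by (auto simp: v c_def S_def)
    then show "v \<in> tangent_space A p" using c 0 by (auto simp: tangent_space_def smooth_near_def)
  qed
qed

lemma chart_vec_in_tangent_space: "(U, \<phi>) \<in> A \<Longrightarrow> p \<in> U \<Longrightarrow> chart_vec A U \<phi> p w \<in> tangent_space A p"
  by (simp add: tangent_space_chart)

lemma tangent_spaceE:
  assumes "v \<in> tangent_space A p" "(U, \<phi>) \<in> A" "p \<in> U"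
  obtains w where "v = chart_vec A U \<phi> p w"
  using assms by (auto simp: tangent_space_chart)

lemma tangent_space_carr: "v \<in> tangent_space A p \<Longrightarrow> p \<in> carr A"
  by (auto simp: tangent_space_def smooth_near_def smooth_into_def)

lemma tangent_space_add: "v \<in> tangent_space A p \<Longrightarrow> w \<in> tangent_space A p \<Longrightarrow> tv_add v w \<in> tangent_space A p"
proof -
  assume v: "v \<in> tangent_space A p" and w: "w \<in> tangent_space A p"
  obtain U \<phi> where U: "(U, \<phi>) \<in> A" "p \<in> U" using tangent_space_carr[OF v] by (rule carrE)
  obtain a b where "v = chart_vec A U \<phi> p a" "w = chart_vec A U \<phi> p b"
    using tangent_spaceE[OF v U] tangent_spaceE[OF w U] by metis
  then show ?thesis using chart_vec_in_tangent_space[OF U, of "a + b"] chart_vec_add[OF U, of a b] by simp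
qed

lemma tangent_space_scale: "v \<in> tangent_space A p \<Longrightarrow> tv_scale c v \<in> tangent_space A p"
proof -
  assume v: "v \<in> tangent_space A p"
  obtain U \<phi> where U: "(U, \<phi>) \<in> A" "p \<in> U" using tangent_space_carr[OF v] by (rule carrE)
  obtain a where "v = chart_vec A U \<phi> p a" using tangent_spaceE[OF v U] by metis
  then show ?thesis using chart_vec_in_tangent_space[OF U, of "c *\<^sub>R a"] chart_vec_scale[OF U, of c a] by simp
qed

lemma tangent_space_zero: "p \<in> carr A \<Longrightarrow> tv_zero \<in> tangent_space A p"
proof -
  assume "p \<in> carr A"
  then obtain U \<phi> where U: "(U, \<phi>) \<in> A" "p \<in> U" by (rule carrE)
  show ?thesis using chart_vec_in_tangent_space[OF U, of 0] by (simp add: chart_vec_0[OF U])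
qed

text \<open>Tangent vectors are set to 0 on functions that are not smooth, and smoothness is a
  global property that agreement near \<open>p\<close> does not decide; hence the assumption
  \<open>fg\<close>.\<close>

lemma tangent_cong_near:
  assumes v: "v \<in> tangent_space A p" and U: "(U, \<phi>) \<in> A" "p \<in> U" and T: "open T" "\<phi> p \<in> T"
    and eq: "\<And>q. q \<in> U \<Longrightarrow> \<phi> q \<in> T \<Longrightarrow> f q = g q" and fg: "f \<in> smooth_fun A \<longleftrightarrow> g \<in> smooth_fun A"
  shows "v f = v g"
proof -
  obtain w where w: "v = chart_vec A U \<phi> p w" using v U by (rule tangent_spaceE)
  have "dd (f \<circ> inv_into U \<phi>) (\<phi> p) = dd (g \<circ> inv_into U \<phi>) (\<phi> p)"
    by (rule dd_cong(1)[of "T \<inter> \<phi> ` U"]) (use T U eq in \<open>auto simp: chart_open inv_chart\<close>)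
  then show ?thesis by (simp add: w chart_vec_def fg)
qed

lemma tangent_cong:
  assumes "v \<in> tangent_space A p" "\<And>q. q \<in> carr A \<Longrightarrow> f q = g q"
  shows "v f = v g"
proof -
  obtain U \<phi> where U: "(U, \<phi>) \<in> A" "p \<in> U" using tangent_space_carr[OF assms(1)] by (rule carrE)
  show ?thesis
    by (rule tangent_cong_near[OF assms(1) U open_UNIV UNIV_I assms(2)[OF carrI[OF U(1)]]
        smooth_fun_cong[OF assms(2)]])
qed

lemma tangent_not_smooth: "v \<in> tangent_space A p \<Longrightarrow> f \<notin> smooth_fun A \<Longrightarrow> v f = 0"
  by (auto simp: tangent_space_def velocity_def)

lemma smooth_fun_mult:
  assumes "f \<in> smooth_fun A" "g \<in> smooth_fun A"
  shows "(\<lambda>q. f q * g q) \<in> smooth_fun A"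
proof -
  have "smooth_on (\<phi> ` U) (\<lambda>x. f (inv_into U \<phi> x) * g (inv_into U \<phi> x))" if U: "(U, \<phi>) \<in> A" for U \<phi>
    using smooth_on_mult[OF chart_open[OF U] assms[THEN smooth_funD, OF U]] by (simp add: comp_def)
  then show ?thesis by (auto simp: smooth_fun_def comp_def)
qed

lemma smooth_fun_add:
  assumes "f \<in> smooth_fun A" "g \<in> smooth_fun A"
  shows "(\<lambda>q. f q + g q) \<in> smooth_fun A"
proof -
  have "smooth_on (\<phi> ` U) (\<lambda>x. f (inv_into U \<phi> x) + g (inv_into U \<phi> x))" if U: "(U, \<phi>) \<in> A" for U \<phi>
    using smooth_on_add[OF chart_open[OF U] assms[THEN smooth_funD, OF U]] by (simp add: comp_def)
  then show ?thesis by (auto simp: smooth_fun_def comp_def)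
qed

lemma smooth_fun_const: "(\<lambda>q. c) \<in> smooth_fun A"
  by (auto simp: smooth_fun_def comp_def)

lemma vector_fieldD:
  "X \<in> vector_fields A \<Longrightarrow> p \<in> carr A \<Longrightarrow> X p \<in> tangent_space A p"
  "X \<in> vector_fields A \<Longrightarrow> p \<notin> carr A \<Longrightarrow> X p = tv_zero"
  "X \<in> vector_fields A \<Longrightarrow> f \<in> smooth_fun A \<Longrightarrow> (\<lambda>p. X p f) \<in> smooth_fun A"
  by (auto simp: vector_fields_def)

lemma vf_add_closed: "X \<in> vector_fields A \<Longrightarrow> Y \<in> vector_fields A \<Longrightarrow> vf_add X Y \<in> vector_fields A"
  unfolding vector_fields_def vf_add_def
  by (auto intro: tangent_space_add smooth_fun_add) (auto simp: tv_add_def tv_zero_def intro: smooth_fun_add)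

lemma vf_scale_closed: "h \<in> smooth_fun A \<Longrightarrow> X \<in> vector_fields A \<Longrightarrow> vf_scale h X \<in> vector_fields A"
  unfolding vector_fields_def vf_scale_def
  by (auto intro: tangent_space_scale) (auto simp: tv_scale_def tv_zero_def intro: smooth_fun_mult)

text \<open>If \<open>f\<close> is not smooth, every tangent vector is 0 on it by convention, and
  the result is a constant function.\<close>

lemma vector_field_smooth:
  assumes "X \<in> vector_fields A"
  shows "(\<lambda>p. X p f) \<in> smooth_fun A"
proof (cases "f \<in> smooth_fun A")
  case False
  have "X p f = 0" for p
  proof (cases "p \<in> carr A")
    case True
    then show ?thesis using tangent_not_smooth[OF vector_fieldD(1)[OF assms True] False] by simp
  qed (simp add: vector_fieldD(2)[OF assms] tv_zero_def)
  then show ?thesis by (simp add: smooth_fun_const)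
qed (rule vector_fieldD(3)[OF assms])

end

section \<open>Extension of functions from a chart by zero\<close>

locale manifold = smooth_atlas A for A :: "('a, 'e::euclidean_space) atlas" +
  assumes smooth_manifold: "smooth_manifold A"
begin

abbreviation "\<T> \<equiv> manifold_topology A"

lemma openin_\<T>: "openin \<T> W \<longleftrightarrow> W \<subseteq> carr A \<and> (\<forall>(U, \<phi>)\<in>A. open (\<phi> ` (W \<inter> U)))"
  by (rule openin_manifold_topology[OF smooth_manifold])

lemma topspace_\<T>: "topspace \<T> = carr A"
proof -
  have "openin \<T> (carr A)" unfolding openin_\<T>
  proof safe
    fix U \<phi> assume "(U, \<phi>) \<in> A"
    moreover from this have "carr A \<inter> U = U" using carrI by blast
    ultimately show "open (\<phi> ` (carr A \<inter> U))" using chart_open by simp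
  qed
  then show ?thesis using openin_subset[of \<T> "carr A"] openin_topspace[of \<T>] unfolding openin_\<T>[of "topspace \<T>"] by blast
qed

text \<open>Here the Hausdorff property enters: an inverse chart is continuous, so the image of
  \<open>K\<close> is compact and therefore closed in the manifold. Its complement is then an open
  set on which functions supported in \<open>K\<close> vanish.\<close>

lemma closedin_chart_compact:
  assumes U: "(U, \<phi>) \<in> A" and K: "compact K" "K \<subseteq> \<phi> ` U"
  shows "closedin \<T> (inv_into U \<phi> ` K)"
proof (rule compactin_imp_closedin)
  show "Hausdorff_space \<T>" using smooth_manifold by (simp add: smooth_manifold_def)
  have "continuous_map (top_of_set (\<phi> ` U)) \<T> (inv_into U \<phi>)"
    unfolding continuous_map_def
  proof (intro conjI allI impI)
    show "inv_into U \<phi> \<in> topspace (top_of_set (\<phi> ` U)) \<rightarrow> topspace \<T>"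
      using carrI[OF U] by (auto simp: topspace_\<T> inv_chart[OF U])
    fix W assume "openin \<T> W"
    then have "open (\<phi> ` (W \<inter> U))" using U by (auto simp: openin_\<T>)
    moreover have "{x \<in> topspace (top_of_set (\<phi> ` U)). inv_into U \<phi> x \<in> W} = \<phi> ` (W \<inter> U)"
      by (auto simp: inv_chart[OF U])
    ultimately show "openin (top_of_set (\<phi> ` U)) {x \<in> topspace (top_of_set (\<phi> ` U)). inv_into U \<phi> x \<in> W}"
      by (auto simp: openin_open)
  qed
  then show "compactin \<T> (inv_into U \<phi> ` K)"
    using K by (intro image_compactin) (auto simp: compactin_subtopology)
qed

lemma smooth_fun_extend:
  assumes U: "(U, \<phi>) \<in> A" and K: "compact K" "K \<subseteq> \<phi> ` U"
    and H: "smooth_on (\<phi> ` U) H" "\<And>y. y \<in> \<phi> ` U - K \<Longrightarrow> H y = 0"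
  shows "(\<lambda>q. if q \<in> U then H (\<phi> q) else 0) \<in> smooth_fun A" (is "?f \<in> _")
proof (rule smooth_fun_localI)
  fix p assume "p \<in> carr A"
  then obtain V \<psi> where V: "(V, \<psi>) \<in> A" "p \<in> V" by (rule carrE)
  show "\<exists>U \<phi> T. (U, \<phi>) \<in> A \<and> p \<in> U \<and> open T \<and> \<phi> p \<in> T \<and> T \<subseteq> \<phi> ` U \<and> smooth_on T (?f \<circ> inv_into U \<phi>)"
  proof (cases "p \<in> U")
    case True
    have "smooth_on (\<phi> ` U) (?f \<circ> inv_into U \<phi>)"
      by (rule iffD1[OF smooth_on_cong[OF chart_open[OF U]] H(1)]) (auto simp: inv_chart[OF U])
    then show ?thesis using U True chart_open[OF U] by blast
  next
    case False
    \<comment> \<open>A point outside \<open>U\<close> has a neighbourhood that misses the compact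
      support; there the extended function is identically 0.\<close>
    define T where "T = \<psi> ` ((carr A - inv_into U \<phi> ` K) \<inter> V)"
    have "openin \<T> (topspace \<T> - inv_into U \<phi> ` K)"
      using closedin_chart_compact[OF U K] by (simp add: closedin_def)
    then have o: "open T" using V(1) by (auto simp: openin_\<T> topspace_\<T> T_def)
    have "p \<notin> inv_into U \<phi> ` K" using False K(2) by (auto simp: inv_chart[OF U])
    then have p: "\<psi> p \<in> T" using V \<open>p \<in> carr A\<close> by (simp add: T_def)
    have "(?f \<circ> inv_into V \<psi>) y = 0" if y: "y \<in> T" for y
    proof -
      obtain q where q: "q \<in> V" "q \<notin> inv_into U \<phi> ` K" "y = \<psi> q" using y unfolding T_def by blast
      have "\<phi> q \<notin> K" if "q \<in> U" using q(2) inv_chart[OF U that] by (metis image_eqI)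
      then show ?thesis using H(2) q by (simp add: inv_chart[OF V(1)])
    qed
    then have "smooth_on T (?f \<circ> inv_into V \<psi>)" using iffD2[OF smooth_on_cong[OF o, of _ "\<lambda>y. 0"] smooth_on_const] by blast
    then show ?thesis using V o p by (intro exI[of _ V] exI[of _ \<psi>] exI[of _ T]) (auto simp: T_def)
  qed
qed

end

lemma manifold_locale:
  assumes "smooth_manifold A"
  shows "manifold A"
  using assms by unfold_locales (auto simp: smooth_manifold_def split: prod.splits)

section \<open>Connections in coordinates\<close>

definition components ::
  "('a, 'e::euclidean_space) atlas \<Rightarrow> 'a set \<Rightarrow> ('a \<Rightarrow> 'e) \<Rightarrow> 'a vfield \<Rightarrow> 'e \<Rightarrow> 'e" where
  "components A U \<phi> Z y = (THE w. Z (inv_into U \<phi> y) = chart_vec A U \<phi> (inv_into U \<phi> y) w)"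

lemma affine_connectionD:
  assumes "affine_connection A D"
  shows "X \<in> vector_fields A \<Longrightarrow> Y \<in> vector_fields A \<Longrightarrow> D X Y \<in> vector_fields A"
    and "X \<in> vector_fields A \<Longrightarrow> Y \<in> vector_fields A \<Longrightarrow> Z \<in> vector_fields A \<Longrightarrow>
      D (vf_add X Y) Z = vf_add (D X Z) (D Y Z)"
    and "X \<in> vector_fields A \<Longrightarrow> Y \<in> vector_fields A \<Longrightarrow> Z \<in> vector_fields A \<Longrightarrow>
      D X (vf_add Y Z) = vf_add (D X Y) (D X Z)"
    and "X \<in> vector_fields A \<Longrightarrow> Z \<in> vector_fields A \<Longrightarrow> h \<in> smooth_fun A \<Longrightarrow>
      D (vf_scale h X) Z = vf_scale h (D X Z)"
    and "X \<in> vector_fields A \<Longrightarrow> Z \<in> vector_fields A \<Longrightarrow> h \<in> smooth_fun A \<Longrightarrow>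
      D X (vf_scale h Z) = vf_add (vf_scale (\<lambda>p. X p h) Z) (vf_scale h (D X Z))"
proof -
  \<comment> \<open>The axioms are quantified jointly over three fields and a function, so the
    additivity rules need some smooth function to instantiate them.\<close>
  have "(\<lambda>q. 0) \<in> smooth_fun A" by (auto simp: smooth_fun_def comp_def)
  with assms show
    "X \<in> vector_fields A \<Longrightarrow> Y \<in> vector_fields A \<Longrightarrow> D X Y \<in> vector_fields A"
    "X \<in> vector_fields A \<Longrightarrow> Y \<in> vector_fields A \<Longrightarrow> Z \<in> vector_fields A \<Longrightarrow>
      D (vf_add X Y) Z = vf_add (D X Z) (D Y Z)"
    "X \<in> vector_fields A \<Longrightarrow> Y \<in> vector_fields A \<Longrightarrow> Z \<in> vector_fields A \<Longrightarrow>
      D X (vf_add Y Z) = vf_add (D X Y) (D X Z)"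
    "X \<in> vector_fields A \<Longrightarrow> Z \<in> vector_fields A \<Longrightarrow> h \<in> smooth_fun A \<Longrightarrow>
      D (vf_scale h X) Z = vf_scale h (D X Z)"
    "X \<in> vector_fields A \<Longrightarrow> Z \<in> vector_fields A \<Longrightarrow> h \<in> smooth_fun A \<Longrightarrow>
      D X (vf_scale h Z) = vf_add (vf_scale (\<lambda>p. X p h) Z) (vf_scale h (D X Z))"
    unfolding affine_connection_def by blast+
qed

context smooth_atlas
begin

lemma vf_zero_closed: "(\<lambda>p. tv_zero) \<in> vector_fields A"
  using smooth_fun_const[of 0] tangent_space_zero
  by (auto simp: vector_fields_def) (simp add: tv_zero_def)

lemma vf_sum_closed:
  assumes "finite I" "\<And>i. i \<in> I \<Longrightarrow> h i \<in> smooth_fun A" "\<And>i. i \<in> I \<Longrightarrow> E i \<in> vector_fields A"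
  shows "(\<lambda>p f. \<Sum>i\<in>I. h i p * E i p f) \<in> vector_fields A"
  using assms
proof (induction I)
  case empty
  then show ?case using vf_zero_closed by (simp add: tv_zero_def)
next
  case (insert i I)
  have "(\<lambda>p f. \<Sum>i\<in>insert i I. h i p * E i p f) = vf_add (vf_scale (h i) (E i)) (\<lambda>p f. \<Sum>i\<in>I. h i p * E i p f)"
    using insert.hyps by (simp add: vf_add_def vf_scale_def tv_add_def tv_scale_def)
  then show ?case using insert by (simp add: vf_add_closed vf_scale_closed)
qed

lemma vf_scale_zero: "vf_scale (\<lambda>p. 0) X = (\<lambda>p. tv_zero)"
  by (simp add: vf_scale_def tv_scale_def tv_zero_def)

lemma tangent_const: "v \<in> tangent_space A p \<Longrightarrow> v (\<lambda>q. c) = 0"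
proof -
  assume v: "v \<in> tangent_space A p"
  obtain U \<phi> where U: "(U, \<phi>) \<in> A" "p \<in> U" using tangent_space_carr[OF v] by (rule carrE)
  obtain w where "v = chart_vec A U \<phi> p w" using v U by (rule tangent_spaceE)
  then show ?thesis by (simp add: chart_vec_def comp_def)
qed

lemma vf_const: "X \<in> vector_fields A \<Longrightarrow> X p (\<lambda>q. c) = 0"
  by (cases "p \<in> carr A") (simp add: tangent_const[OF vector_fieldD(1)], simp add: vector_fieldD(2) tv_zero_def)

lemma connection_sum_left:
  assumes D: "affine_connection A D" and Z: "Z \<in> vector_fields A"
    and "finite I" "\<And>i. i \<in> I \<Longrightarrow> h i \<in> smooth_fun A" "\<And>i. i \<in> I \<Longrightarrow> E i \<in> vector_fields A"
  shows "D (\<lambda>p f. \<Sum>i\<in>I. h i p * E i p f) Z = (\<lambda>p f. \<Sum>i\<in>I. h i p * D (E i) Z p f)"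
  using assms(3-5)
proof (induction I)
  case empty
  \<comment> \<open>The empty sum is the zero field, written as 0 times a field so that linearity
    over functions yields the value 0.\<close>
  have "D (vf_scale (\<lambda>p. 0) Z) Z = vf_scale (\<lambda>p. 0) (D Z Z)"
    by (rule affine_connectionD(4)[OF D Z Z smooth_fun_const])
  then show ?case by (simp add: vf_scale_zero tv_zero_def)
next
  case (insert i I)
  have "(\<lambda>p f. \<Sum>i\<in>insert i I. h i p * E i p f) = vf_add (vf_scale (h i) (E i)) (\<lambda>p f. \<Sum>i\<in>I. h i p * E i p f)"
    using insert.hyps by (simp add: vf_add_def vf_scale_def tv_add_def tv_scale_def)
  then have "D (\<lambda>p f. \<Sum>i\<in>insert i I. h i p * E i p f) Z
      = vf_add (vf_scale (h i) (D (E i) Z)) (\<lambda>p f. \<Sum>i\<in>I. h i p * D (E i) Z p f)"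
    using insert Z vf_sum_closed[of I h E]
    by (simp add: affine_connectionD[OF D] vf_scale_closed)
  then show ?case using insert.hyps by (simp add: vf_add_def vf_scale_def tv_add_def tv_scale_def)
qed

lemma connection_sum_right:
  assumes D: "affine_connection A D" and X: "X \<in> vector_fields A"
    and "finite I" "\<And>i. i \<in> I \<Longrightarrow> h i \<in> smooth_fun A" "\<And>i. i \<in> I \<Longrightarrow> E i \<in> vector_fields A"
  shows "D X (\<lambda>p f. \<Sum>i\<in>I. h i p * E i p f)
    = (\<lambda>p f. \<Sum>i\<in>I. X p (h i) * E i p f + h i p * D X (E i) p f)"
  using assms(3-5)
proof (induction I)
  case empty
  have "D X (vf_scale (\<lambda>p. 0) X) = vf_add (vf_scale (\<lambda>p. X p (\<lambda>p. 0)) X) (vf_scale (\<lambda>p. 0) (D X X))"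
    by (rule affine_connectionD(5)[OF D X X smooth_fun_const])
  then show ?case by (simp add: vf_scale_zero vf_const[OF X]) (simp add: vf_add_def tv_zero_def tv_add_def)
next
  case (insert i I)
  have "(\<lambda>p f. \<Sum>i\<in>insert i I. h i p * E i p f) = vf_add (vf_scale (h i) (E i)) (\<lambda>p f. \<Sum>i\<in>I. h i p * E i p f)"
    using insert.hyps by (simp add: vf_add_def vf_scale_def tv_add_def tv_scale_def)
  then have "D X (\<lambda>p f. \<Sum>i\<in>insert i I. h i p * E i p f)
      = vf_add (vf_add (vf_scale (\<lambda>p. X p (h i)) (E i)) (vf_scale (h i) (D X (E i))))
         (\<lambda>p f. \<Sum>i\<in>I. X p (h i) * E i p f + h i p * D X (E i) p f)"
    using insert X vf_sum_closed[of I h E]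
    by (simp add: affine_connectionD[OF D] vf_scale_closed)
  then show ?case using insert.hyps by (simp add: vf_add_def vf_scale_def tv_add_def tv_scale_def)
qed

end

context manifold
begin

text \<open>The factor 4 leaves room for two nested cutoffs, one supported within radius
  \<open>2 * r\<close> and another, equal to 1 on that ball, within \<open>4 * r\<close>.\<close>

lemma chart_ball:
  assumes "(U, \<phi>) \<in> A" "p \<in> U"
  obtains r where "r > 0" "cball (\<phi> p) (4 * r) \<subseteq> \<phi> ` U"
proof -
  obtain e where "e > 0" "cball (\<phi> p) e \<subseteq> \<phi> ` U"
    using chart_open[OF assms(1)] assms(2) open_contains_cball by blast
  then show thesis using that[of "e / 4"] by simp
qed

lemma smooth_fun_bump:
  assumes U: "(U, \<phi>) \<in> A" and r: "cball y0 (2 * r) \<subseteq> \<phi> ` U" and H: "smooth_on (\<phi> ` U) H"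
    and \<eta>: "smooth_on UNIV \<eta>" "\<And>x. x \<notin> ball y0 (2 * r) \<Longrightarrow> \<eta> x = 0"
  shows "(\<lambda>q. if q \<in> U then \<eta> (\<phi> q) * H (\<phi> q) else 0) \<in> smooth_fun A"
  by (rule smooth_fun_extend[OF U compact_cball r])
    (use \<eta>(2) in \<open>auto intro!: smooth_on_mult H smooth_on_subset[OF \<eta>(1)] chart_open[OF U]\<close>)

lemma vector_field_bump:
  assumes U: "(U, \<phi>) \<in> A" and r: "cball y0 (2 * r) \<subseteq> \<phi> ` U"
    and \<eta>: "smooth_on UNIV \<eta>" "\<And>x. x \<notin> ball y0 (2 * r) \<Longrightarrow> \<eta> x = 0"
  shows "(\<lambda>q. if q \<in> U then chart_vec A U \<phi> q (\<eta> (\<phi> q) *\<^sub>R w) else tv_zero) \<in> vector_fields A" (is "?E \<in> _")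
proof -
  have E: "?E q f = (if q \<in> U then \<eta> (\<phi> q) * dd (f \<circ> inv_into U \<phi>) (\<phi> q) w else 0)"
    if "f \<in> smooth_fun A" for q f
    using that by (auto simp: chart_vec_scale[OF U]) (auto simp: tv_scale_def chart_vec_def tv_zero_def)
  have "(\<lambda>q. ?E q f) \<in> smooth_fun A" if f: "f \<in> smooth_fun A" for f
    unfolding E[OF f]
    by (rule smooth_fun_bump[OF U r smooth_on_dd_const[OF smooth_funD[OF f U]] \<eta>])
  moreover have "?E q \<in> tangent_space A q" if "q \<in> carr A" for q
    using that chart_vec_in_tangent_space[OF U] tangent_space_zero by simp
  moreover have "?E q = tv_zero" if "q \<notin> carr A" for q
    using that carrI[OF U] by auto
  ultimately show ?thesis by (simp add: vector_fields_def)
qed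

text \<open>Tangent vectors only act on global functions, so the coordinates near \<open>p\<close>
  are multiplied by a cutoff and extended by 0.\<close>

lemma coordinate_functions:
  assumes U: "(U, \<phi>) \<in> A" "p \<in> U"
  obtains x r where "r > 0" "ball (\<phi> p) r \<subseteq> \<phi> ` U" "\<And>b. x b \<in> smooth_fun A"
    "\<And>b q. q \<in> U \<Longrightarrow> \<phi> q \<in> ball (\<phi> p) r \<Longrightarrow> x b q = \<phi> q \<bullet> b"
proof -
  obtain r where r: "r > 0" "cball (\<phi> p) (4 * r) \<subseteq> \<phi> ` U" using chart_ball[OF U] .
  then have r2: "cball (\<phi> p) (2 * r) \<subseteq> \<phi> ` U" by (auto simp: subset_iff)
  obtain \<eta> :: "'e \<Rightarrow> real" where \<eta>: "smooth_on UNIV \<eta>" "\<And>x. x \<in> ball (\<phi> p) r \<Longrightarrow> \<eta> x = 1"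
    "\<And>x. x \<notin> ball (\<phi> p) (2 * r) \<Longrightarrow> \<eta> x = 0" by (rule bump_function[OF r(1), of "\<phi> p"]) (rule that, assumption+)
  have H: "smooth_on (\<phi> ` U) (\<lambda>y. y \<bullet> b)" for b
    by (rule smooth_on_linear[OF bounded_linear_inner_left chart_open[OF U(1)]])
  show thesis
  proof (rule that[of r "\<lambda>b q. if q \<in> U then \<eta> (\<phi> q) * (\<phi> q \<bullet> b) else 0"])
    show "ball (\<phi> p) r \<subseteq> \<phi> ` U" using r by (auto simp: subset_iff)
  qed (use r \<eta> smooth_fun_bump[OF U(1) r2 H \<eta>(1,3)] in auto)
qed

lemma chart_vec_coordinate:
  assumes "x \<in> smooth_fun A" "(U, \<phi>) \<in> A" "q \<in> U" "open T" "\<phi> q \<in> T"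
    "\<And>q'. q' \<in> U \<Longrightarrow> \<phi> q' \<in> T \<Longrightarrow> x q' = \<phi> q' \<bullet> b"
  shows "chart_vec A U \<phi> q w x = w \<bullet> b"
proof -
  have "dd (x \<circ> inv_into U \<phi>) (\<phi> q) = dd (\<lambda>y. y \<bullet> b) (\<phi> q)"
    by (rule dd_cong(1)[of "T \<inter> \<phi> ` U"]) (use assms in \<open>auto simp: chart_open inv_chart\<close>)
  moreover have "dd (\<lambda>y. y \<bullet> b) (\<phi> q) = (\<lambda>w. w \<bullet> b)"
    by (rule dd_eq) (auto intro!: derivative_eq_intros)
  ultimately show ?thesis using assms(1) by (simp add: chart_vec_def)
qed

text \<open>The cut-off coordinates are smooth on the whole manifold and recover all components of a
  chart vector.\<close>

lemma chart_vec_inject: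
  assumes U: "(U, \<phi>) \<in> A" "q \<in> U"
  shows "chart_vec A U \<phi> q v = chart_vec A U \<phi> q w \<longleftrightarrow> v = w"
proof
  assume eq: "chart_vec A U \<phi> q v = chart_vec A U \<phi> q w"
  obtain x r where x: "r > 0" "ball (\<phi> q) r \<subseteq> \<phi> ` U" "\<And>b. x b \<in> smooth_fun A"
    "\<And>b q'. q' \<in> U \<Longrightarrow> \<phi> q' \<in> ball (\<phi> q) r \<Longrightarrow> x b q' = \<phi> q' \<bullet> b" by (rule coordinate_functions[OF U]) (rule that, assumption+)
  have "chart_vec A U \<phi> q w (x b) = w \<bullet> b" for w b
    by (rule chart_vec_coordinate[OF x(3) U open_ball _ x(4)]) (use x in auto)
  then show "v = w" using eq by (metis euclidean_eqI)
qed simp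

lemma components:
  assumes Z: "Z \<in> vector_fields A" and U: "(U, \<phi>) \<in> A" "q \<in> U"
  shows "Z q = chart_vec A U \<phi> q (components A U \<phi> Z (\<phi> q))"
proof -
  obtain w where w: "Z q = chart_vec A U \<phi> q w"
    using vector_fieldD(1)[OF Z carrI[OF U]] U by (rule tangent_spaceE)
  then have "components A U \<phi> Z (\<phi> q) = w" unfolding components_def
    by (intro the_equality) (simp_all add: inv_chart[OF U] chart_vec_inject[OF U])
  then show ?thesis using w by simp
qed

lemma components_eq:
  assumes U: "(U, \<phi>) \<in> A" "q \<in> U" and "Z q = chart_vec A U \<phi> q w"
  shows "components A U \<phi> Z (\<phi> q) = w"
  unfolding components_def
  by (rule the_equality) (simp_all add: inv_chart[OF U] assms(3) chart_vec_inject[OF U])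

lemma components_coordinate:
  assumes "x \<in> smooth_fun A" "Z \<in> vector_fields A" "(U, \<phi>) \<in> A" "q \<in> U" "open T" "\<phi> q \<in> T"
    "\<And>q'. q' \<in> U \<Longrightarrow> \<phi> q' \<in> T \<Longrightarrow> x q' = \<phi> q' \<bullet> b"
  shows "components A U \<phi> Z (\<phi> q) \<bullet> b = Z q x"
  using chart_vec_coordinate[OF assms(1,3-7)] components[OF assms(2-4)] by metis

lemma smooth_on_components:
  assumes Z: "Z \<in> vector_fields A" and U: "(U, \<phi>) \<in> A"
  shows "smooth_on (\<phi> ` U) (components A U \<phi> Z)"
proof (rule smooth_on_local)
  fix y assume "y \<in> \<phi> ` U"
  then obtain p where p: "p \<in> U" "y = \<phi> p" by blast
  obtain x r where x: "r > 0" "ball (\<phi> p) r \<subseteq> \<phi> ` U" "\<And>b. x b \<in> smooth_fun A"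
    "\<And>b q. q \<in> U \<Longrightarrow> \<phi> q \<in> ball (\<phi> p) r \<Longrightarrow> x b q = \<phi> q \<bullet> b" by (rule coordinate_functions[OF U p(1)]) (rule that, assumption+)
  have "smooth_on (ball (\<phi> p) r) (components A U \<phi> Z)"
  proof (rule smooth_on_euclidean[OF open_ball])
    fix b
    have eq: "components A U \<phi> Z y \<bullet> b = ((\<lambda>q. Z q (x b)) \<circ> inv_into U \<phi>) y" if y: "y \<in> ball (\<phi> p) r" for y
    proof -
      obtain q where q: "q \<in> U" "y = \<phi> q" using y x(2) by blast
      show ?thesis
        using components_coordinate[OF x(3) Z U q(1) open_ball _ x(4)] y q
        by (simp add: inv_chart[OF U])
    qed
    have "smooth_on (ball (\<phi> p) r) ((\<lambda>q. Z q (x b)) \<circ> inv_into U \<phi>)"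
      by (rule smooth_on_subset[OF smooth_funD[OF vector_fieldD(3)[OF Z x(3)] U] x(2)])
    then show "smooth_on (ball (\<phi> p) r) (\<lambda>y. components A U \<phi> Z y \<bullet> b)"
      by (rule iffD2[OF smooth_on_cong[of "ball (\<phi> p) r" "\<lambda>y. components A U \<phi> Z y \<bullet> b"
            "(\<lambda>q. Z q (x b)) \<circ> inv_into U \<phi>", OF open_ball eq], rotated])
  qed
  then show "\<exists>T. open T \<and> y \<in> T \<and> smooth_on T (components A U \<phi> Z)" using x(1) p by (metis open_ball centre_in_ball)
qed

end

text \<open>The Christoffel symbols \<open>\<Gamma>\<close> of \<open>D\<close> on an open part \<open>T\<close> of a chart, together with globally
  defined vector fields \<open>E b\<close> that restrict to the coordinate fields.\<close>

locale frame = manifold A for A :: "('a, 'e::euclidean_space) atlas" +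
  fixes D :: "'a conn" and U :: "'a set" and \<phi> :: "'a \<Rightarrow> 'e" and T :: "'e set"
    and \<Gamma> :: "'e \<Rightarrow> 'e \<Rightarrow> 'e \<Rightarrow> 'e" and E :: "'e \<Rightarrow> 'a vfield"
  assumes U: "(U, \<phi>) \<in> A" and open_T: "open T" and T_sub: "T \<subseteq> \<phi> ` U"
    and \<Gamma>_smooth: "smooth_on T (\<lambda>y. \<Gamma> y v w)"
    and \<Gamma>_bilinear: "bilinear (\<Gamma> y)"
    and \<Gamma>_symmetric: "y \<in> T \<Longrightarrow> \<Gamma> y v w = \<Gamma> y w v"
    and E_field: "E w \<in> vector_fields A"
    and E_eq: "q \<in> U \<Longrightarrow> \<phi> q \<in> T \<Longrightarrow> E w q = chart_vec A U \<phi> q w"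
    and D_eq: "X \<in> vector_fields A \<Longrightarrow> Z \<in> vector_fields A \<Longrightarrow> q \<in> U \<Longrightarrow> \<phi> q \<in> T \<Longrightarrow>
      D X Z q = chart_vec A U \<phi> q (dd (components A U \<phi> Z) (\<phi> q) (components A U \<phi> X (\<phi> q)) +
        \<Gamma> (\<phi> q) (components A U \<phi> X (\<phi> q)) (components A U \<phi> Z (\<phi> q)))"

context manifold
begin

text \<open>With \<open>x b\<close> equal to the coordinates on the support of the cutoff \<open>\<xi>\<close> and \<open>E b = \<xi> \<partial>\<^sub>b\<close>, the
  identity \<open>\<xi> Z = (\<Sum>b. Z (x b) E b)\<close> holds globally, so that the connection axioms apply to it.\<close>

lemma frame_exists:
  assumes D: "levi_civita A g D" and U: "(U, \<phi>) \<in> A" "p \<in> U"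
  obtains T \<Gamma> E where "frame A D U \<phi> T \<Gamma> E" "\<phi> p \<in> T"
proof -
  have aff: "affine_connection A D" using D by (simp add: levi_civita_def)
  obtain r where r: "r > 0" "cball (\<phi> p) (4 * r) \<subseteq> \<phi> ` U" using chart_ball[OF U] .
  then have r2: "cball (\<phi> p) (2 * r) \<subseteq> \<phi> ` U" "cball (\<phi> p) (2 * (2 * r)) \<subseteq> \<phi> ` U" by (auto simp: subset_iff)
  obtain \<eta> :: "'e \<Rightarrow> real" where \<eta>: "smooth_on UNIV \<eta>" "\<And>x. x \<in> ball (\<phi> p) r \<Longrightarrow> \<eta> x = 1"
    "\<And>x. x \<notin> ball (\<phi> p) (2 * r) \<Longrightarrow> \<eta> x = 0" by (rule bump_function[OF r(1), of "\<phi> p"]) (rule that, assumption+)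
  \<comment> \<open>The second cutoff is 1 on the ball outside which the first one vanishes. So
    \<open>x b\<close> is a genuine coordinate wherever \<open>\<xi>\<close> or \<open>E b\<close>
    can be nonzero.\<close>
  obtain \<eta>' :: "'e \<Rightarrow> real" where \<eta>': "smooth_on UNIV \<eta>'" "\<And>x. x \<in> ball (\<phi> p) (2 * r) \<Longrightarrow> \<eta>' x = 1"
    "\<And>x. x \<notin> ball (\<phi> p) (2 * (2 * r)) \<Longrightarrow> \<eta>' x = 0" using bump_function[of "2 * r" "\<phi> p"] r(1) by (metis mult_pos_pos zero_less_numeral)
  define \<xi> where "\<xi> q = (if q \<in> U then \<eta> (\<phi> q) else 0)" for q
  define x where "x b q = (if q \<in> U then \<eta>' (\<phi> q) * (\<phi> q \<bullet> b) else 0)" for b q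
  define E where "E w q = (if q \<in> U then chart_vec A U \<phi> q (\<eta> (\<phi> q) *\<^sub>R w) else tv_zero)" for w q
  define T where "T = ball (\<phi> p) r"
  have T: "open T" "T \<subseteq> \<phi> ` U" "T \<subseteq> ball (\<phi> p) (2 * r)" using r by (auto simp: T_def subset_iff)
  have \<xi>: "\<xi> \<in> smooth_fun A"
    using smooth_fun_bump[OF U(1) r2(1) smooth_on_const[of _ 1] \<eta>(1,3)] by (simp add: \<xi>_def[abs_def] cong: if_cong)
  have H: "smooth_on (\<phi> ` U) (\<lambda>y. y \<bullet> b)" for b
    by (rule smooth_on_linear[OF bounded_linear_inner_left chart_open[OF U(1)]])
  have x: "x b \<in> smooth_fun A" for b
    unfolding x_def[abs_def] by (rule smooth_fun_bump[OF U(1) r2(2) H \<eta>'(1,3)])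
  have E: "E w \<in> vector_fields A" for w
    unfolding E_def[abs_def] by (rule vector_field_bump[OF U(1) r2(1) \<eta>(1,3)])
  have x_eq: "x b q = \<phi> q \<bullet> b" if "q \<in> U" "\<phi> q \<in> ball (\<phi> p) (2 * r)" for b q
    using that \<eta>'(2) by (simp add: x_def)
  have comp: "components A U \<phi> Z (\<phi> q) \<bullet> b = Z q (x b)"
    if "Z \<in> vector_fields A" "q \<in> U" "\<phi> q \<in> ball (\<phi> p) (2 * r)" for Z b q
    by (rule components_coordinate[OF x that(1) U(1) that(2) open_ball that(3) x_eq])
  have E_eq: "E w q = chart_vec A U \<phi> q w" if "q \<in> U" "\<phi> q \<in> T" for q w
    using that \<eta>(2) by (simp add: E_def T_def)
  define h where "h Z b q = Z q (x b)" for Z :: "'a vfield" and b q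
  have h: "h Z b \<in> smooth_fun A" if "Z \<in> vector_fields A" for Z b
    unfolding h_def[abs_def] by (rule vector_fieldD(3)[OF that x])
  have expand: "vf_scale \<xi> Z = (\<lambda>q f. \<Sum>b\<in>Basis. h Z b q * E b q f)" if Z: "Z \<in> vector_fields A" for Z
  proof (intro ext)
    fix q f
    \<comment> \<open>Either the \<open>x b\<close> are coordinates at \<open>q\<close> and the
      components can be read off, or both sides vanish there.\<close>
    consider "q \<in> U" "\<phi> q \<in> ball (\<phi> p) (2 * r)" | "q \<in> U" "\<eta> (\<phi> q) = 0" | "q \<notin> U" using \<eta>(3) by blast
    then show "vf_scale \<xi> Z q f = (\<Sum>b\<in>Basis. h Z b q * E b q f)"
    proof cases
      case 1
      have "Z q = chart_vec A U \<phi> q (components A U \<phi> Z (\<phi> q))"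
        by (rule components[OF Z U(1) 1(1)])
      also have "components A U \<phi> Z (\<phi> q) = (\<Sum>b\<in>Basis. h Z b q *\<^sub>R b)"
        by (subst euclidean_representation[symmetric]) (simp add: comp[OF Z 1] h_def)
      finally have "Z q f = (\<Sum>b\<in>Basis. h Z b q * chart_vec A U \<phi> q b f)"
        by (simp add: chart_vec_sum[OF U(1) 1(1)])
      then show ?thesis using 1
        by (simp add: vf_scale_def tv_scale_def \<xi>_def E_def chart_vec_scale[OF U(1)] sum_distrib_left mult_ac)
    next
      case 2
      then show ?thesis by (simp add: vf_scale_def tv_scale_def \<xi>_def E_def chart_vec_0[OF U(1)] tv_zero_def)
    next
      case 3
      then show ?thesis by (simp add: vf_scale_def tv_scale_def \<xi>_def E_def tv_zero_def)
    qed
  qed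
  have \<xi>1: "\<xi> q = 1" if "q \<in> U" "\<phi> q \<in> T" for q using that \<eta>(2) by (simp add: \<xi>_def T_def)
  \<comment> \<open>\<open>\<xi>\<close> is constant near \<open>q\<close>, so the derivative term
    in the Leibniz rule for \<open>\<xi> Z\<close> disappears and \<open>D X Z\<close> at
    \<open>q\<close> is computed from the expansion.\<close>
  have X\<xi>: "X q \<xi> = 0" if X: "X \<in> vector_fields A" and q: "q \<in> U" "\<phi> q \<in> T" for X q
  proof -
    have "X q \<xi> = X q (\<lambda>q. 1)"
      by (rule tangent_cong_near[OF vector_fieldD(1)[OF X carrI[OF U(1) q(1)]] U(1) q(1) T(1) q(2)])
        (use \<xi>1 \<xi> smooth_fun_const in auto)
    then show ?thesis using vf_const[OF X] by simp
  qed
  have D_right: "D X Z q f = (\<Sum>b\<in>Basis. X q (h Z b) * E b q f + h Z b q * D X (E b) q f)"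
    if X: "X \<in> vector_fields A" and Z: "Z \<in> vector_fields A" and q: "q \<in> U" "\<phi> q \<in> T" for X Z q f
  proof -
    have "D X (vf_scale \<xi> Z) = vf_add (vf_scale (\<lambda>p. X p \<xi>) Z) (vf_scale \<xi> (D X Z))"
      by (rule affine_connectionD(5)[OF aff X Z \<xi>])
    then have "D X (vf_scale \<xi> Z) q f = D X Z q f"
      using X\<xi>[OF X q] \<xi>1[OF q] by (simp add: vf_add_def vf_scale_def tv_add_def tv_scale_def)
    moreover have "D X (\<lambda>q f. \<Sum>b\<in>Basis. h Z b q * E b q f)
        = (\<lambda>q f. \<Sum>b\<in>Basis. X q (h Z b) * E b q f + h Z b q * D X (E b) q f)"
      by (rule connection_sum_right[OF aff X finite_Basis h[OF Z] E])
    ultimately show ?thesis unfolding expand[OF Z] by simp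
  qed
  have D_left: "D X Z q f = (\<Sum>b\<in>Basis. h X b q * D (E b) Z q f)"
    if X: "X \<in> vector_fields A" and Z: "Z \<in> vector_fields A" and q: "q \<in> U" "\<phi> q \<in> T" for X Z q f
  proof -
    have "D (vf_scale \<xi> X) Z = vf_scale \<xi> (D X Z)"
      by (rule affine_connectionD(4)[OF aff X Z \<xi>])
    then have "D (vf_scale \<xi> X) Z q f = D X Z q f"
      using \<xi>1[OF q] by (simp add: vf_scale_def tv_scale_def)
    moreover have "D (\<lambda>q f. \<Sum>b\<in>Basis. h X b q * E b q f) Z
        = (\<lambda>q f. \<Sum>b\<in>Basis. h X b q * D (E b) Z q f)"
      by (rule connection_sum_left[OF aff Z finite_Basis h[OF X] E])
    ultimately show ?thesis unfolding expand[OF X] by simp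
  qed
  define G where "G c b = components A U \<phi> (D (E c) (E b))" for c b
  have DE: "D (E c) (E b) \<in> vector_fields A" for c b by (rule affine_connectionD(1)[OF aff E E])
  have DEG: "D (E c) (E b) q = chart_vec A U \<phi> q (G c b (\<phi> q))" if "q \<in> U" for b c q
    unfolding G_def by (rule components[OF DE U(1) that])
  \<comment> \<open>The components of \<open>D (E c) (E b)\<close> are the Christoffel symbols on
    \<open>T\<close>, extended bilinearly to arbitrary vectors.\<close>
  define \<Gamma> where "\<Gamma> y v w = (\<Sum>b\<in>Basis. \<Sum>c\<in>Basis. ((w \<bullet> b) * (v \<bullet> c)) *\<^sub>R G c b y)" for y v w
  have hh: "h Z b q = components A U \<phi> Z (\<phi> q) \<bullet> b" if "Z \<in> vector_fields A" "q \<in> U" "\<phi> q \<in> T" for Z b q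
    using comp[OF that(1,2), of b] that(3) T(3) by (auto simp: h_def)
  \<comment> \<open>Torsion-freeness applied to coordinate fields. Their bracket vanishes on the
    cut-off coordinates because \<open>E b\<close> maps \<open>x d\<close> to a constant near
    \<open>q\<close>.\<close>
  have G_sym: "G c b (\<phi> q) = G b c (\<phi> q)" if q: "q \<in> U" "\<phi> q \<in> T" for b c q
  proof (rule euclidean_eqI)
    fix d
    have 0: "E c q (\<lambda>q'. E b q' (x d)) = 0" for b c
    proof -
      have "E c q (\<lambda>q'. E b q' (x d)) = E c q (\<lambda>q'. b \<bullet> d)"
      proof (rule tangent_cong_near[OF vector_fieldD(1)[OF E carrI[OF U(1) q(1)]] U(1) q(1) T(1) q(2)])
        fix q' assume q': "q' \<in> U" "\<phi> q' \<in> T"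
        have "components A U \<phi> (E b) (\<phi> q') = b" by (rule components_eq[where Z = "E b", OF U(1) q'(1) E_eq[OF q']])
        then show "E b q' (x d) = b \<bullet> d" using hh[OF E q', of b d] by (simp add: h_def)
      qed (use vector_fieldD(3)[OF E x] smooth_fun_const in auto)
      then show ?thesis using vf_const[OF E] by simp
    qed
    have "vf_add (D (E c) (E b)) (vf_scale (\<lambda>p. -1) (D (E b) (E c))) = lie_bracket (E c) (E b)"
      using D E by (simp add: levi_civita_def)
    then have "D (E c) (E b) q (x d) - D (E b) (E c) q (x d) = lie_bracket (E c) (E b) q (x d)"
      by (auto simp: vf_add_def vf_scale_def tv_add_def tv_scale_def dest!: fun_cong[of _ _ q] fun_cong[of _ _ "x d"])
    also have "\<dots> = 0" by (simp add: lie_bracket_def 0)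
    finally show "G c b (\<phi> q) \<bullet> d = G b c (\<phi> q) \<bullet> d"
      using hh[OF DE q, of c b d] hh[OF DE q, of b c d] by (simp add: h_def G_def)
  qed
  have "frame A D U \<phi> T \<Gamma> E"
  proof unfold_locales
    show "smooth_on T (\<lambda>y. \<Gamma> y v w)" for v w unfolding \<Gamma>_def G_def
      by (intro smooth_on_sum smooth_on_scaleR smooth_on_const T(1) smooth_on_subset[OF smooth_on_components[OF DE U(1)] T(2)])
    show "bilinear (\<Gamma> y)" for y
      unfolding bilinear_def
      by (intro conjI allI linearI)
        (simp_all add: \<Gamma>_def inner_add_left algebra_simps sum.distrib scaleR_sum_right scaleR_left_distrib)
    show "\<Gamma> y v w = \<Gamma> y w v" if y: "y \<in> T" for y v w
    proof -
      obtain q where q: "q \<in> U" "y = \<phi> q" using y T(2) by blast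
      have "\<Gamma> y v w = (\<Sum>c\<in>Basis. \<Sum>b\<in>Basis. ((w \<bullet> b) * (v \<bullet> c)) *\<^sub>R G c b y)"
        unfolding \<Gamma>_def by (rule sum.swap)
      then show ?thesis unfolding \<Gamma>_def using G_sym[OF q(1)] y q by (simp add: mult.commute)
    qed
    fix X Z q assume X: "X \<in> vector_fields A" and Z: "Z \<in> vector_fields A" and q: "q \<in> U" "\<phi> q \<in> T"
    let ?X = "components A U \<phi> X" and ?Z = "components A U \<phi> Z"
    show "D X Z q = chart_vec A U \<phi> q (dd ?Z (\<phi> q) (?X (\<phi> q)) + \<Gamma> (\<phi> q) (?X (\<phi> q)) (?Z (\<phi> q)))"
    proof
      fix f
      have dZ: "?Z differentiable (at (\<phi> q))"
        by (rule smooth_on_differentiable[OF smooth_on_components[OF Z U(1)]]) (use q in simp)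
      have Xh: "X q (h Z b) = dd ?Z (\<phi> q) (?X (\<phi> q)) \<bullet> b" for b
      proof -
        have "X q (h Z b) = dd (h Z b \<circ> inv_into U \<phi>) (\<phi> q) (?X (\<phi> q))"
          using components[OF X U(1) q(1)] h[OF Z, of b]
          by (simp add: chart_vec_def)
        also have "dd (h Z b \<circ> inv_into U \<phi>) (\<phi> q) = dd (\<lambda>y. ?Z y \<bullet> b) (\<phi> q)"
        proof (rule dd_cong(1)[OF T(1) q(2)])
          fix y assume y: "y \<in> T"
          then obtain q' where "q' \<in> U" "y = \<phi> q'" using T(2) by blast
          then show "(h Z b \<circ> inv_into U \<phi>) y = ?Z y \<bullet> b" using hh[OF Z, of q' b] y by (simp add: inv_chart[OF U(1)])
        qed
        finally show ?thesis using dd_inner[OF dZ] by simp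
      qed
      have "D X Z q f = (\<Sum>b\<in>Basis. X q (h Z b) * E b q f + h Z b q * D X (E b) q f)"
        by (rule D_right[OF X Z q])
      also have "\<dots> = (\<Sum>b\<in>Basis. (dd ?Z (\<phi> q) (?X (\<phi> q)) \<bullet> b) * chart_vec A U \<phi> q b f)
         + (\<Sum>b\<in>Basis. (?Z (\<phi> q) \<bullet> b) * (\<Sum>c\<in>Basis. (?X (\<phi> q) \<bullet> c) * chart_vec A U \<phi> q (G c b (\<phi> q)) f))"
        by (simp add: Xh E_eq[OF q] D_left[OF X E q] hh[OF X q] hh[OF Z q] DEG[OF q(1)] sum.distrib)
      also have "(\<Sum>b\<in>Basis. (dd ?Z (\<phi> q) (?X (\<phi> q)) \<bullet> b) * chart_vec A U \<phi> q b f)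
         = chart_vec A U \<phi> q (dd ?Z (\<phi> q) (?X (\<phi> q))) f"
        using fun_cong[OF chart_vec_sum[OF U(1) q(1), where I = Basis and a = "\<lambda>b. dd ?Z (\<phi> q) (?X (\<phi> q)) \<bullet> b" and v = "\<lambda>b. b"], of f]
        by (simp add: euclidean_representation)
      also have "(\<Sum>b\<in>Basis. (?Z (\<phi> q) \<bullet> b) * (\<Sum>c\<in>Basis. (?X (\<phi> q) \<bullet> c) * chart_vec A U \<phi> q (G c b (\<phi> q)) f))
         = chart_vec A U \<phi> q (\<Gamma> (\<phi> q) (?X (\<phi> q)) (?Z (\<phi> q))) f"
        by (simp add: \<Gamma>_def chart_vec_sum[OF U(1) q(1)] flip: scaleR_scaleR scaleR_sum_right)
      finally show "D X Z q f = chart_vec A U \<phi> q (dd ?Z (\<phi> q) (?X (\<phi> q)) + \<Gamma> (\<phi> q) (?X (\<phi> q)) (?Z (\<phi> q))) f"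
        by (simp add: chart_vec_add[OF U(1) q(1)] tv_add_def)
    qed
  qed (use U T E E_eq in auto)
  then show thesis using that r(1) by (simp add: T_def)
qed

end

section \<open>Covariant derivatives along curves and total derivatives\<close>

context frame
begin

abbreviation "tv \<equiv> chart_vec A U \<phi>"
abbreviation "comps \<equiv> components A U \<phi>"

definition nabla :: "(real \<Rightarrow> 'e) \<Rightarrow> (real \<Rightarrow> 'e) \<Rightarrow> real \<Rightarrow> 'e" where
  "nabla c v t = vector_derivative v (at t) + \<Gamma> (c t) (vector_derivative c (at t)) (v t)"

lemma \<Gamma>_linear: "linear (\<Gamma> y v)" "linear (\<lambda>v. \<Gamma> y v w)"
  using \<Gamma>_bilinear[of y] by (auto simp: bilinear_def)

lemma smooth_on_\<Gamma>:
  assumes "open S" "smooth_on S f" "smooth_on S g" "smooth_on S h" "f ` S \<subseteq> T"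
  shows "smooth_on S (\<lambda>x. \<Gamma> (f x) (g x) (h x))"
proof -
  \<comment> \<open>\<open>\<Gamma>_smooth\<close> only covers fixed vector arguments; bilinearity
    reduces varying ones to scalar multiples of basis vectors.\<close>
  have eq: "\<Gamma> y v w = (\<Sum>b\<in>Basis. \<Sum>c\<in>Basis. (v \<bullet> b) *\<^sub>R (w \<bullet> c) *\<^sub>R \<Gamma> y b c)" for y v w
  proof -
    have "\<Gamma> y v w = \<Gamma> y (\<Sum>b\<in>Basis. (v \<bullet> b) *\<^sub>R b) (\<Sum>c\<in>Basis. (w \<bullet> c) *\<^sub>R c)"
      by (simp add: euclidean_representation)
    also have "\<dots> = (\<Sum>b\<in>Basis. (v \<bullet> b) *\<^sub>R \<Gamma> y b (\<Sum>c\<in>Basis. (w \<bullet> c) *\<^sub>R c))"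
      by (simp add: linear_sum[OF \<Gamma>_linear(2)] linear_scale[OF \<Gamma>_linear(2)])
    also have "\<dots> = (\<Sum>b\<in>Basis. \<Sum>c\<in>Basis. (v \<bullet> b) *\<^sub>R (w \<bullet> c) *\<^sub>R \<Gamma> y b c)"
      by (simp add: linear_sum[OF \<Gamma>_linear(1)] linear_scale[OF \<Gamma>_linear(1)] scaleR_sum_right del: scaleR_scaleR)
    finally show ?thesis .
  qed
  have "smooth_on S (\<lambda>x. \<Sum>b\<in>Basis. \<Sum>c\<in>Basis. (g x \<bullet> b) *\<^sub>R (h x \<bullet> c) *\<^sub>R \<Gamma> (f x) b c)"
    by (intro smooth_on_sum smooth_on_scaleR smooth_on_inner smooth_on_const assms(1-4)
      smooth_on_compose[OF \<Gamma>_smooth assms(2,1) open_T assms(5)])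
  moreover have "(\<lambda>x. \<Gamma> (f x) (g x) (h x))
      = (\<lambda>x. \<Sum>b\<in>Basis. \<Sum>c\<in>Basis. (g x \<bullet> b) *\<^sub>R (h x \<bullet> c) *\<^sub>R \<Gamma> (f x) b c)"
    by (rule ext) (rule eq)
  ultimately show ?thesis by (rule ssubst[rotated])
qed

lemma smooth_on_nabla:
  assumes "open J" "smooth_on J c" "smooth_on J v" "c ` J \<subseteq> T"
  shows "smooth_on J (nabla c v)"
  unfolding nabla_def[abs_def]
  by (intro smooth_on_add smooth_on_\<Gamma> smooth_on_vector_derivative assms)

lemma field_at:
  assumes "q \<in> U" "\<phi> q \<in> T"
  shows "E w \<in> vector_fields A" "comps (E w) (\<phi> q) = w"
  using components_eq[where Z = "E w", OF U assms(1) E_eq[OF assms]] E_field by simp_all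

lemma D_field_at:
  assumes X: "X \<in> vector_fields A" and q: "q \<in> U" "\<phi> q \<in> T"
  shows "D X (E w) q = tv q (\<Gamma> (\<phi> q) (comps X (\<phi> q)) w)"
proof -
  have "dd (comps (E w)) (\<phi> q) = dd (\<lambda>y. w) (\<phi> q)"
  proof (rule dd_cong(1)[OF open_T q(2)])
    fix y assume y: "y \<in> T"
    then obtain q' where "q' \<in> U" "y = \<phi> q'" using T_sub by blast
    then show "comps (E w) y = w" using field_at[of q'] y by simp
  qed
  then show ?thesis using D_eq[OF X E_field q, of w] field_at(2)[OF q] by simp
qed

text \<open>The definite description in \<open>cov_deriv_along\<close> is settled in two halves. The
  frame provides one admissible representation, and differentiating the components of any
  representation gives the same coordinate expression \<open>nabla\<close>, so that neither the
  choice of fields nor that of \<open>X\<close> matters.\<close>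

lemma cov_deriv_along_eq:
  assumes J: "open J" "t \<in> J" and C: "smooth_on J C" "C ` J \<subseteq> T" and v: "smooth_on J v"
    and c: "\<And>r. r \<in> J \<Longrightarrow> c r \<in> U \<and> \<phi> (c r) = C r" and V: "\<And>r. r \<in> J \<Longrightarrow> V r = tv (c r) (v r)"
  shows "cov_deriv_along A D c V t = tv (c t) (nabla C v t)"
proof -
  have ct: "c t \<in> U" "\<phi> (c t) = C t" "C t \<in> T" "\<phi> (c t) \<in> T" using c[OF J(2)] C(2) J(2) by auto
  have dC: "(C has_vector_derivative vector_derivative C (at t)) (at t)"
    using smooth_on_vderiv[OF C(1) J(2)] by simp
  have dv: "(v has_vector_derivative vector_derivative v (at t)) (at t)"
    using smooth_on_vderiv[OF v J(2)] by simp
  have vel: "velocity A c t = tv (c t) (vector_derivative C (at t))"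
  proof (rule velocity_chart_deriv[where c = c and t = t, OF U ct(1) J])
    show "((\<lambda>r. \<phi> (c r)) has_vector_derivative vector_derivative C (at t)) (at t)"
      by (rule has_vector_derivative_transform_within_open[OF dC J]) (use c in simp)
  qed (use c in auto)
  show ?thesis unfolding cov_deriv_along_def
  proof (rule the_equality)
    \<comment> \<open>The sum in the definition runs over numbers below \<open>m\<close>, so the
      basis is enumerated. The fields \<open>E (e i)\<close> and the components of \<open>v\<close>
      give the representation, and \<open>?X\<close> is a global field through the velocity of
      \<open>c\<close>.\<close>
    obtain e where e: "bij_betw e {0..<card (Basis :: 'e set)} (Basis :: 'e set)"
      using ex_bij_betw_nat_finite[OF finite_Basis] by blast
    let ?m = "card (Basis :: 'e set)" and ?a = "\<lambda>i r. v r \<bullet> e i" and ?Z = "\<lambda>i. E (e i)"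
      and ?X = "E (vector_derivative C (at t))"
    have sum_e: "(\<Sum>i<?m. f (e i)) = (\<Sum>b\<in>Basis. f b)" for f :: "'e \<Rightarrow> real"
      using sum.reindex_bij_betw[OF e] by (simp add: atLeast0LessThan)
    have sm: "smooth_on J (?a i)" for i
      by (rule smooth_on_bounded_linear[OF bounded_linear_inner_left J(1) v])
    have rep: "tv q w f = (\<Sum>b\<in>Basis. (w \<bullet> b) * tv q b f)" if "q \<in> U" for q w f
      using fun_cong[OF chart_vec_sum[OF U that, where I = Basis and a = "\<lambda>b. w \<bullet> b" and v = "\<lambda>b. b"], of f]
      by (simp add: euclidean_representation)
    have V_eq: "\<forall>\<^sub>F r in nhds t. V r = (\<lambda>f. \<Sum>i<?m. ?a i r * ?Z i (c r) f)"
    proof -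
      have "V r = (\<lambda>f. \<Sum>i<?m. ?a i r * ?Z i (c r) f)" if r: "r \<in> J" for r
      proof -
        have cr: "c r \<in> U" "\<phi> (c r) \<in> T" using c[OF r] C(2) r by auto
        show ?thesis unfolding V[OF r] E_eq[OF cr]
        proof
          fix f
          show "tv (c r) (v r) f = (\<Sum>i<?m. v r \<bullet> e i * tv (c r) (e i) f)"
            using sum_e[of "\<lambda>b. (v r \<bullet> b) * tv (c r) b f"] rep[OF cr(1), of "v r" f] by (rule trans[OF _ sym, rotated])
        qed
      qed
      then show ?thesis using J eventually_nhds by blast
    qed
    have X_eq: "?X (c t) = velocity A c t" using E_eq[OF ct(1,4)] vel by simp
    have da: "deriv (?a i) t = vector_derivative v (at t) \<bullet> e i" for i
    proof -
      have "((\<lambda>r. v r \<bullet> e i) has_vector_derivative vector_derivative v (at t) \<bullet> e i) (at t)"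
        by (rule bounded_linear.has_vector_derivative[OF bounded_linear_inner_left dv])
      then show ?thesis by (simp add: DERIV_imp_deriv has_real_derivative_iff_has_vector_derivative)
    qed
    have \<Gamma>_rep: "tv (c t) (\<Gamma> y u w) f = (\<Sum>b\<in>Basis. (w \<bullet> b) * tv (c t) (\<Gamma> y u b) f)" for y u w f
    proof -
      have "\<Gamma> y u w = (\<Sum>b\<in>Basis. (w \<bullet> b) *\<^sub>R \<Gamma> y u b)"
        using linear_sum[OF \<Gamma>_linear(1), of y u "\<lambda>b. (w \<bullet> b) *\<^sub>R b" Basis]
        by (simp add: euclidean_representation linear_scale[OF \<Gamma>_linear(1)])
      then show ?thesis by (simp add: chart_vec_sum[OF U ct(1)])
    qed
    have "tv (c t) (nabla C v t) f = (\<Sum>i<?m. deriv (?a i) t * ?Z i (c t) f + ?a i t * D ?X (?Z i) (c t) f)" for f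
      unfolding da E_eq[OF ct(1,4)] D_field_at[OF E_field ct(1,4)] field_at(2)[OF ct(1,4)] sum.distrib
      using sum_e[of "\<lambda>b. (vector_derivative v (at t) \<bullet> b) * tv (c t) b f"]
        sum_e[of "\<lambda>b. (v t \<bullet> b) * tv (c t) (\<Gamma> (\<phi> (c t)) (vector_derivative C (at t)) b) f"]
        rep[OF ct(1), of "vector_derivative v (at t)" f] \<Gamma>_rep[of "C t" "vector_derivative C (at t)" "v t" f]
      by (simp add: nabla_def chart_vec_add[OF U ct(1)] tv_add_def ct(2))
    then show "\<exists>(m::nat) a Z X.
     (\<forall>i<m. Z i \<in> vector_fields A \<and> (\<exists>S. open S \<and> t \<in> S \<and> smooth_on S (a i))) \<and>
     (\<forall>\<^sub>F r in nhds t. V r = (\<lambda>f. \<Sum>i<m. a i r * Z i (c r) f)) \<and>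
     X \<in> vector_fields A \<and> X (c t) = velocity A c t \<and>
     tv (c t) (nabla C v t) = (\<lambda>f. \<Sum>i<m. deriv (a i) t * Z i (c t) f + a i t * D X (Z i) (c t) f)"
      using J sm E_field V_eq X_eq
      by (intro exI[of _ ?m] exI[of _ ?a] exI[of _ ?Z] exI[of _ ?X]) auto
  next
    fix \<xi>
    assume "\<exists>(m::nat) a Z X.
     (\<forall>i<m. Z i \<in> vector_fields A \<and> (\<exists>S. open S \<and> t \<in> S \<and> smooth_on S (a i))) \<and>
     (\<forall>\<^sub>F r in nhds t. V r = (\<lambda>f. \<Sum>i<m. a i r * Z i (c r) f)) \<and>
     X \<in> vector_fields A \<and> X (c t) = velocity A c t \<and>
     \<xi> = (\<lambda>f. \<Sum>i<m. deriv (a i) t * Z i (c t) f + a i t * D X (Z i) (c t) f)"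
    then obtain m :: nat and a Z X where
      Z: "\<And>i. i < m \<Longrightarrow> Z i \<in> vector_fields A" and a: "\<And>i. i < m \<Longrightarrow> \<exists>S. open S \<and> t \<in> S \<and> smooth_on S (a i)"
      and V': "\<forall>\<^sub>F r in nhds t. V r = (\<lambda>f. \<Sum>i<m. a i r * Z i (c r) f)"
      and X: "X \<in> vector_fields A" "X (c t) = velocity A c t"
      and \<xi>: "\<xi> = (\<lambda>f. \<Sum>i<m. deriv (a i) t * Z i (c t) f + a i t * D X (Z i) (c t) f)" by blast
    obtain N where N: "open N" "t \<in> N" "\<And>r. r \<in> N \<Longrightarrow> V r = (\<lambda>f. \<Sum>i<m. a i r * Z i (c r) f)"
      using V' unfolding eventually_nhds by blast
    \<comment> \<open>An arbitrary representation is turned into an identity of components near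
      \<open>t\<close>, which can be differentiated there by the product and chain rules.\<close>
    have v_eq: "v r = (\<Sum>i<m. a i r *\<^sub>R comps (Z i) (C r))" if r: "r \<in> J \<inter> N" for r
    proof -
      have cr: "c r \<in> U" "\<phi> (c r) = C r" using c r by auto
      have "tv (c r) (v r) = (\<lambda>f. \<Sum>i<m. a i r * Z i (c r) f)" using V[of r] N(3)[of r] r by simp
      also have "\<dots> = tv (c r) (\<Sum>i<m. a i r *\<^sub>R comps (Z i) (C r))"
        using components[OF Z U cr(1)] cr(2) by (simp add: chart_vec_sum[OF U cr(1)])
      finally show ?thesis by (simp add: chart_vec_inject[OF U cr(1)])
    qed
    have X_comp: "comps X (C t) = vector_derivative C (at t)"
      using components_eq[where Z = X, OF U ct(1), of "vector_derivative C (at t)"] X(2) vel ct(2) by simp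
    have da: "(a i has_real_derivative deriv (a i) t) (at t)" if i: "i < m" for i
    proof -
      obtain S where S: "open S" "t \<in> S" "smooth_on S (a i)" using a[OF i] by blast
      have "(a i has_real_derivative dd (a i) t 1) (at t)"
        using smooth_on_vderiv(1)[OF S(3,2)] by (simp add: has_real_derivative_iff_has_vector_derivative)
      then show ?thesis using DERIV_imp_deriv by metis
    qed
    have dZ: "((\<lambda>r. comps (Z i) (C r)) has_vector_derivative dd (comps (Z i)) (C t) (vector_derivative C (at t))) (at t)"
      if i: "i < m" for i
      by (rule vector_derivative_compose_dd[OF smooth_on_differentiable[OF smooth_on_components[OF Z[OF i] U]] dC])
        (use ct T_sub in auto)
    let ?d = "\<lambda>i. a i t *\<^sub>R dd (comps (Z i)) (C t) (vector_derivative C (at t)) + deriv (a i) t *\<^sub>R comps (Z i) (C t)"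
    have "((\<lambda>r. \<Sum>i<m. a i r *\<^sub>R comps (Z i) (C r)) has_vector_derivative (\<Sum>i<m. ?d i)) (at t)"
      using da dZ by (intro has_vector_derivative_sum has_vector_derivative_scaleR) auto
    then have "(v has_vector_derivative (\<Sum>i<m. ?d i)) (at t)"
      by (rule has_vector_derivative_transform_within_open[where S = "J \<inter> N"]) (use J N v_eq in auto)
    then have v': "vector_derivative v (at t) = (\<Sum>i<m. ?d i)" by (rule vector_derivative_at)
    have vt: "v t = (\<Sum>i<m. a i t *\<^sub>R comps (Z i) (C t))" using v_eq J N by blast
    have "nabla C v t = (\<Sum>i<m. deriv (a i) t *\<^sub>R comps (Z i) (C t)
       + a i t *\<^sub>R (dd (comps (Z i)) (C t) (comps X (C t)) + \<Gamma> (C t) (comps X (C t)) (comps (Z i) (C t))))"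
      by (simp add: nabla_def v' vt X_comp linear_sum[OF \<Gamma>_linear(1)] linear_scale[OF \<Gamma>_linear(1)]
          scaleR_add_right sum.distrib algebra_simps)
    then have "tv (c t) (nabla C v t) f = (\<Sum>i<m. deriv (a i) t * tv (c t) (comps (Z i) (C t)) f
       + a i t * tv (c t) (dd (comps (Z i)) (C t) (comps X (C t)) + \<Gamma> (C t) (comps X (C t)) (comps (Z i) (C t))) f)" for f
      by (simp add: sum.distrib chart_vec_add[OF U ct(1)] tv_add_def
          chart_vec_sum[OF U ct(1), where I = "{..<m}"])
    moreover have "Z i (c t) = tv (c t) (comps (Z i) (C t))" if "i < m" for i
      using components[OF Z[OF that] U ct(1)] ct(2) by simp
    moreover have "D X (Z i) (c t) = tv (c t) (dd (comps (Z i)) (C t) (comps X (C t)) + \<Gamma> (C t) (comps X (C t)) (comps (Z i) (C t)))"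
      if "i < m" for i
      using D_eq[OF X(1) Z[OF that] ct(1,4)] ct(2) by simp
    ultimately show "\<xi> = tv (c t) (nabla C v t)" unfolding \<xi> by (intro ext) simp
  qed
qed

lemma smooth_on_nabla_iterate:
  assumes "open J" "smooth_on J c" "smooth_on J v" "c ` J \<subseteq> T"
  shows "smooth_on J ((nabla c ^^ n) v)"
  by (induction n) (simp_all add: smooth_on_nabla assms)

lemma cov_deriv_iterate:
  assumes J: "open J" "t \<in> J" and C: "smooth_on J C" "C ` J \<subseteq> T" and v: "smooth_on J v"
    and c: "\<And>r. r \<in> J \<Longrightarrow> c r \<in> U \<and> \<phi> (c r) = C r" and V: "\<And>r. r \<in> J \<Longrightarrow> V r = tv (c r) (v r)"
  shows "((cov_deriv_along A D c) ^^ n) V t = tv (c t) ((nabla C ^^ n) v t)"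
  using J(2)
proof (induction n arbitrary: t)
  case (Suc n)
  show ?case
    using cov_deriv_along_eq[OF J(1) Suc.prems C smooth_on_nabla_iterate[OF J(1) C(1) v C(2)] c Suc.IH] by simp
qed (simp add: V)

end

section \<open>Jet coordinates, order of dependence and total derivatives\<close>

locale jet_index =
  fixes k :: nat and \<iota> :: "'i::finite \<Rightarrow> nat"
  assumes bij: "bij_betw \<iota> UNIV {0..k}"
begin

definition idx :: "nat \<Rightarrow> 'i" where
  "idx n = inv_into UNIV \<iota> n"

lemma \<iota>_idx [simp]: "n \<le> k \<Longrightarrow> \<iota> (idx n) = n"
  using bij by (simp add: idx_def bij_betw_def f_inv_into_f)

lemma idx_\<iota> [simp]: "idx (\<iota> i) = i"
  using bij by (simp add: idx_def bij_betw_def)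

lemma \<iota>_le [simp]: "\<iota> i \<le> k"
  using bij by (auto simp: bij_betw_def)

lemma \<iota>_eq: "n \<le> k \<Longrightarrow> \<iota> i = n \<longleftrightarrow> i = idx n"
  by auto

lemma vec_eqI: "(\<And>n. n \<le> k \<Longrightarrow> y $ idx n = y' $ idx n) \<Longrightarrow> y = (y' :: 'b ^ 'i)"
  by (metis vec_eq_iff idx_\<iota> \<iota>_le)

definition jcurve :: "(real \<Rightarrow> 'b::real_normed_vector) \<Rightarrow> real \<Rightarrow> 'b ^ 'i" where
  "jcurve c t = (\<chi> i. higher_vderiv (\<iota> i) c t)"

text \<open>The derivative of the jet of a curve, except in the slot of order \<open>k\<close>:
  there it would be the derivative of order \<open>k + 1\<close>, which is not a jet coordinate and
  is replaced by 0.\<close>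

definition shift :: "'b::real_normed_vector ^ 'i \<Rightarrow> 'b ^ 'i" where
  "shift y = (\<chi> i. if \<iota> i < k then y $ idx (Suc (\<iota> i)) else 0)"

text \<open>\<open>TD\<close> is the total derivative on functions that do not involve the top-order coordinate.\<close>

definition TD :: "('b::euclidean_space ^ 'i \<Rightarrow> 'c::real_normed_vector) \<Rightarrow> 'b ^ 'i \<Rightarrow> 'c" where
  "TD F y = dd F y (shift y)"

definition over :: "'b set \<Rightarrow> ('b ^ 'i) set" where
  "over S = {y. y $ idx 0 \<in> S}"

text \<open>Order 0 is among the orders up to any \<open>m\<close>, so agreement already forces
  \<open>y'\<close> to lie in \<open>over S\<close>.\<close>

definition depends :: "nat \<Rightarrow> 'b set \<Rightarrow> ('b::real_normed_vector ^ 'i \<Rightarrow> 'c) \<Rightarrow> bool" where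
  "depends m S F \<longleftrightarrow> (\<forall>y y'. y \<in> over S \<longrightarrow> (\<forall>i. \<iota> i \<le> m \<longrightarrow> y $ i = y' $ i) \<longrightarrow> F y = F y')"

lemma dependsD: "depends m S F \<Longrightarrow> y \<in> over S \<Longrightarrow> (\<And>i. \<iota> i \<le> m \<Longrightarrow> y $ i = y' $ i) \<Longrightarrow> F y = F y'"
  by (auto simp: depends_def)

lemma open_over: "open S \<Longrightarrow> open (over S)"
  unfolding over_def by (rule open_vimage[of S "\<lambda>y. y $ idx 0", unfolded vimage_def]) (auto intro!: continuous_intros)

lemma over_agree: "y \<in> over S \<Longrightarrow> y $ idx 0 = y' $ idx 0 \<Longrightarrow> y' \<in> over S"
  by (simp add: over_def)

lemma smooth_on_shift: "open S \<Longrightarrow> smooth_on S (shift :: 'b::euclidean_space ^ 'i \<Rightarrow> _)"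
proof -
  assume S: "open S"
  have "smooth_on S (\<lambda>y :: 'b ^ 'i. if \<iota> i < k then y $ idx (Suc (\<iota> i)) else 0)" for i
    by (cases "\<iota> i < k") (auto intro: smooth_on_vec_nth S)
  then show ?thesis unfolding shift_def[abs_def] by (rule smooth_on_vec_lambda[OF S])
qed

lemma smooth_on_TD: "open S \<Longrightarrow> smooth_on (over S) F \<Longrightarrow> smooth_on (over S) (TD F)"
  unfolding TD_def[abs_def] by (intro smooth_on_dd smooth_on_shift open_over)

text \<open>The direction \<open>h - h'\<close> has no entries of order up to \<open>m\<close>, so
  \<open>F\<close> is constant along the line through \<open>y\<close> in that direction.\<close>

lemma dd_depends_dir:
  assumes S: "open S" and F: "smooth_on (over S) F" "depends m S F" and y: "y \<in> over S"
    and h: "\<And>i. \<iota> i \<le> m \<Longrightarrow> h $ i = h' $ i"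
  shows "dd F y h = dd F y h'"
proof -
  have dF: "F differentiable (at y)" by (rule smooth_on_differentiable[OF F(1) y])
  have "((\<lambda>s. y + s *\<^sub>R (h - h')) has_vector_derivative (h - h')) (at 0)"
    by (auto intro!: derivative_eq_intros)
  from vector_derivative_compose_dd[where F = F and c = "\<lambda>s. y + s *\<^sub>R (h - h')" and t = 0, OF _ this] dF
  have "((\<lambda>s. F (y + s *\<^sub>R (h - h'))) has_vector_derivative dd F y (h - h')) (at 0)" by simp
  moreover have "F (y + s *\<^sub>R (h - h')) = F y" for s
    by (rule dependsD[OF F(2) y, symmetric]) (simp add: h)
  ultimately have "((\<lambda>s. F y) has_vector_derivative dd F y (h - h')) (at 0)" by simp
  then have "dd F y (h - h') = 0"
    using has_vector_derivative_const vector_derivative_unique_at by blast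
  then show ?thesis by (simp add: linear_diff[OF dd_linear[OF dF]])
qed

text \<open>Translation by \<open>y' - y\<close> changes no entry of order up to \<open>m\<close>.
  Hence \<open>F\<close> coincides near \<open>y\<close> with its translate, whose derivative at
  \<open>y\<close> is that of \<open>F\<close> at \<open>y'\<close>.\<close>

lemma dd_depends_base:
  assumes S: "open S" and F: "smooth_on (over S) F" "depends m S F" and y: "y \<in> over S"
    and y': "\<And>i. \<iota> i \<le> m \<Longrightarrow> y $ i = y' $ i"
  shows "dd F y' h = dd F y h"
proof -
  have 0: "y $ idx 0 = y' $ idx 0" by (rule y') simp
  then have "y' \<in> over S" using y over_agree by blast
  then have d: "F differentiable (at (y + (y' - y)))" by (simp add: smooth_on_differentiable[OF F(1)])
  have "dd (\<lambda>z. z + (y' - y)) y = (\<lambda>h. h)" by (rule dd_eq) (auto intro!: derivative_eq_intros)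
  then have "dd (\<lambda>z. F (z + (y' - y))) y h = dd F y' h"
    using dd_compose[of F "\<lambda>z. z + (y' - y)", OF d] by (simp add: differentiable_add)
  moreover have "dd (\<lambda>z. F (z + (y' - y))) y = dd F y"
  proof (rule dd_cong(1)[OF open_over[OF S] y])
    fix z assume "z \<in> over S"
    then show "F (z + (y' - y)) = F z" by (intro dependsD[OF F(2), symmetric]) (simp_all add: y')
  qed
  ultimately show ?thesis by simp
qed

lemma shift_agree:
  assumes "\<And>i. \<iota> i \<le> Suc m \<Longrightarrow> y $ i = y' $ i" "\<iota> i \<le> m"
  shows "shift y $ i = shift y' $ i"
  using assms by (simp add: shift_def)

lemma depends_TD:
  assumes S: "open S" and F: "smooth_on (over S) F" "depends m S F"
  shows "depends (Suc m) S (TD F)"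
  unfolding depends_def TD_def
proof (intro allI impI)
  fix y y' assume y: "y \<in> over S" "\<forall>i. \<iota> i \<le> Suc m \<longrightarrow> y $ i = y' $ i"
  have "dd F y (shift y) = dd F y (shift y')"
    by (rule dd_depends_dir[OF S F y(1) shift_agree]) (use y in auto)
  also have "\<dots> = dd F y' (shift y')"
    by (rule dd_depends_base[OF S F y(1), symmetric]) (use y in auto)
  finally show "dd F y (shift y) = dd F y' (shift y')" .
qed

text \<open>If \<open>F\<close> is affine in the coordinate of its top order \<open>m\<close>, so is \<open>TD F\<close> in the next one, with the
  same slope.\<close>

lemma TD_affine:
  assumes S: "open S" and F: "smooth_on (over S) F" "depends m S F" and m: "m < k" "m \<ge> 1" and y: "y \<in> over S"
    and affine: "\<And>w. F (y + axis (idx m) w) = F y + B w" and B: "linear B"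
  shows "TD F (y + axis (idx (Suc m)) w) = TD F y + B w"
proof -
  \<comment> \<open>Adding \<open>w\<close> in order \<open>m + 1\<close> adds \<open>w\<close> to
    the entry of order \<open>m\<close> of the direction in which \<open>TD\<close> differentiates.
    The base point changes only in an order that \<open>F\<close> does not see.\<close>
  have "shift (y + axis (idx (Suc m)) w) = shift y + axis (idx m) w"
    using m by (intro vec_eqI) (auto simp: shift_def axis_def \<iota>_eq[symmetric])
  moreover have "dd F (y + axis (idx (Suc m)) w) h = dd F y h" for h
  proof (rule dd_depends_base[OF S F y])
    fix i assume "\<iota> i \<le> m"
    then have "i \<noteq> idx (Suc m)" using m by (metis \<iota>_idx Suc_leI not_less_eq_eq order_refl)
    then show "y $ i = (y + axis (idx (Suc m)) w) $ i" by (simp add: axis_def)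
  qed
  moreover have dF: "F differentiable (at y)" by (rule smooth_on_differentiable[OF F(1) y])
  moreover have "dd F y (axis (idx m) w) = B w"
  proof -
    have "((\<lambda>s. y + s *\<^sub>R axis (idx m) w) has_vector_derivative (axis (idx m) w)) (at 0)"
      by (auto intro!: derivative_eq_intros)
    from vector_derivative_compose_dd[where F = F and c = "\<lambda>s. y + s *\<^sub>R axis (idx m) w" and t = 0, OF _ this] dF
    have "((\<lambda>s. F (y + s *\<^sub>R axis (idx m) w)) has_vector_derivative dd F y (axis (idx m) w)) (at 0)" by simp
    moreover have "F (y + s *\<^sub>R axis (idx m) w) = F y + s *\<^sub>R B w" for s
    proof -
      have "s *\<^sub>R axis (idx m) w = axis (idx m) (s *\<^sub>R w)" by (simp add: vec_eq_iff axis_def)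
      then show ?thesis using affine[of "s *\<^sub>R w"] by (simp add: linear_scale[OF B])
    qed
    moreover have "((\<lambda>s. F y + s *\<^sub>R B w) has_vector_derivative B w) (at 0)"
      by (auto intro!: derivative_eq_intros)
    ultimately show ?thesis using vector_derivative_unique_at by fastforce
  qed
  ultimately show ?thesis by (simp add: TD_def linear_add[OF dd_linear[OF dF]])
qed

lemma jcurve_over: "jcurve c t \<in> over S \<longleftrightarrow> c t \<in> S"
  by (simp add: over_def jcurve_def)

lemma jcurve_cong:
  assumes "open J" "t \<in> J" "\<And>r. r \<in> J \<Longrightarrow> c r = d r"
  shows "jcurve c t = jcurve d t"
  by (simp add: jcurve_def higher_vderiv_cong[OF assms])

lemma jcurve_deriv:
  assumes "open J" "smooth_on J c" "t \<in> J"
  shows "(jcurve c has_vector_derivative (\<chi> i. higher_vderiv (Suc (\<iota> i)) c t)) (at t)"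
  unfolding jcurve_def[abs_def]
  by (intro has_vector_derivative_vec_lambda higher_vderiv_has_derivative[OF assms])

text \<open>The jet of \<open>c\<close> moves in the direction \<open>shift\<close> up to the entry
  of order \<open>k\<close>. For \<open>m < k\<close> the function \<open>F\<close> is insensitive
  to that entry.\<close>

lemma TD_chain:
  fixes c :: "real \<Rightarrow> 'b::euclidean_space"
  assumes S: "open S" and F: "smooth_on (over S) F" "depends m S F" and m: "m < k"
    and c: "open J" "smooth_on J c" "t \<in> J" "c t \<in> S"
  shows "((\<lambda>t. F (jcurve c t)) has_vector_derivative TD F (jcurve c t)) (at t)"
proof -
  have y: "jcurve c t \<in> over S" using c by (simp add: jcurve_over)
  have "dd F (jcurve c t) (\<chi> i. higher_vderiv (Suc (\<iota> i)) c t) = TD F (jcurve c t)"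
    unfolding TD_def
    by (rule dd_depends_dir[OF S F y]) (use m in \<open>auto simp: shift_def jcurve_def\<close>)
  then show ?thesis
    using vector_derivative_compose_dd[OF smooth_on_differentiable[OF F(1) y] jcurve_deriv[OF c(1-3)]] by simp
qed

text \<open>The derivative of order \<open>n\<close> of \<open>F\<close> along a curve as a function
  of the jet of the curve. It stands for the formula of Faa di Bruno, whose explicit coefficients
  are avoided.\<close>

definition prol :: "nat \<Rightarrow> ('b::euclidean_space \<Rightarrow> 'c::real_normed_vector) \<Rightarrow> 'b ^ 'i \<Rightarrow> 'c" where
  "prol n F = (TD ^^ n) (\<lambda>y. F (y $ idx 0))"

lemma prol_props:
  assumes S: "open S" and F: "smooth_on S F"
  shows "smooth_on (over S) (prol n F)" "depends n S (prol n F)"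
proof (induction n)
  case 0
  have "smooth_on (over S) (\<lambda>y. F (y $ idx 0))"
    by (intro smooth_on_compose[OF F] smooth_on_vec_nth smooth_on_id open_over S) (auto simp: over_def)
  then show "smooth_on (over S) (prol 0 F)" by (simp add: prol_def)
  show "depends 0 S (prol 0 F)" by (auto simp: prol_def depends_def over_def)
next
  case (Suc n)
  show "smooth_on (over S) (prol (Suc n) F)" using smooth_on_TD[OF S Suc(1)] by (simp add: prol_def)
  show "depends (Suc n) S (prol (Suc n) F)" using depends_TD[OF S Suc] by (simp add: prol_def)
qed

lemma higher_vderiv_compose:
  fixes c :: "real \<Rightarrow> 'b::euclidean_space"
  assumes S: "open S" and F: "smooth_on S F" and c: "open J" "smooth_on J c" "c ` J \<subseteq> S" and "n \<le> k" "t \<in> J"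
  shows "higher_vderiv n (\<lambda>t. F (c t)) t = prol n F (jcurve c t)"
  using assms(6,7)
proof (induction n arbitrary: t)
  case 0
  then show ?case by (simp add: prol_def jcurve_def)
next
  case (Suc n)
  have "((\<lambda>t. prol n F (jcurve c t)) has_vector_derivative TD (prol n F) (jcurve c t)) (at t)"
    using Suc.prems c by (intro TD_chain[OF S prol_props[OF S F]]) auto
  then have "vector_derivative (higher_vderiv n (\<lambda>t. F (c t))) (at t) = TD (prol n F) (jcurve c t)"
    using vector_derivative_cong_open[OF c(1) Suc.prems(2), of "higher_vderiv n (\<lambda>t. F (c t))"] Suc
    by (simp add: vector_derivative_at)
  then show ?case by (simp add: higher_vderiv_Suc prol_def)
qed

definition jtaylor :: "'b::euclidean_space ^ 'i \<Rightarrow> real \<Rightarrow> 'b" where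
  "jtaylor y = taylor k (\<lambda>j. y $ idx j)"

lemma jcurve_jtaylor: "jcurve (jtaylor y) 0 = y"
  by (intro vec_eqI) (simp add: jcurve_def jtaylor_def higher_vderiv_taylor_0)

lemma jtaylor_0: "jtaylor y 0 = y $ idx 0"
  by (simp add: jtaylor_def taylor_at_0)

lemma smooth_on_taylor:
  assumes "open S" "smooth_on S (f :: 'p::euclidean_space \<Rightarrow> real)" "\<And>j. j \<le> k \<Longrightarrow> smooth_on S (\<lambda>x. a x j)"
  shows "smooth_on S (\<lambda>x. taylor k (a x) (f x))"
  unfolding taylor_def divide_inverse
  by (intro smooth_on_sum smooth_on_scaleR smooth_on_mult smooth_on_power smooth_on_const assms) auto

lemma smooth_on_jtaylor: "open J \<Longrightarrow> smooth_on J (jtaylor y)"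
  unfolding jtaylor_def by (rule smooth_on_taylor) auto

end

section \<open>The jet manifold\<close>

locale jet_space = smooth_atlas A + jet_index k \<iota>
  for A :: "('a, 'e::euclidean_space) atlas" and k :: nat and \<iota> :: "'i::finite \<Rightarrow> nat"
begin

abbreviation "JA \<equiv> jet_atlas A k \<iota>"

definition jet_dom :: "'a set \<Rightarrow> 'a jet set" where
  "jet_dom U = {u \<in> jets A k. jet_proj u \<in> U}"

text \<open>The inverse of the jet chart. The polynomial curve may leave the chart image away from
  0, but only its behaviour near 0 enters the jet.\<close>

definition jet_lift :: "'a set \<Rightarrow> ('a \<Rightarrow> 'e) \<Rightarrow> 'e ^ 'i \<Rightarrow> 'a jet" where
  "jet_lift U \<phi> y = jet_of A k (\<lambda>t. inv_into U \<phi> (jtaylor y t))"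

lemma smooth_near_chart:
  assumes "smooth_near A x c" "(U, \<phi>) \<in> A" "c x \<in> U"
  obtains J where "open J" "x \<in> J" "c ` J \<subseteq> U" "smooth_on J (\<phi> \<circ> c)"
proof -
  obtain S where S: "x \<in> S" "smooth_into A S c" using assms(1) by (auto simp: smooth_near_def)
  note s = smooth_intoD[OF S(2) assms(2)]
  show thesis by (rule that[of "S \<inter> c -` U"]) (use S s assms(3) in \<open>auto simp: comp_def\<close>)
qed

text \<open>The higher chain rule for a change of chart. It shows both that equality of jets can be
  tested in one chart and that the transition maps of the jet atlas are smooth.\<close>

lemma jcurve_transition:
  assumes q: "smooth_near A 0 q" and U: "(U, \<phi>) \<in> A" "q 0 \<in> U" and V: "(V, \<psi>) \<in> A" "q 0 \<in> V"
  shows "jcurve (\<psi> \<circ> q) 0 = (\<chi> i. prol (\<iota> i) (\<psi> \<circ> inv_into U \<phi>) (jcurve (\<phi> \<circ> q) 0))"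
proof -
  obtain J1 where J1: "open J1" "0 \<in> J1" "q ` J1 \<subseteq> U" "smooth_on J1 (\<phi> \<circ> q)"
    using smooth_near_chart[OF q U] by blast
  obtain J2 where J2: "open J2" "0 \<in> J2" "q ` J2 \<subseteq> V" "smooth_on J2 (\<psi> \<circ> q)"
    using smooth_near_chart[OF q V] by blast
  let ?J = "J1 \<inter> J2"
  have J: "open ?J" "0 \<in> ?J" "(\<phi> \<circ> q) ` ?J \<subseteq> \<phi> ` (U \<inter> V)" using J1 J2 by auto
  have s: "smooth_on ?J (\<phi> \<circ> q)" by (rule smooth_on_subset[OF J1(4)]) simp
  have "higher_vderiv n (\<psi> \<circ> q) 0 = prol n (\<psi> \<circ> inv_into U \<phi>) (jcurve (\<phi> \<circ> q) 0)" if "n \<le> k" for n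
  proof -
    have "higher_vderiv n (\<psi> \<circ> q) 0 = higher_vderiv n (\<lambda>t. (\<psi> \<circ> inv_into U \<phi>) ((\<phi> \<circ> q) t)) 0"
      by (rule higher_vderiv_cong[OF J(1,2)]) (use J1(3) in \<open>auto simp: inv_chart[OF U(1)] image_subset_iff\<close>)
    also have "\<dots> = prol n (\<psi> \<circ> inv_into U \<phi>) (jcurve (\<phi> \<circ> q) 0)"
      by (rule higher_vderiv_compose[OF overlap_open[OF U(1) V(1)] transition_smooth[OF U(1) V(1)] J(1) s J(3) that J(2)])
    finally show ?thesis .
  qed
  then show ?thesis by (simp add: vec_eq_iff) (simp add: jcurve_def)
qed

lemma jcurve_eq_iff: "jcurve c t = jcurve d t \<longleftrightarrow> (\<forall>n\<le>k. higher_vderiv n c t = higher_vderiv n d t)"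
proof
  assume eq: "jcurve c t = jcurve d t"
  have "jcurve c t $ idx n = higher_vderiv n c t" if "n \<le> k" for n c
    using that by (simp add: jcurve_def)
  then show "\<forall>n\<le>k. higher_vderiv n c t = higher_vderiv n d t" using eq by metis
qed (simp add: jcurve_def)

text \<open>\<open>jet_of\<close> asks for equal derivatives in every chart at the base point; by
  the transition formula equality in one chart propagates to the others.\<close>

lemma jet_of_iff:
  assumes q: "smooth_near A 0 q" and U: "(U, \<phi>) \<in> A" "q 0 \<in> U"
  shows "r \<in> jet_of A k q \<longleftrightarrow> smooth_near A 0 r \<and> r 0 = q 0 \<and> jcurve (\<phi> \<circ> r) 0 = jcurve (\<phi> \<circ> q) 0"
proof
  assume "r \<in> jet_of A k q"
  then show "smooth_near A 0 r \<and> r 0 = q 0 \<and> jcurve (\<phi> \<circ> r) 0 = jcurve (\<phi> \<circ> q) 0"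
    using U by (auto simp: jet_of_def jcurve_eq_iff)
next
  assume r: "smooth_near A 0 r \<and> r 0 = q 0 \<and> jcurve (\<phi> \<circ> r) 0 = jcurve (\<phi> \<circ> q) 0"
  have "jcurve (\<psi> \<circ> r) 0 = jcurve (\<psi> \<circ> q) 0" if "(V, \<psi>) \<in> A" "q 0 \<in> V" for V \<psi>
    using jcurve_transition[OF q U that] jcurve_transition[of r U \<phi> V \<psi>] U that r by simp
  then show "r \<in> jet_of A k q" using r by (auto simp: jet_of_def jcurve_eq_iff)
qed

lemma jet_of_self: "smooth_near A 0 q \<Longrightarrow> q \<in> jet_of A k q"
  by (simp add: jet_of_def)

lemma mem_jet_of_iff:
  "x \<in> jet_of A k q \<longleftrightarrow> smooth_near A 0 x \<and> x 0 = q 0 \<and> (\<forall>U \<phi> \<alpha>. (U, \<phi>) \<in> A \<longrightarrow> q 0 \<in> U \<longrightarrow> \<alpha> \<le> k \<longrightarrow>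
    higher_vderiv \<alpha> (\<phi> \<circ> x) 0 = higher_vderiv \<alpha> (\<phi> \<circ> q) 0)"
  by (auto simp: jet_of_def)

lemma jet_of_member:
  assumes "r \<in> jet_of A k q"
  shows "jet_of A k r = jet_of A k q"
proof (rule set_eqI)
  fix x
  have r: "r 0 = q 0" "\<And>U \<phi> \<alpha>. (U, \<phi>) \<in> A \<Longrightarrow> q 0 \<in> U \<Longrightarrow> \<alpha> \<le> k \<Longrightarrow>
      higher_vderiv \<alpha> (\<phi> \<circ> r) 0 = higher_vderiv \<alpha> (\<phi> \<circ> q) 0"
    using assms unfolding mem_jet_of_iff by blast+
  show "x \<in> jet_of A k r \<longleftrightarrow> x \<in> jet_of A k q"
    unfolding mem_jet_of_iff r(1) using r(2) by metis
qed

lemma jet_of_eq: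
  assumes q: "smooth_near A 0 q" "smooth_near A 0 r" and U: "(U, \<phi>) \<in> A" "q 0 \<in> U"
  shows "jet_of A k q = jet_of A k r \<longleftrightarrow> q 0 = r 0 \<and> jcurve (\<phi> \<circ> q) 0 = jcurve (\<phi> \<circ> r) 0"
proof
  assume "jet_of A k q = jet_of A k r"
  then have "r \<in> jet_of A k q" using jet_of_self[OF q(2)] by simp
  then show "q 0 = r 0 \<and> jcurve (\<phi> \<circ> q) 0 = jcurve (\<phi> \<circ> r) 0"
    unfolding jet_of_iff[OF q(1) U] by simp
next
  assume "q 0 = r 0 \<and> jcurve (\<phi> \<circ> q) 0 = jcurve (\<phi> \<circ> r) 0"
  then have "r \<in> jet_of A k q" using q(2) unfolding jet_of_iff[OF q(1) U] by simp
  from jet_of_member[OF this] show "jet_of A k q = jet_of A k r" by (rule sym)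
qed

lemma smooth_near_carr: "smooth_near A x c \<Longrightarrow> c x \<in> carr A"
  by (auto simp: smooth_near_def smooth_into_def)

lemma jets_rep:
  assumes "u \<in> jets A k"
  shows "smooth_near A 0 (jet_rep u)" "jet_of A k (jet_rep u) = u" "jet_rep u 0 = jet_proj u" "jet_proj u \<in> carr A"
proof -
  obtain q where q: "u = jet_of A k q" "smooth_near A 0 q" using assms by (auto simp: jets_def)
  then have "jet_rep u \<in> u" unfolding jet_rep_def using jet_of_self someI by metis
  then show "smooth_near A 0 (jet_rep u)" "jet_of A k (jet_rep u) = u"
    using jet_of_member q(1) by (auto simp: jet_of_def)
  then show "jet_rep u 0 = jet_proj u" "jet_proj u \<in> carr A"
    using smooth_near_carr by (auto simp: jet_proj_def)
qed

lemma jet_of_jets: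
  assumes "smooth_near A 0 q"
  shows "jet_of A k q \<in> jets A k" "jet_proj (jet_of A k q) = q 0"
    "(U, \<phi>) \<in> A \<Longrightarrow> q 0 \<in> U \<Longrightarrow> jet_chart \<iota> \<phi> (jet_of A k q) = jcurve (\<phi> \<circ> q) 0"
proof -
  show j: "jet_of A k q \<in> jets A k" using assms by (auto simp: jets_def)
  let ?r = "jet_rep (jet_of A k q)"
  note r = jets_rep[OF j]
  have "?r \<in> jet_of A k q" using jet_of_self[OF r(1)] r(2) by simp
  then show p: "jet_proj (jet_of A k q) = q 0" by (simp add: jet_of_def jet_proj_def)
  show "jet_chart \<iota> \<phi> (jet_of A k q) = jcurve (\<phi> \<circ> q) 0" if "(U, \<phi>) \<in> A" "q 0 \<in> U"
    using jet_of_iff[OF assms that, of ?r] \<open>?r \<in> jet_of A k q\<close> by (simp add: jet_chart_def jcurve_def)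
qed

lemma jet_chart_jcurve: "jet_chart \<iota> \<phi> u = jcurve (\<phi> \<circ> jet_rep u) 0"
  by (simp add: jet_chart_def jcurve_def)

lemma jcurve_0: "jcurve c t $ idx 0 = c t"
  by (simp add: jcurve_def)

lemma jet_chart_0: "u \<in> jets A k \<Longrightarrow> jet_chart \<iota> \<phi> u $ idx 0 = \<phi> (jet_proj u)"
  by (simp add: jet_chart_jcurve jcurve_0 jets_rep)

lemma jtaylor_near:
  assumes U: "(U, \<phi>) \<in> A" and y: "y \<in> over (\<phi> ` U)"
  obtains J where "open J" "0 \<in> J" "jtaylor y ` J \<subseteq> \<phi> ` U"
proof (rule that[of "jtaylor y -` (\<phi> ` U)"])
  have "continuous_on UNIV (jtaylor y)" by (rule smooth_on_continuous[OF smooth_on_jtaylor]) simp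
  then show "open (jtaylor y -` (\<phi> ` U))" using chart_open[OF U] by (simp add: open_vimage)
  show "0 \<in> jtaylor y -` (\<phi> ` U)" using y by (simp add: jtaylor_0 over_def)
qed auto

lemma jet_lift:
  assumes U: "(U, \<phi>) \<in> A" and y: "y \<in> over (\<phi> ` U)"
  shows "jet_lift U \<phi> y \<in> jet_dom U" "jet_chart \<iota> \<phi> (jet_lift U \<phi> y) = y"
    "jet_proj (jet_lift U \<phi> y) = inv_into U \<phi> (y $ idx 0)"
proof -
  obtain J where J: "open J" "0 \<in> J" "jtaylor y ` J \<subseteq> \<phi> ` U" by (rule jtaylor_near[OF U y])
  let ?q = "\<lambda>t. inv_into U \<phi> (jtaylor y t)"
  have q: "smooth_near A 0 ?q" unfolding smooth_near_def
    using smooth_into_chart[OF U J(1) smooth_on_jtaylor[OF J(1)] J(3)] J(2) by blast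
  have 0: "?q 0 \<in> U" "?q 0 = inv_into U \<phi> (y $ idx 0)"
    using J(2,3) chart_inv(2)[of "jtaylor y 0" \<phi> U] by (auto simp: jtaylor_0 image_subset_iff)
  show "jet_proj (jet_lift U \<phi> y) = inv_into U \<phi> (y $ idx 0)" "jet_lift U \<phi> y \<in> jet_dom U"
    using jet_of_jets[OF q] 0 by (simp_all add: jet_lift_def jet_dom_def)
  have "jcurve (\<phi> \<circ> ?q) 0 = jcurve (jtaylor y) 0"
    by (rule jcurve_cong[OF J(1,2)]) (use J(3) in \<open>auto simp: chart_inv image_subset_iff\<close>)
  then show "jet_chart \<iota> \<phi> (jet_lift U \<phi> y) = y"
    using jet_of_jets(3)[OF q U 0(1)] by (simp add: jet_lift_def jcurve_jtaylor)
qed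

lemma jet_dom_over: "u \<in> jet_dom U \<Longrightarrow> jet_chart \<iota> \<phi> u \<in> over (\<phi> ` U)"
  by (auto simp: jet_dom_def over_def jet_chart_0)

lemma jet_chart_inj: "(U, \<phi>) \<in> A \<Longrightarrow> inj_on (jet_chart \<iota> \<phi>) (jet_dom U)"
proof (rule inj_onI)
  fix u w assume U: "(U, \<phi>) \<in> A" and u: "u \<in> jet_dom U" "w \<in> jet_dom U"
    and eq: "jet_chart \<iota> \<phi> u = jet_chart \<iota> \<phi> w"
  then have j: "u \<in> jets A k" "w \<in> jets A k" "jet_proj u \<in> U" "jet_proj w \<in> U" by (auto simp: jet_dom_def)
  have "\<phi> (jet_proj u) = \<phi> (jet_proj w)" using eq jet_chart_0 j by metis
  then have "jet_proj u = jet_proj w" using chart_inj[OF U] j by (simp add: inj_on_def)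
  then have "jet_of A k (jet_rep u) = jet_of A k (jet_rep w)"
    using jet_of_eq[OF jets_rep(1)[OF j(1)] jets_rep(1)[OF j(2)] U] eq j
    by (simp add: jets_rep jet_chart_jcurve)
  then show "u = w" by (simp add: jets_rep j)
qed

lemma jet_dom_Int: "jet_dom (U \<inter> V) = jet_dom U \<inter> jet_dom V"
  by (auto simp: jet_dom_def)

lemma jet_chart_image:
  assumes U: "(U, \<phi>) \<in> A" and V: "V \<subseteq> U"
  shows "jet_chart \<iota> \<phi> ` jet_dom V = over (\<phi> ` V)"
proof
  show "jet_chart \<iota> \<phi> ` jet_dom V \<subseteq> over (\<phi> ` V)" using jet_dom_over by blast
  show "over (\<phi> ` V) \<subseteq> jet_chart \<iota> \<phi> ` jet_dom V"
  proof
    fix y assume y: "y \<in> over (\<phi> ` V)"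
    then have y': "y \<in> over (\<phi> ` U)" using V by (auto simp: over_def)
    have "jet_proj (jet_lift U \<phi> y) \<in> V"
      using y V by (auto simp: jet_lift[OF U y'] over_def inv_chart[OF U] subset_iff)
    then have "jet_lift U \<phi> y \<in> jet_dom V" using jet_lift(1)[OF U y'] by (simp add: jet_dom_def)
    then show "y \<in> jet_chart \<iota> \<phi> ` jet_dom V" using jet_lift(2)[OF U y'] by (metis image_eqI)
  qed
qed

lemma inv_jet_chart:
  assumes U: "(U, \<phi>) \<in> A" and y: "y \<in> over (\<phi> ` U)"
  shows "inv_into (jet_dom U) (jet_chart \<iota> \<phi>) y = jet_lift U \<phi> y"
  using inv_into_f_f[OF jet_chart_inj[OF U] jet_lift(1)[OF U y]] jet_lift(2)[OF U y] by simp

lemma jet_atlas_iff: "(W, \<Phi>) \<in> JA \<longleftrightarrow> (\<exists>U \<phi>. (U, \<phi>) \<in> A \<and> W = jet_dom U \<and> \<Phi> = jet_chart \<iota> \<phi>)"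
  unfolding jet_atlas_def jet_dom_def image_iff Bex_def split_paired_Ex by auto

lemma jet_atlasI: "(U, \<phi>) \<in> A \<Longrightarrow> (jet_dom U, jet_chart \<iota> \<phi>) \<in> JA"
  by (auto simp: jet_atlas_iff)

lemma jet_chart_transition:
  assumes U: "(U, \<phi>) \<in> A" and V: "(V, \<psi>) \<in> A" and u: "u \<in> jet_dom U" "u \<in> jet_dom V"
  shows "jet_chart \<iota> \<psi> u = (\<chi> i. prol (\<iota> i) (\<psi> \<circ> inv_into U \<phi>) (jet_chart \<iota> \<phi> u))"
  using jcurve_transition[OF jets_rep(1) U _ V] u by (simp add: jet_chart_jcurve jet_dom_def jets_rep)

lemma smooth_atlas_jets: "smooth_atlas JA"
proof
  fix W \<Phi> assume "(W, \<Phi>) \<in> JA"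
  then obtain U \<phi> where U: "(U, \<phi>) \<in> A" "W = jet_dom U" "\<Phi> = jet_chart \<iota> \<phi>" by (auto simp: jet_atlas_iff)
  show "inj_on \<Phi> W" unfolding U by (rule jet_chart_inj[OF U(1)])
  show "open (\<Phi> ` W)" unfolding U jet_chart_image[OF U(1) order_refl] by (rule open_over[OF chart_open[OF U(1)]])
  fix W' \<Phi>' assume "(W', \<Phi>') \<in> JA"
  then obtain V \<psi> where V: "(V, \<psi>) \<in> A" "W' = jet_dom V" "\<Phi>' = jet_chart \<iota> \<psi>" by (auto simp: jet_atlas_iff)
  have im: "\<Phi> ` (W \<inter> W') = over (\<phi> ` (U \<inter> V))"
    unfolding U V jet_dom_Int[symmetric] by (rule jet_chart_image[OF U(1)]) simp
  have o: "open (over (\<phi> ` (U \<inter> V)))" by (rule open_over[OF overlap_open[OF U(1) V(1)]])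
  then show "open (\<Phi> ` (W \<inter> W'))" by (simp add: im)
  have "smooth_on (over (\<phi> ` (U \<inter> V))) (\<lambda>y. \<chi> i. prol (\<iota> i) (\<psi> \<circ> inv_into U \<phi>) y)"
    by (intro smooth_on_vec_lambda prol_props o overlap_open[OF U(1) V(1)] transition_smooth[OF U(1) V(1)])
  moreover have "(\<chi> i. prol (\<iota> i) (\<psi> \<circ> inv_into U \<phi>) y) = (\<Phi>' \<circ> inv_into W \<Phi>) y" if y: "y \<in> over (\<phi> ` (U \<inter> V))" for y
  proof -
    obtain u where u: "u \<in> jet_dom U" "u \<in> jet_dom V" "y = jet_chart \<iota> \<phi> u"
      using y im unfolding U V by blast
    then show ?thesis
      using jet_chart_transition[OF U(1) V(1) u(1,2)] by (simp add: U V inv_into_f_f[OF jet_chart_inj[OF U(1)]])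
  qed
  ultimately show "smooth_on (\<Phi> ` (W \<inter> W')) (\<Phi>' \<circ> inv_into W \<Phi>)"
    unfolding im by (rule iffD1[OF smooth_on_cong[OF o], rotated])
qed

sublocale J: smooth_atlas JA
  by (rule smooth_atlas_jets)

lemma carr_jets: "carr JA = jets A k"
proof
  show "carr JA \<subseteq> jets A k" by (auto simp: carr_def jet_atlas_iff jet_dom_def jet_atlas_def)
  show "jets A k \<subseteq> carr JA"
  proof
    fix u assume u: "u \<in> jets A k"
    obtain U \<phi> where "(U, \<phi>) \<in> A" "jet_proj u \<in> U" using jets_rep(4)[OF u] by (rule carrE)
    then show "u \<in> carr JA" using u by (intro J.carrI[OF jet_atlasI]) (auto simp: jet_dom_def)
  qed
qed

lemma jet_chart_inv:
  assumes U: "(U, \<phi>) \<in> A" and y: "y \<in> over (\<phi> ` U)"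
  shows "inv_into (jet_dom U) (jet_chart \<iota> \<phi>) y \<in> jet_dom U" "jet_chart \<iota> \<phi> (inv_into (jet_dom U) (jet_chart \<iota> \<phi>) y) = y"
    "jet_proj (inv_into (jet_dom U) (jet_chart \<iota> \<phi>) y) = inv_into U \<phi> (y $ idx 0)"
  using jet_lift[OF U y] by (simp_all add: inv_jet_chart[OF U y])

lemma smooth_near_slice:
  assumes \<gamma>: "smooth_into A S \<gamma>" and "(s, 0) \<in> S"
  shows "smooth_near A 0 (\<lambda>t. \<gamma> (s, t))"
proof -
  have S: "open S" "\<gamma> ` S \<subseteq> carr A" using \<gamma> by (auto simp: smooth_into_def)
  have "smooth_into A {t. (s, t) \<in> S} (\<lambda>t. \<gamma> (s, t))"
    unfolding smooth_into_def
  proof (intro conjI ballI, safe)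
    show "open {t. (s, t) \<in> S}" by (rule open_slice(1)[OF S(1)])
    show "\<gamma> (s, t) \<in> carr A" if "(s, t) \<in> S" for t using that S(2) by blast
    fix U \<phi> assume U: "(U, \<phi>) \<in> A"
    note s = smooth_intoD[OF \<gamma> U]
    have eq: "{t. (s, t) \<in> S} \<inter> (\<lambda>t. \<gamma> (s, t)) -` U = {t. (s, t) \<in> S \<inter> \<gamma> -` U}" by auto
    show o: "open ({t. (s, t) \<in> S} \<inter> (\<lambda>t. \<gamma> (s, t)) -` U)" unfolding eq by (rule open_slice(1)[OF s(2)])
    show "smooth_on ({t. (s, t) \<in> S} \<inter> (\<lambda>t. \<gamma> (s, t)) -` U) (\<phi> \<circ> (\<lambda>t. \<gamma> (s, t)))"
      using smooth_on_compose[OF s(3) smooth_on_Pair[OF o smooth_on_const smooth_on_id] o s(2)]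
      by (auto simp: comp_def)
  qed
  then show ?thesis using assms(2) by (auto simp: smooth_near_def)
qed

lemma jet_family:
  assumes \<gamma>: "smooth_into A S \<gamma>"
  shows "smooth_into JA {s. (s, 0) \<in> S} (\<lambda>s. jet_of A k (\<lambda>t. \<gamma> (s, t)))" (is "smooth_into _ ?S ?j")
proof -
  have S: "open S" "\<gamma> ` S \<subseteq> carr A" using \<gamma> by (auto simp: smooth_into_def)
  note j = jet_of_jets[OF smooth_near_slice[OF \<gamma>]]
  show ?thesis unfolding smooth_into_def
  proof (intro conjI ballI, safe)
    show "open ?S" by (rule open_slice(2)[OF S(1)])
    show "?j s \<in> carr JA" if "(s, 0) \<in> S" for s using j(1)[OF that] by (simp add: carr_jets)
    fix W \<Phi> assume "(W, \<Phi>) \<in> JA"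
    then obtain U \<phi> where U: "(U, \<phi>) \<in> A" "W = jet_dom U" "\<Phi> = jet_chart \<iota> \<phi>" by (auto simp: jet_atlas_iff)
    note s = smooth_intoD[OF \<gamma> U(1)]
    have eq: "?S \<inter> ?j -` W = {s. (s, 0) \<in> S \<inter> \<gamma> -` U}"
      using j by (auto simp: U jet_dom_def)
    show o: "open (?S \<inter> ?j -` W)" unfolding eq by (rule open_slice(2)[OF s(2)])
    have "smooth_on (?S \<inter> ?j -` W) (\<lambda>x. \<chi> i. iterated_dd (\<iota> i) (0, 1) (\<lambda>x. \<phi> (\<gamma> x)) (x, 0))"
      by (intro smooth_on_vec_lambda o smooth_on_compose[OF smooth_on_iterated_dd[OF s(3)]] smooth_on_Pair
        smooth_on_id smooth_on_const s(2)) (auto simp: eq)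
    moreover have "(\<chi> i. iterated_dd (\<iota> i) (0, 1) (\<lambda>x. \<phi> (\<gamma> x)) (x, 0)) = (\<Phi> \<circ> ?j) x" if "x \<in> ?S \<inter> ?j -` W" for x
    proof -
      have x: "(x, 0) \<in> S \<inter> \<gamma> -` U" using that unfolding eq by simp
      then have "jet_chart \<iota> \<phi> (?j x) = jcurve (\<phi> \<circ> (\<lambda>t. \<gamma> (x, t))) 0" using j(3)[of x, OF _ U(1)] by simp
      then show ?thesis using higher_vderiv_snd[OF s(2,3) x] by (simp add: U(3) jcurve_def comp_def)
    qed
    ultimately show "smooth_on (?S \<inter> ?j -` W) (\<Phi> \<circ> ?j)"
      by (rule iffD1[OF smooth_on_cong[OF o], rotated])
  qed
qed

text \<open>Exchanging the derivatives in \<open>s\<close> and \<open>t\<close> turns the coordinate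
  velocity of the curve of jets into the jet of the variation field in the chart.\<close>

lemma jet_family_velocity:
  assumes \<gamma>: "smooth_into A S \<gamma>" and s: "(s, 0) \<in> S" and U: "(U, \<phi>) \<in> A" "\<gamma> (s, 0) \<in> U"
  shows "velocity JA (\<lambda>s. jet_of A k (\<lambda>t. \<gamma> (s, t))) s = chart_vec JA (jet_dom U) (jet_chart \<iota> \<phi>)
    (jet_of A k (\<lambda>t. \<gamma> (s, t))) (jcurve (\<lambda>t. vector_derivative (\<lambda>s. \<phi> (\<gamma> (s, t))) (at s)) 0)"
proof -
  let ?j = "\<lambda>s. jet_of A k (\<lambda>t. \<gamma> (s, t))" and ?S = "{s. (s, 0) \<in> S}"
  note J = jet_family[OF \<gamma>]
  note sm = smooth_intoD[OF \<gamma> U(1)]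
  note j = jet_of_jets[OF smooth_near_slice[OF \<gamma>]]
  let ?N = "{s. (s, 0) \<in> S \<inter> \<gamma> -` U}"
  have N: "open ?N" "s \<in> ?N" by (rule open_slice(2)[OF sm(2)]) (use s U(2) in simp)
  have d: "((\<lambda>s. (\<chi> i. higher_vderiv (\<iota> i) (\<lambda>t. \<phi> (\<gamma> (s, t))) 0)) has_vector_derivative
      jcurve (\<lambda>t. vector_derivative (\<lambda>s. \<phi> (\<gamma> (s, t))) (at s)) 0) (at s)"
    unfolding jcurve_def
    by (intro has_vector_derivative_vec_lambda higher_vderiv_family[OF sm(2,3)]) (use N(2) in simp)
  show ?thesis
  proof (rule J.velocity_chart_deriv[where c = ?j and t = s, OF jet_atlasI[OF U(1)] _ N])
    show "?j s \<in> jet_dom U" using j[OF s] U(2) by (simp add: jet_dom_def)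
    show "?j ` ?N \<subseteq> jet_dom U" using j by (auto simp: jet_dom_def)
    show "((\<lambda>s. jet_chart \<iota> \<phi> (?j s)) has_vector_derivative
      jcurve (\<lambda>t. vector_derivative (\<lambda>s. \<phi> (\<gamma> (s, t))) (at s)) 0) (at s)"
      by (rule has_vector_derivative_transform_within_open[OF d N])
        (use j(3)[OF _ U(1)] in \<open>auto simp: jcurve_def comp_def\<close>)
  qed
qed

text \<open>Global smooth functions on the jets obtained from functions on \<open>A\<close>. Applied
  to cut-off coordinates, they become the jet coordinates over a ball and thereby separate tangent
  vectors of the jet manifold.\<close>

definition jet_fun :: "nat \<Rightarrow> ('a \<Rightarrow> real) \<Rightarrow> 'a jet \<Rightarrow> real" where
  "jet_fun n f u = higher_vderiv n (f \<circ> jet_rep u) 0"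

lemma jet_fun_chart:
  assumes f: "f \<in> smooth_fun A" and n: "n \<le> k" and U: "(U, \<phi>) \<in> A" and u: "u \<in> jet_dom U"
  shows "jet_fun n f u = prol n (f \<circ> inv_into U \<phi>) (jet_chart \<iota> \<phi> u)"
proof -
  have j: "u \<in> jets A k" "jet_proj u \<in> U" using u by (auto simp: jet_dom_def)
  have "jet_rep u 0 \<in> U" using j jets_rep by simp
  then obtain J where J: "open J" "0 \<in> J" "jet_rep u ` J \<subseteq> U" "smooth_on J (\<phi> \<circ> jet_rep u)"
    using smooth_near_chart[OF jets_rep(1)[OF j(1)] U] by blast
  have "higher_vderiv n (f \<circ> jet_rep u) 0 = higher_vderiv n (\<lambda>t. (f \<circ> inv_into U \<phi>) ((\<phi> \<circ> jet_rep u) t)) 0"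
    by (rule higher_vderiv_cong[OF J(1,2)]) (use J(3) in \<open>auto simp: inv_chart[OF U] image_subset_iff\<close>)
  also have "\<dots> = prol n (f \<circ> inv_into U \<phi>) (jcurve (\<phi> \<circ> jet_rep u) 0)"
    by (rule higher_vderiv_compose[OF chart_open[OF U] smooth_funD[OF f U] J(1,4) _ n J(2)]) (use J(3) in auto)
  finally show ?thesis by (simp add: jet_fun_def jet_chart_jcurve)
qed

lemma jet_fun_smooth:
  assumes f: "f \<in> smooth_fun A" and n: "n \<le> k"
  shows "jet_fun n f \<in> smooth_fun JA"
proof -
  have "smooth_on (\<Phi> ` W) (jet_fun n f \<circ> inv_into W \<Phi>)" if "(W, \<Phi>) \<in> JA" for W \<Phi>
  proof -
    obtain U \<phi> where U: "(U, \<phi>) \<in> A" "W = jet_dom U" "\<Phi> = jet_chart \<iota> \<phi>" using \<open>(W, \<Phi>) \<in> JA\<close> by (auto simp: jet_atlas_iff)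
    have "smooth_on (over (\<phi> ` U)) (prol n (f \<circ> inv_into U \<phi>))"
      by (rule prol_props[OF chart_open[OF U(1)] smooth_funD[OF f U(1)]])
    then show ?thesis unfolding U jet_chart_image[OF U(1) order_refl]
      by (rule iffD1[OF smooth_on_cong[OF open_over[OF chart_open[OF U(1)]]], rotated])
        (simp add: jet_fun_chart[OF f n U(1)] jet_chart_inv[OF U(1)])
  qed
  then show ?thesis by (auto simp: smooth_fun_def)
qed

lemma jet_fun_0: "u \<in> jets A k \<Longrightarrow> jet_fun 0 f u = f (jet_proj u)"
  by (simp add: jet_fun_def jets_rep)

lemma smooth_fun_proj: "f \<in> smooth_fun A \<Longrightarrow> (\<lambda>u. f (jet_proj u)) \<in> smooth_fun JA"
  by (rule iffD1[OF J.smooth_fun_cong jet_fun_smooth[of f 0]]) (simp_all add: jet_fun_0 carr_jets)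

lemma pushforward_proj:
  assumes U: "(U, \<phi>) \<in> A" and u: "u \<in> jet_dom U"
  shows "pushforward A jet_proj (chart_vec JA (jet_dom U) (jet_chart \<iota> \<phi>) u w) = chart_vec A U \<phi> (jet_proj u) (w $ idx 0)"
proof
  fix f
  let ?y = "jet_chart \<iota> \<phi> u"
  have j: "u \<in> jets A k" "jet_proj u \<in> U" using u by (auto simp: jet_dom_def)
  show "pushforward A jet_proj (chart_vec JA (jet_dom U) (jet_chart \<iota> \<phi>) u w) f = chart_vec A U \<phi> (jet_proj u) (w $ idx 0) f"
  proof (cases "f \<in> smooth_fun A")
    case True
    have nth: "((\<lambda>y. y $ idx 0) has_derivative (\<lambda>w. w $ idx 0)) (at ?y)"
      by (rule bounded_linear_imp_has_derivative[OF bounded_linear_vec_nth])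
    have "dd ((f \<circ> jet_proj) \<circ> inv_into (jet_dom U) (jet_chart \<iota> \<phi>)) ?y w
        = dd (\<lambda>y. (f \<circ> inv_into U \<phi>) (y $ idx 0)) ?y w"
      by (rule fun_cong[OF dd_cong(1)[OF open_over[OF chart_open[OF U]] jet_dom_over[OF u]]])
        (simp add: jet_chart_inv[OF U])
    also have "\<dots> = dd (f \<circ> inv_into U \<phi>) (?y $ idx 0) (dd (\<lambda>y. y $ idx 0) ?y w)"
    proof (rule dd_compose)
      show "(f \<circ> inv_into U \<phi>) differentiable at (?y $ idx 0)"
        unfolding jet_chart_0[OF j(1)] by (rule smooth_fun_differentiable[OF True U j(2)])
      show "(\<lambda>y. y $ idx 0) differentiable at ?y" by (rule differentiableI[OF nth])
    qed
    also have "dd (\<lambda>y. y $ idx 0) ?y w = w $ idx 0"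
      by (simp add: dd_eq[OF nth])
    finally show ?thesis using smooth_fun_proj[OF True] True
      by (simp add: pushforward_def chart_vec_def comp_def jet_chart_0[OF j(1)])
  qed (simp add: pushforward_def chart_vec_def)
qed

end

section \<open>The maps K in coordinates\<close>

lemma higher_vderiv_bounded_linear:
  assumes L: "bounded_linear L" and J: "open J" "smooth_on J c" "t \<in> J"
  shows "higher_vderiv n (\<lambda>t. L (c t)) t = L (higher_vderiv n c t)"
  using J(3)
proof (induction n arbitrary: t)
  case (Suc n)
  have "((\<lambda>t. L (higher_vderiv n c t)) has_vector_derivative L (higher_vderiv (Suc n) c t)) (at t)"
    by (rule bounded_linear.has_vector_derivative[OF L higher_vderiv_has_derivative[OF J(1,2) Suc.prems]])
  then show ?case
    using vector_derivative_cong_open[OF J(1) Suc.prems, of "higher_vderiv n (\<lambda>t. L (c t))"] Suc.IH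
    by (simp add: higher_vderiv_Suc[of n "\<lambda>t. L (c t)"] vector_derivative_at)
qed simp

text \<open>Pascal's rule, arranged for the induction step of a Leibniz formula.\<close>

lemma binomial_sum_Suc:
  fixes a :: "nat \<Rightarrow> 'b::real_vector"
  shows "(\<Sum>j\<le>Suc n. real (Suc n choose j) *\<^sub>R a j)
    = (\<Sum>j\<le>n. real (n choose j) *\<^sub>R a j) + (\<Sum>j\<le>n. real (n choose j) *\<^sub>R a (Suc j))"
proof -
  have "(\<Sum>j\<le>n. real (n choose j) *\<^sub>R a j) = (\<Sum>j\<le>Suc n. real (n choose j) *\<^sub>R a j)" by simp
  also have "\<dots> = a 0 + (\<Sum>j\<le>n. real (n choose Suc j) *\<^sub>R a (Suc j))"
    by (simp add: sum.atMost_Suc_shift del: sum.atMost_Suc)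
  finally show ?thesis
    by (simp add: sum.atMost_Suc_shift[of _ n] scaleR_left_distrib sum.distrib del: sum.atMost_Suc)
qed

locale jet_manifold = manifold A + jet_index k \<iota>
  for A :: "('a, 'e::euclidean_space) atlas" and k :: nat and \<iota> :: "'i::finite \<Rightarrow> nat"

sublocale jet_manifold \<subseteq> jet_space
  by unfold_locales

context jet_manifold
begin

abbreviation "jtv U \<phi> \<equiv> chart_vec JA (jet_dom U) (jet_chart \<iota> \<phi>)"

lemma jet_coordinates:
  assumes U: "(U, \<phi>) \<in> A" "p \<in> U"
  obtains x r where "r > 0" "ball (\<phi> p) r \<subseteq> \<phi> ` U" "\<And>b. x b \<in> smooth_fun A"
    "\<And>b q. q \<in> U \<Longrightarrow> \<phi> q \<in> ball (\<phi> p) r \<Longrightarrow> x b q = \<phi> q \<bullet> b"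
    "\<And>n b u. n \<le> k \<Longrightarrow> u \<in> jet_dom U \<Longrightarrow> \<phi> (jet_proj u) \<in> ball (\<phi> p) r \<Longrightarrow>
      jet_fun n (x b) u = jet_chart \<iota> \<phi> u $ idx n \<bullet> b"
    "\<And>n b u w. n \<le> k \<Longrightarrow> u \<in> jet_dom U \<Longrightarrow> \<phi> (jet_proj u) \<in> ball (\<phi> p) r \<Longrightarrow>
      jtv U \<phi> u w (jet_fun n (x b)) = w $ idx n \<bullet> b"
proof -
  obtain x r where x: "r > 0" "ball (\<phi> p) r \<subseteq> \<phi> ` U" "\<And>b. x b \<in> smooth_fun A"
    "\<And>b q. q \<in> U \<Longrightarrow> \<phi> q \<in> ball (\<phi> p) r \<Longrightarrow> x b q = \<phi> q \<bullet> b"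
    by (rule coordinate_functions[OF U]) (rule that, assumption+)
  let ?B = "ball (\<phi> p) r"
  have j: "jet_fun n (x b) u = jet_chart \<iota> \<phi> u $ idx n \<bullet> b"
    if n: "n \<le> k" and u: "u \<in> jet_dom U" "\<phi> (jet_proj u) \<in> ?B" for n b u
  proof -
    have u': "u \<in> jets A k" "jet_rep u 0 \<in> U" "jet_rep u 0 = jet_proj u" using u by (auto simp: jet_dom_def jets_rep)
    obtain J where J: "open J" "0 \<in> J" "jet_rep u ` J \<subseteq> U" "smooth_on J (\<phi> \<circ> jet_rep u)"
      using smooth_near_chart[OF jets_rep(1)[OF u'(1)] U(1) u'(2)] by blast
    \<comment> \<open>Over the ball \<open>x b\<close> is a coordinate, so only times at which the
      curve lies over it are kept.\<close>
    let ?J = "J \<inter> (\<phi> \<circ> jet_rep u) -` ?B"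
    have o: "open ?J" by (rule continuous_open_preimage[OF smooth_on_continuous[OF J(4)] J(1) open_ball])
    have 0: "0 \<in> ?J" using J(2) u(2) u'(3) by simp
    have "jet_fun n (x b) u = higher_vderiv n (\<lambda>t. (\<phi> \<circ> jet_rep u) t \<bullet> b) 0"
      unfolding jet_fun_def
      by (rule higher_vderiv_cong[OF o 0]) (use x(4) J(3) in \<open>auto simp: image_subset_iff\<close>)
    also have "\<dots> = higher_vderiv n (\<phi> \<circ> jet_rep u) 0 \<bullet> b"
      by (rule higher_vderiv_bounded_linear[OF bounded_linear_inner_left J(1,4,2)])
    finally show ?thesis using n by (simp add: jet_chart_jcurve jcurve_def)
  qed
  have jt: "jtv U \<phi> u w (jet_fun n (x b)) = w $ idx n \<bullet> b"
    if n: "n \<le> k" and u: "u \<in> jet_dom U" "\<phi> (jet_proj u) \<in> ?B" for n b u w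
  proof -
    have u': "u \<in> jets A k" using u by (simp add: jet_dom_def)
    have "dd (jet_fun n (x b) \<circ> inv_into (jet_dom U) (jet_chart \<iota> \<phi>)) (jet_chart \<iota> \<phi> u)
        = dd (\<lambda>y. y $ idx n \<bullet> b) (jet_chart \<iota> \<phi> u)"
    proof (rule dd_cong(1)[OF open_over[OF open_ball]])
      show "jet_chart \<iota> \<phi> u \<in> over ?B" using u by (simp add: over_def jet_chart_0[OF u'])
      fix y :: "'e ^ 'i" assume "y \<in> over ?B"
      then have y: "y $ idx 0 \<in> ?B" "y \<in> over (\<phi> ` U)" using x(2) by (auto simp: over_def)
      note i = jet_chart_inv[OF U(1) y(2)]
      have "y $ idx 0 \<in> \<phi> ` U" using y by (simp add: over_def)
      then have "\<phi> (inv_into U \<phi> (y $ idx 0)) = y $ idx 0" by (rule chart_inv(1))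
      then have "\<phi> (jet_proj (inv_into (jet_dom U) (jet_chart \<iota> \<phi>) y)) \<in> ?B" using i(3) y(1) by simp
      from j[OF n i(1) this] show "(jet_fun n (x b) \<circ> inv_into (jet_dom U) (jet_chart \<iota> \<phi>)) y = y $ idx n \<bullet> b"
        using i(2) by simp
    qed
    also have "dd (\<lambda>y. y $ idx n \<bullet> b) (jet_chart \<iota> \<phi> u) = (\<lambda>w. w $ idx n \<bullet> b)"
      by (rule dd_eq, rule has_derivative_inner_left, rule bounded_linear_imp_has_derivative[OF bounded_linear_vec_nth])
    finally show ?thesis using jet_fun_smooth[OF x(3) n] by (simp add: chart_vec_def)
  qed
  show thesis by (rule that[OF x j jt])
qed

lemma jtv_inject:
  assumes U: "(U, \<phi>) \<in> A" and u: "u \<in> jet_dom U"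
  shows "jtv U \<phi> u v = jtv U \<phi> u w \<longleftrightarrow> v = w"
proof
  assume eq: "jtv U \<phi> u v = jtv U \<phi> u w"
  have p: "jet_proj u \<in> U" using u by (simp add: jet_dom_def)
  obtain x r where x: "r > 0" "\<And>n b u' w. n \<le> k \<Longrightarrow> u' \<in> jet_dom U \<Longrightarrow> \<phi> (jet_proj u') \<in> ball (\<phi> (jet_proj u)) r \<Longrightarrow>
      jtv U \<phi> u' w (jet_fun n (x b)) = w $ idx n \<bullet> b"
    by (rule jet_coordinates[OF U p]) (rule that, assumption+)
  show "v = w"
  proof (rule vec_eqI, rule euclidean_eqI)
    fix n b assume "n \<le> k"
    then show "v $ idx n \<bullet> b = w $ idx n \<bullet> b"
      using x(2)[of n u v b] x(2)[of n u w b] eq u x(1) by simp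
  qed
qed simp

lemma family_exists:
  assumes U: "(U, \<phi>) \<in> A" and u: "u \<in> jet_dom U"
  obtains \<gamma> S where "smooth_into A S \<gamma>" "(0, 0) \<in> S" "jet_of A k (\<lambda>t. \<gamma> (0, t)) = u"
    "velocity JA (\<lambda>s. jet_of A k (\<lambda>t. \<gamma> (s, t))) 0 = jtv U \<phi> u w"
proof -
  define y where "y = jet_chart \<iota> \<phi> u"
  have y: "y \<in> over (\<phi> ` U)" unfolding y_def by (rule jet_dom_over[OF u])
  \<comment> \<open>Taylor curves with coefficients \<open>y + s w\<close>: at \<open>s = 0\<close>
    the jet is \<open>y\<close>, and the derivative in \<open>s\<close> is the Taylor curve of
    \<open>w\<close>, whose jet at 0 is \<open>w\<close>.\<close>
  define G where "G = (\<lambda>p :: real \<times> real. taylor k (\<lambda>j. y $ idx j + fst p *\<^sub>R w $ idx j) (snd p))"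
  have G: "smooth_on UNIV G" unfolding G_def
    by (intro smooth_on_taylor smooth_on_add smooth_on_const smooth_on_scaleR open_UNIV
        smooth_on_linear[OF bounded_linear_fst] smooth_on_linear[OF bounded_linear_snd])
  define S where "S = G -` (\<phi> ` U)"
  have S: "open S" unfolding S_def by (rule open_vimage[OF chart_open[OF U] smooth_on_continuous[OF G]])
  define \<gamma> where "\<gamma> p = inv_into U \<phi> (G p)" for p
  have \<gamma>: "smooth_into A S \<gamma>" unfolding \<gamma>_def
    by (rule smooth_into_chart[OF U S smooth_on_subset[OF G]]) (auto simp: S_def)
  have G0: "G (0, t) = jtaylor y t" for t by (simp add: G_def jtaylor_def)
  have 0: "(0, 0) \<in> S" using y by (simp add: S_def G0 jtaylor_0 over_def)
  have \<phi>\<gamma>: "\<phi> (\<gamma> p) = G p" "\<gamma> p \<in> U" if "p \<in> S" for p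
    using that chart_inv[of "G p" \<phi> U] by (simp_all add: \<gamma>_def S_def)
  have ju: "jet_of A k (\<lambda>t. \<gamma> (0, t)) = u"
  proof -
    have "jet_of A k (\<lambda>t. \<gamma> (0, t)) = jet_lift U \<phi> y" by (simp add: jet_lift_def \<gamma>_def G0)
    also have "\<dots> = u" using inv_jet_chart[OF U y] inv_into_f_f[OF jet_chart_inj[OF U] u] by (simp add: y_def)
    finally show ?thesis .
  qed
  have "jcurve (\<lambda>t. vector_derivative (\<lambda>s. \<phi> (\<gamma> (s, t))) (at 0)) 0 = jcurve (jtaylor w) 0"
  proof (rule jcurve_cong[OF open_slice(1)[OF S, of 0]])
    fix t assume "t \<in> {t. (0, t) \<in> S}"
    then have t: "0 \<in> {s. (s, t) \<in> S}" by simp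
    have "vector_derivative (\<lambda>s. \<phi> (\<gamma> (s, t))) (at 0) = vector_derivative (\<lambda>s. G (s, t)) (at 0)"
      by (rule vector_derivative_cong_open[OF open_slice(2)[OF S] t]) (simp add: \<phi>\<gamma>)
    also have "\<dots> = jtaylor w t"
    proof (rule vector_derivative_at)
      have "((\<lambda>s. (t ^ j / fact j) *\<^sub>R (y $ idx j + s *\<^sub>R w $ idx j)) has_vector_derivative
          (t ^ j / fact j) *\<^sub>R (w $ idx j)) (at 0)" for j
        by (auto intro!: derivative_eq_intros)
      then show "((\<lambda>s. G (s, t)) has_vector_derivative jtaylor w t) (at 0)"
        unfolding G_def jtaylor_def taylor_def by (simp add: has_vector_derivative_sum)
    qed
    finally show "vector_derivative (\<lambda>s. \<phi> (\<gamma> (s, t))) (at 0) = jtaylor w t" .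
  qed (use 0 in simp)
  then have "velocity JA (\<lambda>s. jet_of A k (\<lambda>t. \<gamma> (s, t))) 0 = jtv U \<phi> u w"
    using jet_family_velocity[OF \<gamma> 0 U \<phi>\<gamma>(2)[OF 0]] by (simp add: ju jcurve_jtaylor)
  then show thesis by (rule that[OF \<gamma> 0 ju])
qed

end

section \<open>Covariant derivatives of the coordinate differentials\<close>

locale jet_frame = frame A D U \<phi> T \<Gamma> E + jet_index k \<iota>
  for A :: "('a, 'e::euclidean_space) atlas" and D U \<phi> T \<Gamma> E and k :: nat and \<iota> :: "'i::finite \<Rightarrow> nat" +
  assumes k_pos: "k \<ge> 1"

sublocale jet_frame \<subseteq> jet_manifold
  by unfold_locales

context jet_frame
begin

text \<open>\<open>Om j w\<close> expresses in coordinates the covariant derivative of order \<open>j\<close> along a curve of the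
  differentials of the coordinate functions, evaluated at \<open>w\<close>, in terms of the jet of the curve.\<close>

primrec Om :: "nat \<Rightarrow> 'e \<Rightarrow> 'e ^ 'i \<Rightarrow> 'e" where
  "Om 0 w y = w"
| "Om (Suc j) w y = TD (Om j w) y - (\<Sum>b\<in>Basis. (\<Gamma> (y $ idx 0) (y $ idx 1) w \<bullet> b) *\<^sub>R Om j b y)"

lemma Om_smooth: "smooth_on (over T) (Om j w)"
proof (induction j arbitrary: w)
  case 0
  have "Om 0 w = (\<lambda>y. w)" by auto
  then show ?case by simp
next
  case (Suc j)
  have "Om (Suc j) w = (\<lambda>y. TD (Om j w) y - (\<Sum>b\<in>Basis. (\<Gamma> (y $ idx 0) (y $ idx 1) w \<bullet> b) *\<^sub>R Om j b y))"
    by auto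
  moreover have o: "open (over T)" by (rule open_over[OF open_T])
  have "smooth_on (over T) (\<lambda>y. TD (Om j w) y - (\<Sum>b\<in>Basis. (\<Gamma> (y $ idx 0) (y $ idx 1) w \<bullet> b) *\<^sub>R Om j b y))"
    by (intro smooth_on_diff smooth_on_TD smooth_on_sum smooth_on_scaleR smooth_on_inner smooth_on_\<Gamma>
        smooth_on_vec_nth smooth_on_const smooth_on_id o open_T Suc) (auto simp: over_def)
  ultimately show ?case by simp
qed

lemma Om_depends: "j \<le> k \<Longrightarrow> depends j T (Om j w)"
proof (induction j arbitrary: w)
  case (Suc j)
  have IH: "depends j T (Om j w)" for w using Suc by simp
  note TD = depends_TD[OF open_T Om_smooth IH]
  show ?case unfolding depends_def
  proof (intro allI impI)
    fix y y' assume y: "y \<in> over T" "\<forall>i. \<iota> i \<le> Suc j \<longrightarrow> y $ i = y' $ i"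
    have "TD (Om j w) y = TD (Om j w) y'" by (rule dependsD[OF TD y(1)]) (use y in auto)
    moreover have "Om j b y = Om j b y'" for b by (rule dependsD[OF IH y(1)]) (use y in auto)
    \<comment> \<open>The connection term involves orders 0 and 1 only; both are at most
      \<open>Suc j\<close>, and \<open>k \<ge> 1\<close> makes order 1 a jet coordinate.\<close>
    moreover have "y $ idx 0 = y' $ idx 0" "y $ idx 1 = y' $ idx 1" using y(2) k_pos by auto
    ultimately show "Om (Suc j) w y = Om (Suc j) w y'" by simp
  qed
qed (simp add: depends_def)

text \<open>Linearity passes to \<open>TD\<close> by differentiating an identity that holds on the
  open set \<open>over T\<close>, which is why the claim is restricted to that set.\<close>

lemma Om_linear: "y \<in> over T \<Longrightarrow> linear (\<lambda>w. Om j w y)"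
proof (induction j arbitrary: y)
  case 0
  then show ?case by (simp add: linear_iff)
next
  case (Suc j)
  note d = smooth_on_differentiable[OF Om_smooth Suc.prems, THEN dd_has_derivative]
  have add: "TD (Om j (v + w)) y = TD (Om j v) y + TD (Om j w) y" for v w
  proof -
    have "dd (Om j (v + w)) y = dd (\<lambda>y. Om j v y + Om j w y) y"
      by (rule dd_cong(1)[OF open_over[OF open_T] Suc.prems]) (simp add: linear_add[OF Suc.IH])
    then show ?thesis using dd_eq[OF has_derivative_add[OF d d], of j v j w] by (simp add: TD_def)
  qed
  have scale: "TD (Om j (c *\<^sub>R w)) y = c *\<^sub>R TD (Om j w) y" for c w
  proof -
    have "dd (Om j (c *\<^sub>R w)) y = dd (\<lambda>y. c *\<^sub>R Om j w y) y"
      by (rule dd_cong(1)[OF open_over[OF open_T] Suc.prems]) (simp add: linear_scale[OF Suc.IH])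
    then show ?thesis using dd_eq[OF has_derivative_scaleR_right[OF d], of c j w] by (simp add: TD_def)
  qed
  show ?case
    by (rule linearI)
      (simp_all add: add scale linear_add[OF \<Gamma>_linear(1)] linear_scale[OF \<Gamma>_linear(1)] inner_add_left
        scaleR_add_left sum.distrib scaleR_sum_right scaleR_diff_right)
qed

lemma Om_expand:
  assumes "y \<in> over T"
  shows "Om j w y = (\<Sum>b\<in>Basis. (w \<bullet> b) *\<^sub>R Om j b y)"
proof -
  have "Om j w y = Om j (\<Sum>b\<in>Basis. (w \<bullet> b) *\<^sub>R b) y" by (simp add: euclidean_representation)
  also have "\<dots> = (\<Sum>b\<in>Basis. (w \<bullet> b) *\<^sub>R Om j b y)"
    using linear_sum[OF Om_linear[OF assms], of j "\<lambda>b. (w \<bullet> b) *\<^sub>R b" Basis] linear_scale[OF Om_linear[OF assms]]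
    by simp
  finally show ?thesis .
qed

lemma Om_Suc:
  assumes "y \<in> over T"
  shows "Om (Suc j) w y = TD (Om j w) y - Om j (\<Gamma> (y $ idx 0) (y $ idx 1) w) y"
  using Om_expand[OF assms, of j "\<Gamma> (y $ idx 0) (y $ idx 1) w"] by simp

lemma Om_0_fun: "Om 0 w = (\<lambda>y. w)"
  by auto

text \<open>\<open>Om 1 w y\<close> is minus \<open>\<Gamma>\<close> applied to the first derivative
  and \<open>w\<close>, which fixes the slope in the top entry. \<open>TD_affine\<close> carries
  this slope up one order at a time, and the correction term in \<open>Om_Suc\<close> stays of order
  at most \<open>j\<close>.\<close>

lemma Om_affine:
  assumes "1 \<le> j" "j \<le> k" "y \<in> over T"
  shows "Om j w (y + axis (idx j) v) = Om j w y - \<Gamma> (y $ idx 0) v w"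
  using assms(1,2)
proof (induction j arbitrary: w v rule: dec_induct)
  case base
  have ne: "idx 1 \<noteq> idx 0" using k_pos by (metis \<iota>_idx le0 zero_neq_one)
  have y': "y + axis (idx 1) v \<in> over T" using assms(3) ne by (simp add: over_def axis_def)
  have 1: "Om 1 w z = - \<Gamma> (z $ idx 0) (z $ idx 1) w" if "z \<in> over T" for z
    using Om_Suc[OF that, of 0 w] by (simp add: Om_0_fun TD_def)
  show ?case unfolding 1[OF y'] 1[OF assms(3)] using ne
    by (simp add: axis_def linear_add[OF \<Gamma>_linear(2)])
next
  case (step j)
  have j: "j < k" "j \<le> k" "1 \<le> j" using step by auto
  have ne: "idx (Suc j) \<noteq> idx 0" "idx (Suc j) \<noteq> idx 1"
    using step by (metis \<iota>_idx le0 nat.distinct(1), metis \<iota>_idx One_nat_def Suc_inject Suc_le_D k_pos le_zero_eq not_one_le_zero)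
  have y': "y + axis (idx (Suc j)) v \<in> over T" using assms(3) ne by (simp add: over_def axis_def)
  have "linear (\<lambda>v. - \<Gamma> (y $ idx 0) v w)" for w
    using linear_compose_neg[OF \<Gamma>_linear(2)] .
  moreover have "Om j w (y + axis (idx j) v) = Om j w y + - \<Gamma> (y $ idx 0) v w" for w v
    using step.IH[OF j(2)] by simp
  ultimately have "TD (Om j w) (y + axis (idx (Suc j)) v) = TD (Om j w) y + - \<Gamma> (y $ idx 0) v w"
    by (intro TD_affine[OF open_T Om_smooth Om_depends[OF j(2)] j(1,3) assms(3)])
  moreover have "Om j b (y + axis (idx (Suc j)) v) = Om j b y" for b
  proof (rule dependsD[OF Om_depends[OF j(2)] assms(3), symmetric])
    fix i assume "\<iota> i \<le> j"
    then have "i \<noteq> idx (Suc j)" using j(1) by auto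
    then show "y $ i = (y + axis (idx (Suc j)) v) $ i" by (simp add: axis_def)
  qed
  ultimately show ?case unfolding Om_Suc[OF y'] Om_Suc[OF assms(3)] using ne by (simp add: axis_def)
qed

text \<open>The Leibniz rule for the pairing of a covector field with a vector field along
  \<open>c\<close>: the \<open>\<Gamma>\<close> terms hidden in \<open>Om (Suc j)\<close> and in
  \<open>nabla\<close> cancel. The bound \<open>j < k\<close> keeps the derivative of the jet within
  the available coordinates.\<close>

lemma Om_deriv:
  assumes j: "j < k" and J: "open J" "t \<in> J" and c: "smooth_on J c" "c ` J \<subseteq> T" and n: "smooth_on J n"
  shows "((\<lambda>t. Om j (n t) (jcurve c t)) has_vector_derivative
    Om (Suc j) (n t) (jcurve c t) + Om j (nabla c n t) (jcurve c t)) (at t)"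
proof -
  let ?y = "jcurve c t" and ?n' = "vector_derivative n (at t)"
  have ov: "jcurve c r \<in> over T" if "r \<in> J" for r using that c(2) by (auto simp: jcurve_over)
  have y: "?y \<in> over T" by (rule ov[OF J(2)])
  have y01: "?y $ idx 0 = c t" "?y $ idx 1 = vector_derivative c (at t)"
    using k_pos by (simp_all add: jcurve_def higher_vderiv_Suc flip: One_nat_def) (simp add: higher_vderiv_Suc)
  have dn: "((\<lambda>t. n t \<bullet> b) has_real_derivative ?n' \<bullet> b) (at t)" for b
    unfolding has_real_derivative_iff_has_vector_derivative
    using bounded_linear.has_vector_derivative[OF bounded_linear_inner_left smooth_on_vderiv(1)[OF n J(2)]]
    by (simp add: smooth_on_vderiv(2)[OF n J(2)])
  have ct: "c t \<in> T" using c(2) J(2) by blast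
  have dOm: "((\<lambda>t. Om j b (jcurve c t)) has_vector_derivative TD (Om j b) ?y) (at t)" for b
    by (rule TD_chain[OF open_T Om_smooth Om_depends[OF less_imp_le[OF j]] j J(1) c(1) J(2) ct])
  have "((\<lambda>t. \<Sum>b\<in>Basis. (n t \<bullet> b) *\<^sub>R Om j b (jcurve c t)) has_vector_derivative
      (\<Sum>b\<in>Basis. (n t \<bullet> b) *\<^sub>R TD (Om j b) ?y + (?n' \<bullet> b) *\<^sub>R Om j b ?y)) (at t)"
    by (intro has_vector_derivative_sum has_vector_derivative_scaleR dn dOm)
  moreover have "(\<Sum>b\<in>Basis. (n t \<bullet> b) *\<^sub>R TD (Om j b) ?y + (?n' \<bullet> b) *\<^sub>R Om j b ?y)
      = Om (Suc j) (n t) ?y + Om j (nabla c n t) ?y"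
  proof -
    have TD: "TD (Om j b) ?y = Om (Suc j) b ?y + Om j (\<Gamma> (c t) (vector_derivative c (at t)) b) ?y" for b
      using Om_Suc[OF y, of j b] by (simp del: Om.simps One_nat_def add: y01)
    have G: "(\<Sum>b\<in>Basis. (n t \<bullet> b) *\<^sub>R Om j (\<Gamma> (c t) v b) ?y) = Om j (\<Gamma> (c t) v (n t)) ?y" for v
    proof -
      have "linear (\<lambda>w. Om j (\<Gamma> (c t) v w) ?y)"
        using linear_compose[OF \<Gamma>_linear(1) Om_linear[OF y]] by (simp add: comp_def)
      from linear_sum[OF this, of "\<lambda>b. (n t \<bullet> b) *\<^sub>R b" Basis] linear_scale[OF this]
      show ?thesis by (simp add: euclidean_representation)
    qed
    have "(\<Sum>b\<in>Basis. (n t \<bullet> b) *\<^sub>R TD (Om j b) ?y + (?n' \<bullet> b) *\<^sub>R Om j b ?y)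
      = (\<Sum>b\<in>Basis. (n t \<bullet> b) *\<^sub>R Om (Suc j) b ?y)
        + (\<Sum>b\<in>Basis. (n t \<bullet> b) *\<^sub>R Om j (\<Gamma> (c t) (vector_derivative c (at t)) b) ?y)
        + (\<Sum>b\<in>Basis. (?n' \<bullet> b) *\<^sub>R Om j b ?y)"
      by (simp del: Om.simps add: TD sum.distrib scaleR_add_right)
    also have "\<dots> = Om (Suc j) (n t) ?y + Om j (\<Gamma> (c t) (vector_derivative c (at t)) (n t)) ?y + Om j ?n' ?y"
      unfolding G Om_expand[OF y, of "Suc j" "n t"] Om_expand[OF y, of j ?n'] ..
    also have "\<dots> = Om (Suc j) (n t) ?y + Om j (nabla c n t) ?y"
      by (simp del: Om.simps add: nabla_def linear_add[OF Om_linear[OF y]])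
    finally show ?thesis .
  qed
  ultimately have "((\<lambda>t. \<Sum>b\<in>Basis. (n t \<bullet> b) *\<^sub>R Om j b (jcurve c t)) has_vector_derivative
      Om (Suc j) (n t) ?y + Om j (nabla c n t) ?y) (at t)" by (simp only:)
  then show ?thesis
    by (rule has_vector_derivative_transform_within_open[OF _ J]) (rule Om_expand[OF ov, symmetric])
qed

text \<open>Since \<open>v\<close> is \<open>Om 0 v\<close>, repeated use of the product rule
  \<open>Om_deriv\<close> expands its ordinary derivatives in covariant ones, with binomial
  coefficients from Pascal's rule.\<close>

lemma higher_vderiv_nabla:
  assumes J: "open J" and c: "smooth_on J c" "c ` J \<subseteq> T" and v: "smooth_on J v" and "\<beta> \<le> k" "t \<in> J"
  shows "higher_vderiv \<beta> v t = (\<Sum>j\<le>\<beta>. real (\<beta> choose j) *\<^sub>R Om (\<beta> - j) ((nabla c ^^ j) v t) (jcurve c t))"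
  using assms(5,6)
proof (induction \<beta> arbitrary: t)
  case (Suc \<beta>)
  let ?a = "\<lambda>j. Om (Suc \<beta> - j) ((nabla c ^^ j) v t) (jcurve c t)"
  have "((\<lambda>t. Om (\<beta> - j) ((nabla c ^^ j) v t) (jcurve c t)) has_vector_derivative ?a j + ?a (Suc j)) (at t)"
    if "j \<le> \<beta>" for j
    using Om_deriv[of "\<beta> - j" J t c "(nabla c ^^ j) v"] Suc.prems J c smooth_on_nabla_iterate[OF J c(1) v c(2)] that
    by (simp del: Om.simps add: Suc_diff_le)
  then have "((\<lambda>t. \<Sum>j\<le>\<beta>. real (\<beta> choose j) *\<^sub>R Om (\<beta> - j) ((nabla c ^^ j) v t) (jcurve c t)) has_vector_derivative
      (\<Sum>j\<le>\<beta>. real (\<beta> choose j) *\<^sub>R (?a j + ?a (Suc j)))) (at t)"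
    by (intro has_vector_derivative_sum bounded_linear.has_vector_derivative[OF bounded_linear_scaleR_right]) simp
  moreover have "(\<Sum>j\<le>\<beta>. real (\<beta> choose j) *\<^sub>R (?a j + ?a (Suc j))) = (\<Sum>j\<le>Suc \<beta>. real (Suc \<beta> choose j) *\<^sub>R ?a j)"
    unfolding binomial_sum_Suc by (simp only: scaleR_add_right sum.distrib)
  ultimately have "vector_derivative (\<lambda>t. \<Sum>j\<le>\<beta>. real (\<beta> choose j) *\<^sub>R Om (\<beta> - j) ((nabla c ^^ j) v t) (jcurve c t)) (at t)
      = (\<Sum>j\<le>Suc \<beta>. real (Suc \<beta> choose j) *\<^sub>R ?a j)"
    by (simp only: vector_derivative_at)
  moreover have "vector_derivative (higher_vderiv \<beta> v) (at t)
      = vector_derivative (\<lambda>t. \<Sum>j\<le>\<beta>. real (\<beta> choose j) *\<^sub>R Om (\<beta> - j) ((nabla c ^^ j) v t) (jcurve c t)) (at t)"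
    by (rule vector_derivative_cong_open[OF J Suc.prems(2)]) (use Suc in simp)
  ultimately show ?case by (simp only: higher_vderiv_Suc)
qed simp

text \<open>\<open>decomp y w \<kappa>\<close>: the tangent vector at the jet \<open>y\<close> with components \<open>w\<close> is mapped to \<open>\<kappa> j\<close> by \<open>K\<^sub>j\<close>.\<close>

definition decomp :: "'e ^ 'i \<Rightarrow> 'e ^ 'i \<Rightarrow> (nat \<Rightarrow> 'e) \<Rightarrow> bool" where
  "decomp y w \<kappa> \<longleftrightarrow> (\<forall>\<beta>\<le>k. w $ idx \<beta> = (\<Sum>j\<le>\<beta>. (fact \<beta> / fact (\<beta> - j)) *\<^sub>R Om (\<beta> - j) (\<kappa> j) y))"

text \<open>The system is triangular: in the equation of order \<open>\<beta>\<close> the unknown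
  \<open>\<kappa> \<beta>\<close> occurs with coefficient \<open>fact \<beta>\<close>, because
  \<open>Om 0\<close> is the identity, and all other unknowns have smaller index.\<close>

lemma decomp_unique:
  assumes "decomp y w \<kappa>" "decomp y w \<kappa>'" "j \<le> k"
  shows "\<kappa> j = \<kappa>' j"
  using assms(3)
proof (induction j rule: less_induct)
  case (less \<beta>)
  have sp: "(\<Sum>j\<le>\<beta>. (fact \<beta> / fact (\<beta> - j)) *\<^sub>R Om (\<beta> - j) (\<kappa> j) y)
      = (\<Sum>j<\<beta>. (fact \<beta> / fact (\<beta> - j)) *\<^sub>R Om (\<beta> - j) (\<kappa> j) y) + fact \<beta> *\<^sub>R \<kappa> \<beta>" for \<kappa>
    by (simp add: lessThan_Suc_atMost[symmetric] del: lessThan_Suc_atMost)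
  have "(\<Sum>j<\<beta>. (fact \<beta> / fact (\<beta> - j)) *\<^sub>R Om (\<beta> - j) (\<kappa> j) y) + fact \<beta> *\<^sub>R \<kappa> \<beta>
      = (\<Sum>j<\<beta>. (fact \<beta> / fact (\<beta> - j)) *\<^sub>R Om (\<beta> - j) (\<kappa>' j) y) + fact \<beta> *\<^sub>R \<kappa>' \<beta>"
    using assms(1,2) less.prems by (simp add: decomp_def flip: sp)
  moreover have "(\<Sum>j<\<beta>. (fact \<beta> / fact (\<beta> - j)) *\<^sub>R Om (\<beta> - j) (\<kappa> j) y)
      = (\<Sum>j<\<beta>. (fact \<beta> / fact (\<beta> - j)) *\<^sub>R Om (\<beta> - j) (\<kappa>' j) y)"
    using less by (intro sum.cong) auto
  ultimately show ?case by simp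
qed

lemma decomp_determines:
  assumes "decomp y w \<kappa>" "decomp y w' \<kappa>'" "\<And>j. j \<le> k \<Longrightarrow> \<kappa> j = \<kappa>' j"
  shows "w = w'"
proof (rule vec_eqI)
  fix n assume "n \<le> k"
  then show "w $ idx n = w' $ idx n" using assms by (auto simp: decomp_def intro!: sum.cong)
qed

lemma decomp_add:
  assumes "y \<in> over T" "decomp y w \<kappa>" "decomp y w' \<kappa>'"
  shows "decomp y (w + w') (\<lambda>j. \<kappa> j + \<kappa>' j)"
  using assms(2,3) by (simp add: decomp_def linear_add[OF Om_linear[OF assms(1)]] scaleR_add_right sum.distrib)

text \<open>The link between the geometric definition of \<open>K\<close> and coordinates: the
  Leibniz expansion of the variation field of a family is precisely a solution of
  \<open>decomp\<close> for the velocity of the jets.\<close>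

lemma family_decomp:
  assumes \<gamma>: "smooth_into A S \<gamma>" "(0, 0) \<in> S" "jet_of A k (\<lambda>t. \<gamma> (0, t)) = u"
    and u: "u \<in> jet_dom U" "\<phi> (jet_proj u) \<in> T"
  obtains w \<kappa> where
    "velocity JA (\<lambda>s. jet_of A k (\<lambda>t. \<gamma> (s, t))) 0 = jtv U \<phi> u w"
    "decomp (jet_chart \<iota> \<phi> u) w \<kappa>"
    "\<And>\<alpha>. tv_scale (1 / fact \<alpha>) (((cov_deriv_along A D (\<lambda>t. \<gamma> (0, t))) ^^ \<alpha>)
                (\<lambda>t. velocity A (\<lambda>s. \<gamma> (s, t)) 0) 0) = tv (jet_proj u) (\<kappa> \<alpha>)"
proof -
  let ?q = "\<lambda>t. \<gamma> (0, t)"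
  define C where "C t = \<phi> (\<gamma> (0, t))" for t
  define v where "v t = vector_derivative (\<lambda>s. \<phi> (\<gamma> (s, t))) (at 0)" for t
  have near: "smooth_near A 0 ?q" by (rule smooth_near_slice[OF \<gamma>(1,2)])
  have p: "jet_proj u = \<gamma> (0, 0)" "\<gamma> (0, 0) \<in> U" "C 0 \<in> T"
    using jet_of_jets(2)[OF near] \<gamma>(3) u by (auto simp: jet_dom_def C_def)
  note sm = smooth_intoD[OF \<gamma>(1) U]
  let ?S' = "S \<inter> \<gamma> -` U"
  \<comment> \<open>Times at which the curve stays in the part of the chart where
    \<open>\<Gamma>\<close> describes the connection.\<close>
  define J where "J = {t. (0, t) \<in> ?S'} \<inter> C -` T"
  have J0: "open {t. (0, t) \<in> ?S'}" by (rule open_slice(1)[OF sm(2)])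
  have C0: "smooth_on {t. (0, t) \<in> ?S'} C" unfolding C_def
    by (rule smooth_on_compose[OF sm(3) smooth_on_Pair[OF J0 smooth_on_const smooth_on_id] J0 sm(2)]) auto
  have J: "open J" "0 \<in> J" unfolding J_def
    using continuous_open_preimage[OF smooth_on_continuous[OF C0] J0 open_T] p \<gamma>(2) by auto
  have C: "smooth_on J C" by (rule smooth_on_subset[OF C0]) (simp add: J_def)
  have CT: "C ` J \<subseteq> T" by (auto simp: J_def)
  have v_eq: "v t = dd (\<lambda>x. \<phi> (\<gamma> x)) (0, t) (1, 0)" if "t \<in> J" for t
    unfolding v_def
    by (rule vector_derivative_at[OF vector_derivative_fst[OF smooth_on_differentiable[OF sm(3)]]]) (use that in \<open>simp add: J_def\<close>)
  have "smooth_on J (\<lambda>t. dd (\<lambda>x. \<phi> (\<gamma> x)) (0, t) (1, 0))"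
    by (rule smooth_on_compose[OF smooth_on_dd_const[OF sm(3)] smooth_on_Pair[OF J(1) smooth_on_const smooth_on_id] J(1) sm(2)])
      (auto simp: J_def)
  then have v: "smooth_on J v" by (rule iffD1[OF smooth_on_cong[OF J(1)], rotated]) (simp add: v_eq)
  have c: "?q r \<in> U \<and> \<phi> (?q r) = C r" if "r \<in> J" for r using that by (simp add: J_def C_def)
  have V: "velocity A (\<lambda>s. \<gamma> (s, r)) 0 = tv (?q r) (v r)" if r: "r \<in> J" for r
  proof (rule velocity_chart_deriv[where c = "\<lambda>s. \<gamma> (s, r)" and t = 0, OF U _ open_slice(2)[OF sm(2), of r]])
    have r': "(0, r) \<in> ?S'" using r by (simp add: J_def)
    then show "\<gamma> (0, r) \<in> U" "0 \<in> {s. (s, r) \<in> ?S'}" by simp_all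
    show "((\<lambda>s. \<phi> (\<gamma> (s, r))) has_vector_derivative v r) (at 0)"
      using vector_derivative_fst[OF smooth_on_differentiable[OF sm(3) r']] v_eq[OF r] by simp
  qed auto
  have it: "((cov_deriv_along A D ?q) ^^ \<alpha>) (\<lambda>t. velocity A (\<lambda>s. \<gamma> (s, t)) 0) 0
      = tv (jet_proj u) ((nabla C ^^ \<alpha>) v 0)" for \<alpha>
    using cov_deriv_iterate[OF J C CT v c V] p(1) by simp
  have y: "jet_chart \<iota> \<phi> u = jcurve C 0"
    using jet_of_jets(3)[OF near U p(2)] \<gamma>(3) by (simp add: C_def[abs_def] comp_def)
  \<comment> \<open>The factor \<open>1 / fact j\<close> from the definition of \<open>K\<close>
    turns the binomial coefficient into \<open>fact \<beta> / fact (\<beta> - j)\<close>.\<close>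
  define \<kappa> where "\<kappa> j = (1 / fact j) *\<^sub>R (nabla C ^^ j) v 0" for j
  have yT: "jcurve C 0 \<in> over T" using p(3) by (simp add: jcurve_over)
  have "decomp (jet_chart \<iota> \<phi> u) (jcurve v 0) \<kappa>" unfolding decomp_def
  proof (intro allI impI)
    fix \<beta> assume \<beta>: "\<beta> \<le> k"
    have "jcurve v 0 $ idx \<beta> = (\<Sum>j\<le>\<beta>. real (\<beta> choose j) *\<^sub>R Om (\<beta> - j) ((nabla C ^^ j) v 0) (jcurve C 0))"
      using higher_vderiv_nabla[OF J(1) C CT v \<beta> J(2)] \<beta> by (simp add: jcurve_def)
    also have "\<dots> = (\<Sum>j\<le>\<beta>. (fact \<beta> / fact (\<beta> - j)) *\<^sub>R Om (\<beta> - j) (\<kappa> j) (jcurve C 0))"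
      by (rule sum.cong) (simp_all add: \<kappa>_def linear_scale[OF Om_linear[OF yT]] binomial_fact)
    finally show "jcurve v 0 $ idx \<beta> = (\<Sum>j\<le>\<beta>. (fact \<beta> / fact (\<beta> - j)) *\<^sub>R Om (\<beta> - j) (\<kappa> j) (jet_chart \<iota> \<phi> u))"
      by (simp add: y)
  qed
  moreover have "velocity JA (\<lambda>s. jet_of A k (\<lambda>t. \<gamma> (s, t))) 0 = jtv U \<phi> u (jcurve v 0)"
    using jet_family_velocity[OF \<gamma>(1,2) U p(2)] \<gamma>(3) by (simp add: v_def[abs_def])
  moreover have "tv_scale (1 / fact \<alpha>) (((cov_deriv_along A D ?q) ^^ \<alpha>) (\<lambda>t. velocity A (\<lambda>s. \<gamma> (s, t)) 0) 0)
      = tv (jet_proj u) (\<kappa> \<alpha>)" for \<alpha>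
    unfolding it using p by (simp add: \<kappa>_def chart_vec_scale[OF U])
  ultimately show thesis using that by blast
qed

text \<open>The triangular system is solved geometrically: some family of curves has velocity
  \<open>w\<close>, and its covariant derivatives are a solution.\<close>

lemma decomp_exists:
  assumes u: "u \<in> jet_dom U" "\<phi> (jet_proj u) \<in> T"
  obtains \<kappa> where "decomp (jet_chart \<iota> \<phi> u) w \<kappa>"
proof -
  obtain \<gamma> S where \<gamma>: "smooth_into A S \<gamma>" "(0, 0) \<in> S" "jet_of A k (\<lambda>t. \<gamma> (0, t)) = u"
    "velocity JA (\<lambda>s. jet_of A k (\<lambda>t. \<gamma> (s, t))) 0 = jtv U \<phi> u w"
    by (rule family_exists[OF U u(1)])
  obtain w' \<kappa> where w': "velocity JA (\<lambda>s. jet_of A k (\<lambda>t. \<gamma> (s, t))) 0 = jtv U \<phi> u w'" "decomp (jet_chart \<iota> \<phi> u) w' \<kappa>"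
    by (rule family_decomp[OF \<gamma>(1-3) u])
  then have "w' = w" using \<gamma>(4) jtv_inject[OF U u(1)] by simp
  then show thesis using that w'(2) by simp
qed

text \<open>This makes \<open>K\<close> well defined. Any two families with the same velocity yield
  solutions of the same system, which agree by \<open>decomp_unique\<close>. Level 0 is defined
  through the projection instead, and there the equation of order 0 reads
  \<open>w $ idx 0 = \<kappa> 0\<close>.\<close>

lemma Kmap_jtv:
  assumes u: "u \<in> jet_dom U" "\<phi> (jet_proj u) \<in> T" and w: "decomp (jet_chart \<iota> \<phi> u) w \<kappa>" and \<alpha>: "\<alpha> \<le> k"
  shows "Kmap A D k \<iota> \<alpha> u (jtv U \<phi> u w) = tv (jet_proj u) (\<kappa> \<alpha>)"
proof (cases "\<alpha> = 0")
  case True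
  have "w $ idx 0 = \<kappa> 0" using w by (auto simp: decomp_def)
  then show ?thesis using True pushforward_proj[OF U u(1)] by (simp add: Kmap_def)
next
  case False
  have "(THE \<xi>. \<exists>\<gamma>. smooth_near A (0::real, 0::real) \<gamma> \<and>
        jet_of A k (\<lambda>t. \<gamma> (0, t)) = u \<and>
        velocity JA (\<lambda>s. jet_of A k (\<lambda>t. \<gamma> (s, t))) 0 = jtv U \<phi> u w \<and>
        \<xi> = tv_scale (1 / fact \<alpha>)
             (((cov_deriv_along A D (\<lambda>t. \<gamma> (0, t))) ^^ \<alpha>)
                (\<lambda>t. velocity A (\<lambda>s. \<gamma> (s, t)) 0) 0)) = tv (jet_proj u) (\<kappa> \<alpha>)"
  proof (rule the_equality)
    have uniq: "tv_scale (1 / fact \<alpha>) (((cov_deriv_along A D (\<lambda>t. \<gamma> (0, t))) ^^ \<alpha>)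
                (\<lambda>t. velocity A (\<lambda>s. \<gamma> (s, t)) 0) 0) = tv (jet_proj u) (\<kappa> \<alpha>)"
      if \<gamma>: "smooth_near A (0, 0) \<gamma>" "jet_of A k (\<lambda>t. \<gamma> (0, t)) = u"
        "velocity JA (\<lambda>s. jet_of A k (\<lambda>t. \<gamma> (s, t))) 0 = jtv U \<phi> u w" for \<gamma> :: "real \<times> real \<Rightarrow> 'a"
    proof -
      obtain S where S: "smooth_into A S \<gamma>" "(0, 0) \<in> S" using \<gamma>(1) by (auto simp: smooth_near_def)
      obtain w' \<kappa>' where w': "velocity JA (\<lambda>s. jet_of A k (\<lambda>t. \<gamma> (s, t))) 0 = jtv U \<phi> u w'"
        "decomp (jet_chart \<iota> \<phi> u) w' \<kappa>'"
        "\<And>\<alpha>. tv_scale (1 / fact \<alpha>) (((cov_deriv_along A D (\<lambda>t. \<gamma> (0, t))) ^^ \<alpha>)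
                (\<lambda>t. velocity A (\<lambda>s. \<gamma> (s, t)) 0) 0) = tv (jet_proj u) (\<kappa>' \<alpha>)"
        by (rule family_decomp[OF S \<gamma>(2) u]) (rule that, assumption+)
      have "w' = w" using w'(1) \<gamma>(3) jtv_inject[OF U u(1)] by simp
      then have "\<kappa>' \<alpha> = \<kappa> \<alpha>" using decomp_unique[OF _ w \<alpha>] w'(2) by simp
      then show ?thesis using w'(3) by simp
    qed
    obtain \<gamma> S where \<gamma>: "smooth_into A S \<gamma>" "(0, 0) \<in> S" "jet_of A k (\<lambda>t. \<gamma> (0, t)) = u"
      "velocity JA (\<lambda>s. jet_of A k (\<lambda>t. \<gamma> (s, t))) 0 = jtv U \<phi> u w"
      by (rule family_exists[OF U u(1)])
    have n: "smooth_near A (0, 0) \<gamma>" using \<gamma>(1,2) by (auto simp: smooth_near_def)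
    show "\<exists>\<gamma>. smooth_near A (0::real, 0::real) \<gamma> \<and>
        jet_of A k (\<lambda>t. \<gamma> (0, t)) = u \<and>
        velocity JA (\<lambda>s. jet_of A k (\<lambda>t. \<gamma> (s, t))) 0 = jtv U \<phi> u w \<and>
        tv (jet_proj u) (\<kappa> \<alpha>) = tv_scale (1 / fact \<alpha>)
             (((cov_deriv_along A D (\<lambda>t. \<gamma> (0, t))) ^^ \<alpha>)
                (\<lambda>t. velocity A (\<lambda>s. \<gamma> (s, t)) 0) 0)"
      using n \<gamma>(3,4) uniq[OF n \<gamma>(3,4)] by (intro exI[of _ \<gamma>]) simp
    fix \<xi>
    assume "\<exists>\<gamma>. smooth_near A (0::real, 0::real) \<gamma> \<and>
        jet_of A k (\<lambda>t. \<gamma> (0, t)) = u \<and>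
        velocity JA (\<lambda>s. jet_of A k (\<lambda>t. \<gamma> (s, t))) 0 = jtv U \<phi> u w \<and>
        \<xi> = tv_scale (1 / fact \<alpha>)
             (((cov_deriv_along A D (\<lambda>t. \<gamma> (0, t))) ^^ \<alpha>)
                (\<lambda>t. velocity A (\<lambda>s. \<gamma> (s, t)) 0) 0)"
    then show "\<xi> = tv (jet_proj u) (\<kappa> \<alpha>)" using uniq by blast
  qed
  then show ?thesis using False by (simp add: Kmap_def)
qed

end

section \<open>Lifts, brackets and the Koszul formula\<close>

context jet_frame
begin

text \<open>The right-hand side of \<open>decomp\<close> when \<open>\<xi>\<close> at level
  \<open>\<alpha>\<close> is the only nonzero entry. For \<open>\<alpha> = k\<close> it reduces to
  \<open>fact k *\<^sub>R \<xi>\<close> in the top slot.\<close>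

definition lift_components :: "nat \<Rightarrow> 'e \<Rightarrow> 'e ^ 'i \<Rightarrow> 'e ^ 'i" where
  "lift_components \<alpha> \<xi> y = (\<chi> i. if \<alpha> \<le> \<iota> i then (fact (\<iota> i) / fact (\<iota> i - \<alpha>)) *\<^sub>R Om (\<iota> i - \<alpha>) \<xi> y else 0)"

lemma lift_components_idx:
  "n \<le> k \<Longrightarrow> lift_components \<alpha> \<xi> y $ idx n = (if \<alpha> \<le> n then (fact n / fact (n - \<alpha>)) *\<^sub>R Om (n - \<alpha>) \<xi> y else 0)"
  by (simp add: lift_components_def)

lemma decomp_lift_components:
  assumes y: "y \<in> over T"
  shows "decomp y (lift_components \<alpha> \<xi> y) (\<lambda>j. if j = \<alpha> then \<xi> else 0)"
  unfolding decomp_def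
proof (intro allI impI)
  fix \<beta> assume \<beta>: "\<beta> \<le> k"
  have "(\<Sum>j\<le>\<beta>. (fact \<beta> / fact (\<beta> - j)) *\<^sub>R Om (\<beta> - j) (if j = \<alpha> then \<xi> else 0) y)
      = (\<Sum>j\<le>\<beta>. if j = \<alpha> then (fact \<beta> / fact (\<beta> - \<alpha>)) *\<^sub>R Om (\<beta> - \<alpha>) \<xi> y else 0)"
    by (rule sum.cong) (simp_all add: linear_0[OF Om_linear[OF y]])
  also have "\<dots> = lift_components \<alpha> \<xi> y $ idx \<beta>"
    by (simp add: lift_components_idx[OF \<beta>] sum.delta)
  finally show "lift_components \<alpha> \<xi> y $ idx \<beta>
    = (\<Sum>j\<le>\<beta>. (fact \<beta> / fact (\<beta> - j)) *\<^sub>R Om (\<beta> - j) (if j = \<alpha> then \<xi> else 0) y)" by (rule sym)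
qed

lemma chart_over_T: "u \<in> jet_dom U \<Longrightarrow> \<phi> (jet_proj u) \<in> T \<Longrightarrow> jet_chart \<iota> \<phi> u \<in> over T"
  by (simp add: over_def jet_dom_def jet_chart_0)

lemma over_T_chart:
  assumes "y \<in> over T"
  shows "inv_into (jet_dom U) (jet_chart \<iota> \<phi>) y \<in> jet_dom U"
    "jet_chart \<iota> \<phi> (inv_into (jet_dom U) (jet_chart \<iota> \<phi>) y) = y"
    "\<phi> (jet_proj (inv_into (jet_dom U) (jet_chart \<iota> \<phi>) y)) = y $ idx 0"
    "y \<in> over (\<phi> ` U)"
proof -
  have y: "y $ idx 0 \<in> \<phi> ` U" using assms T_sub by (auto simp: over_def)
  then show y': "y \<in> over (\<phi> ` U)" by (simp add: over_def)
  show "inv_into (jet_dom U) (jet_chart \<iota> \<phi>) y \<in> jet_dom U"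
    "jet_chart \<iota> \<phi> (inv_into (jet_dom U) (jet_chart \<iota> \<phi>) y) = y"
    by (rule jet_chart_inv[OF U y'])+
  show "\<phi> (jet_proj (inv_into (jet_dom U) (jet_chart \<iota> \<phi>) y)) = y $ idx 0"
    unfolding jet_chart_inv(3)[OF U y'] by (rule chart_inv(1)[OF y])
qed

lemma jet_tangentE:
  assumes "W \<in> tangent_space JA u" "u \<in> jet_dom U"
  obtains w where "W = jtv U \<phi> u w"
  by (rule J.tangent_spaceE[OF assms(1) jet_atlasI[OF U] assms(2)]) (rule that)

lemma jtv_tangent: "u \<in> jet_dom U \<Longrightarrow> jtv U \<phi> u w \<in> tangent_space JA u"
  by (rule J.chart_vec_in_tangent_space[OF jet_atlasI[OF U]])

lemma jet_domD: "u \<in> jet_dom U \<Longrightarrow> jet_proj u \<in> U" "u \<in> jet_dom U \<Longrightarrow> u \<in> jets A k"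
  by (auto simp: jet_dom_def)

lemma Kmap_tangent:
  assumes u: "u \<in> jet_dom U" "\<phi> (jet_proj u) \<in> T" and W: "W \<in> tangent_space JA u" "W' \<in> tangent_space JA u"
  shows "\<alpha> \<le> k \<Longrightarrow> Kmap A D k \<iota> \<alpha> u W \<in> tangent_space A (jet_proj u)"
    and "\<alpha> \<le> k \<Longrightarrow> Kmap A D k \<iota> \<alpha> u (tv_add W W') = tv_add (Kmap A D k \<iota> \<alpha> u W) (Kmap A D k \<iota> \<alpha> u W')"
    and "(\<And>\<beta>. \<beta> \<le> k \<Longrightarrow> Kmap A D k \<iota> \<beta> u W = Kmap A D k \<iota> \<beta> u W') \<Longrightarrow> W = W'"
proof -
  note p = jet_domD(1)[OF u(1)]
  obtain w where w: "W = jtv U \<phi> u w" by (rule jet_tangentE[OF W(1) u(1)])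
  obtain w' where w': "W' = jtv U \<phi> u w'" by (rule jet_tangentE[OF W(2) u(1)])
  obtain \<kappa> where \<kappa>: "decomp (jet_chart \<iota> \<phi> u) w \<kappa>" by (rule decomp_exists[OF u])
  obtain \<kappa>' where \<kappa>': "decomp (jet_chart \<iota> \<phi> u) w' \<kappa>'" by (rule decomp_exists[OF u])
  note K = Kmap_jtv[OF u \<kappa>] Kmap_jtv[OF u \<kappa>']
  show "Kmap A D k \<iota> \<alpha> u W \<in> tangent_space A (jet_proj u)" if "\<alpha> \<le> k"
    unfolding w K(1)[OF that] by (rule chart_vec_in_tangent_space[OF U p])
  show "Kmap A D k \<iota> \<alpha> u (tv_add W W') = tv_add (Kmap A D k \<iota> \<alpha> u W) (Kmap A D k \<iota> \<alpha> u W')" if \<alpha>: "\<alpha> \<le> k"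
  proof -
    have "tv_add W W' = jtv U \<phi> u (w + w')"
      unfolding w w' by (rule J.chart_vec_add[OF jet_atlasI[OF U] u(1), symmetric])
    then have "Kmap A D k \<iota> \<alpha> u (tv_add W W') = tv (jet_proj u) (\<kappa> \<alpha> + \<kappa>' \<alpha>)"
      using Kmap_jtv[OF u decomp_add[OF chart_over_T[OF u] \<kappa> \<kappa>'] \<alpha>] by simp
    then show ?thesis unfolding w w' K(1)[OF \<alpha>] K(2)[OF \<alpha>] chart_vec_add[OF U p] .
  qed
  show "W = W'" if "\<And>\<beta>. \<beta> \<le> k \<Longrightarrow> Kmap A D k \<iota> \<beta> u W = Kmap A D k \<iota> \<beta> u W'"
  proof -
    have "\<kappa> j = \<kappa>' j" if "j \<le> k" for j
      using \<open>\<And>\<beta>. \<beta> \<le> k \<Longrightarrow> Kmap A D k \<iota> \<beta> u W = Kmap A D k \<iota> \<beta> u W'\<close>[OF that] K(1)[OF that] K(2)[OF that]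
        chart_vec_inject[OF U p] by (simp add: w w')
    then show ?thesis using decomp_determines[OF \<kappa> \<kappa>'] w w' by simp
  qed
qed

lemma Kmap_lift_components:
  assumes u: "u \<in> jet_dom U" "\<phi> (jet_proj u) \<in> T" and "\<beta> \<le> k"
  shows "Kmap A D k \<iota> \<beta> u (jtv U \<phi> u (lift_components \<alpha> \<xi> (jet_chart \<iota> \<phi> u)))
    = (if \<beta> = \<alpha> then tv (jet_proj u) \<xi> else tv_zero)"
  using Kmap_jtv[OF u decomp_lift_components[OF chart_over_T[OF u]] assms(3)]
  by (simp add: chart_vec_0[OF U jet_domD(1)[OF u(1)]])

lemma smooth_on_lift_components:
  assumes X: "X \<in> vector_fields A"
  shows "smooth_on (over T) (\<lambda>y. lift_components \<alpha> (comps X (y $ idx 0)) y)"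
proof -
  have o: "open (over T)" by (rule open_over[OF open_T])
  have cX: "smooth_on (over T) (\<lambda>y. comps X (y $ idx 0))"
    by (intro smooth_on_compose[OF smooth_on_components[OF X U]] smooth_on_vec_nth smooth_on_id o chart_open[OF U])
      (use T_sub in \<open>auto simp: over_def\<close>)
  \<comment> \<open>The vector argument varies with the base point, while \<open>Om_smooth\<close>
    has it fixed; linearity reduces it to the basis.\<close>
  have Om: "smooth_on (over T) (\<lambda>y. Om j (comps X (y $ idx 0)) y)" for j
  proof -
    have "smooth_on (over T) (\<lambda>y. \<Sum>b\<in>Basis. (comps X (y $ idx 0) \<bullet> b) *\<^sub>R Om j b y)"
      by (intro smooth_on_sum smooth_on_scaleR smooth_on_inner cX smooth_on_const o) (rule Om_smooth)
    then show ?thesis by (rule iffD2[OF smooth_on_cong[OF o Om_expand], rotated])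
  qed
  have "smooth_on (over T) (\<lambda>y. if \<alpha> \<le> \<iota> i then (fact (\<iota> i) / fact (\<iota> i - \<alpha>)) *\<^sub>R Om (\<iota> i - \<alpha>) (comps X (y $ idx 0)) y else 0)" for i
    by (cases "\<alpha> \<le> \<iota> i") (auto intro!: smooth_on_scaleR o Om)
  then show ?thesis unfolding lift_components_def[abs_def] by (rule smooth_on_vec_lambda[OF o])
qed

text \<open>In coordinates, the bracket of the lifts only involves the dependence of the components
  of \<open>P\<close> on the top-order coordinate, which is given by \<open>\<Gamma>\<close> if \<open>\<alpha> = 0\<close> and is absent otherwise.\<close>

lemma bracket_lift_components:
  assumes \<alpha>: "\<alpha> \<le> k" and X: "X \<in> vector_fields A" and Y: "Y \<in> vector_fields A"
    and P: "P \<in> vector_fields JA" and Q: "Q \<in> vector_fields JA"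
    and P_eq: "\<And>u. u \<in> jet_dom U \<Longrightarrow> \<phi> (jet_proj u) \<in> T \<Longrightarrow>
      P u = jtv U \<phi> u (lift_components \<alpha> (comps X (jet_chart \<iota> \<phi> u $ idx 0)) (jet_chart \<iota> \<phi> u))"
    and Q_eq: "\<And>u. u \<in> jet_dom U \<Longrightarrow> \<phi> (jet_proj u) \<in> T \<Longrightarrow>
      Q u = jtv U \<phi> u (lift_components k (comps Y (jet_chart \<iota> \<phi> u $ idx 0)) (jet_chart \<iota> \<phi> u))"
    and u: "u \<in> jet_dom U" "\<phi> (jet_proj u) \<in> T"
    and B: "lie_bracket P Q u \<in> tangent_space JA u"
  shows "lie_bracket P Q u = (if \<alpha> = 0
    then jtv U \<phi> u (lift_components k (dd (comps Y) (\<phi> (jet_proj u)) (comps X (\<phi> (jet_proj u)))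
      + \<Gamma> (\<phi> (jet_proj u)) (comps X (\<phi> (jet_proj u))) (comps Y (\<phi> (jet_proj u)))) (jet_chart \<iota> \<phi> u))
    else tv_zero)"
proof -
  note p = jet_domD(1)[OF u(1)]
  define y where "y = jet_chart \<iota> \<phi> u"
  define z where "z = \<phi> (jet_proj u)"
  have y0: "y $ idx 0 = z" unfolding y_def z_def by (rule jet_chart_0[OF jet_domD(2)[OF u(1)]])
  have y: "y \<in> over T" unfolding y_def by (rule chart_over_T[OF u])
  have zT: "z \<in> T" using u by (simp add: z_def)
  let ?X = "comps X" and ?Y = "comps Y"
  let ?lP = "\<lambda>y. lift_components \<alpha> (?X (y $ idx 0)) y" and ?lQ = "\<lambda>y. lift_components k (?Y (y $ idx 0)) y"
  obtain x r where x: "r > 0" "\<And>b. x b \<in> smooth_fun A"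
    "\<And>n b u' w. n \<le> k \<Longrightarrow> u' \<in> jet_dom U \<Longrightarrow> \<phi> (jet_proj u') \<in> ball (\<phi> (jet_proj u)) r \<Longrightarrow>
      jtv U \<phi> u' w (jet_fun n (x b)) = w $ idx n \<bullet> b"
    by (rule jet_coordinates[OF U p]) (rule that, assumption+)
  note x = x[folded z_def]
  let ?T = "T \<inter> ball z r"
  have T': "open ?T" "z \<in> ?T" using open_T zT x(1) by auto
  then have T': "open ?T" "z \<in> ?T" "open (over ?T)" "y \<in> over ?T"
    using open_over[of ?T] y0 by (simp_all add: over_def)
  \<comment> \<open>By assumption \<open>B\<close> the bracket is a tangent vector at
    \<open>u\<close>, so it is determined by its values on the functions
    \<open>jet_fun n (x b)\<close>.\<close>
  obtain w where w: "lie_bracket P Q u = jtv U \<phi> u w" by (rule jet_tangentE[OF B u(1)])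
  have deriv: "jtv U \<phi> u h (\<lambda>u'. R u' (jet_fun n (x b))) = dd (\<lambda>y. l y $ idx n \<bullet> b) y h"
    if n: "n \<le> k" and R: "R \<in> vector_fields JA"
      and R_eq: "\<And>u. u \<in> jet_dom U \<Longrightarrow> \<phi> (jet_proj u) \<in> T \<Longrightarrow> R u = jtv U \<phi> u (l (jet_chart \<iota> \<phi> u))" for R l n b h
  proof -
    have "dd ((\<lambda>u'. R u' (jet_fun n (x b))) \<circ> inv_into (jet_dom U) (jet_chart \<iota> \<phi>)) y = dd (\<lambda>y. l y $ idx n \<bullet> b) y"
    proof (rule dd_cong(1)[OF T'(3,4)])
      fix y' assume y': "y' \<in> over ?T"
      then have "y' \<in> over T" by (simp add: over_def)
      note i = over_T_chart[OF this]
      have "\<phi> (jet_proj (inv_into (jet_dom U) (jet_chart \<iota> \<phi>) y')) \<in> T \<inter> ball z r"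
        using y' unfolding i(3) by (simp add: over_def)
      then show "((\<lambda>u'. R u' (jet_fun n (x b))) \<circ> inv_into (jet_dom U) (jet_chart \<iota> \<phi>)) y' = l y' $ idx n \<bullet> b"
        using R_eq[OF i(1)] x(3)[OF n i(1)] i(2) by simp
    qed
    then show ?thesis using J.vector_field_smooth[OF R] by (simp add: chart_vec_def y_def)
  qed
  have w_eq: "w $ idx n \<bullet> b = dd (\<lambda>y. ?lQ y $ idx n \<bullet> b) y (?lP y) - dd (\<lambda>y. ?lP y $ idx n \<bullet> b) y (?lQ y)"
    if n: "n \<le> k" for n b
  proof -
    have "w $ idx n \<bullet> b = lie_bracket P Q u (jet_fun n (x b))"
      using x(3)[OF n u(1)] T'(2) by (simp add: w z_def)
    also have "\<dots> = P u (\<lambda>u'. Q u' (jet_fun n (x b))) - Q u (\<lambda>u'. P u' (jet_fun n (x b)))"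
      by (simp add: lie_bracket_def)
    also have "P u (\<lambda>u'. Q u' (jet_fun n (x b))) = dd (\<lambda>y. ?lQ y $ idx n \<bullet> b) y (?lP y)"
      unfolding P_eq[OF u] y_def[symmetric] by (rule deriv[OF n Q]) (rule Q_eq)
    also have "Q u (\<lambda>u'. P u' (jet_fun n (x b))) = dd (\<lambda>y. ?lP y $ idx n \<bullet> b) y (?lQ y)"
      unfolding Q_eq[OF u] y_def[symmetric] by (rule deriv[OF n P]) (rule P_eq)
    finally show ?thesis .
  qed
  have lQ: "?lQ y' $ idx n = (if n = k then fact k *\<^sub>R ?Y (y' $ idx 0) else 0)" if "n \<le> k" for n y'
    using that by (simp add: lift_components_idx)
  have ne: "idx 0 \<noteq> idx k" using k_pos by (metis \<iota>_idx le0 order_refl not_one_le_zero)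
  \<comment> \<open>The top lift points along the coordinate of order \<open>k\<close>, with factor
    \<open>k!\<close> from the normalisation of \<open>K\<close>.\<close>
  have lQ_axis: "?lQ y = axis (idx k) (fact k *\<^sub>R ?Y z)"
  proof (rule vec_eqI)
    fix n assume n: "n \<le> k"
    then have "idx n = idx k \<longleftrightarrow> n = k" by (metis \<iota>_idx order_refl)
    then show "?lQ y $ idx n = axis (idx k) (fact k *\<^sub>R ?Y z) $ idx n"
      unfolding lQ[OF n] by (simp add: axis_def y0)
  qed
  have lP0: "?lP y $ idx 0 = (if \<alpha> = 0 then ?X z else 0)"
    by (simp add: lift_components_idx y0)
  \<comment> \<open>The only component of the top lift depends on the base point alone, so its
    derivative along \<open>P\<close> sees just the order 0 entry of \<open>P\<close>, which is
    nonzero only for a lift of level 0.\<close>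
  have first: "dd (\<lambda>y. ?lQ y $ idx n \<bullet> b) y (?lP y)
      = (if n = k \<and> \<alpha> = 0 then fact k * (dd ?Y z (?X z) \<bullet> b) else 0)" if n: "n \<le> k" for n b
  proof (cases "n = k")
    case False
    then show ?thesis by (simp add: lQ[OF n])
  next
    case True
    have dY: "?Y differentiable (at (y $ idx 0))"
      by (rule smooth_on_differentiable[OF smooth_on_components[OF Y U]]) (use y0 zT T_sub in auto)
    have nth: "((\<lambda>y :: 'e ^ 'i. y $ idx 0) has_derivative (\<lambda>h. h $ idx 0)) (at y)"
      by (rule bounded_linear_imp_has_derivative[OF bounded_linear_vec_nth])
    have "((\<lambda>y. (fact k *\<^sub>R ?Y (y $ idx 0)) \<bullet> b) has_derivative (\<lambda>h. (fact k *\<^sub>R dd ?Y z (h $ idx 0)) \<bullet> b)) (at y)"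
      using has_derivative_compose[OF nth dd_has_derivative[OF dY]] unfolding y0
      by (intro has_derivative_inner_left has_derivative_scaleR_right)
    from dd_eq[OF this] have "dd (\<lambda>y. ?lQ y $ idx n \<bullet> b) y (?lP y) = fact k * (dd ?Y z (?lP y $ idx 0) \<bullet> b)"
      unfolding lQ[OF n] using True by simp
    then show ?thesis using True linear_0[OF dd_linear[OF dY]] by (simp add: lP0[unfolded y0] y0)
  qed
  \<comment> \<open>Differentiation along \<open>Q\<close> is differentiation in the coordinate of
    order \<open>k\<close>. The component of \<open>P\<close> in order \<open>n\<close> has order at
    most \<open>n - \<alpha>\<close>, so a contribution arises only for \<open>n = k\<close> and
    \<open>\<alpha> = 0\<close>, where \<open>Om_affine\<close> gives the slope.\<close>
  have second: "dd (\<lambda>y. ?lP y $ idx n \<bullet> b) y (?lQ y)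
      = (if n = k \<and> \<alpha> = 0 then - fact k * (\<Gamma> z (?Y z) (?X z) \<bullet> b) else 0)" if n: "n \<le> k" for n b
  proof -
    let ?F = "\<lambda>y. ?lP y $ idx n \<bullet> b" and ?a = "axis (idx k) (fact k *\<^sub>R ?Y z) :: 'e ^ 'i"
    have "smooth_on (over T) ?F"
      by (intro smooth_on_bounded_linear[OF bounded_linear_inner_left] smooth_on_vec_nth smooth_on_lift_components X open_over open_T)
    then have dF: "?F differentiable (at y)" using y by (rule smooth_on_differentiable)
    have d: "((\<lambda>s. ?F (y + s *\<^sub>R ?a)) has_real_derivative dd ?F y ?a) (at 0)"
      using dd_line[of ?F y 0 ?a] dF by simp
    have yk: "(y + s *\<^sub>R ?a) $ idx 0 = z" for s using ne y0 by (simp add: axis_def)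
    have ax: "s *\<^sub>R ?a = axis (idx k) ((s * fact k) *\<^sub>R ?Y z)" for s by (simp add: vec_eq_iff axis_def)
    show ?thesis
    proof (cases "n = k \<and> \<alpha> = 0")
      case True
      have "?F (y + s *\<^sub>R ?a) = Om k (?X z) y \<bullet> b - s * (fact k * (\<Gamma> z (?Y z) (?X z) \<bullet> b))" for s
        using Om_affine[OF k_pos order_refl y, of "?X z" "(s * fact k) *\<^sub>R ?Y z"] True yk[of s]
        by (simp add: lift_components_idx ax y0 linear_scale[OF \<Gamma>_linear(2)] inner_diff_left)
      then have "((\<lambda>s. Om k (?X z) y \<bullet> b - s * (fact k * (\<Gamma> z (?Y z) (?X z) \<bullet> b))) has_real_derivative dd ?F y ?a) (at 0)"
        using d by simp
      moreover have "((\<lambda>s. Om k (?X z) y \<bullet> b - s * (fact k * (\<Gamma> z (?Y z) (?X z) \<bullet> b))) has_real_derivative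
          - (fact k * (\<Gamma> z (?Y z) (?X z) \<bullet> b))) (at 0)"
        by (auto intro!: derivative_eq_intros)
      ultimately have "dd ?F y ?a = - (fact k * (\<Gamma> z (?Y z) (?X z) \<bullet> b))" by (rule DERIV_unique)
      then show ?thesis using True by (simp add: lQ_axis)
    next
      case False
      have "?F (y + s *\<^sub>R ?a) = ?F y" for s
      proof (cases "\<alpha> \<le> n")
        case True
        then have m: "n - \<alpha> < k" using False n \<alpha> by linarith
        have "Om (n - \<alpha>) (?X z) (y + s *\<^sub>R ?a) = Om (n - \<alpha>) (?X z) y"
        proof (rule dependsD[OF Om_depends y, symmetric])
          fix i assume "\<iota> i \<le> n - \<alpha>"
          then have "i \<noteq> idx k" using m by auto
          then show "y $ i = (y + s *\<^sub>R ?a) $ i" by (simp add: axis_def)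
        qed (use m in simp)
        then show ?thesis using True n yk[of s] y0 by (simp only: lift_components_idx)
      qed (use n in \<open>simp add: lift_components_idx\<close>)
      then have "((\<lambda>s. ?F y) has_real_derivative dd ?F y ?a) (at 0)" using d by simp
      then have "dd ?F y ?a = 0" using DERIV_unique DERIV_const by blast
      then show ?thesis using False by (simp only: lQ_axis if_False)
    qed
  qed
  \<comment> \<open>Subtracting the second derivative turns its sign around, and the symmetry of
    \<open>\<Gamma>\<close> exchanges its arguments; what results is the coordinate form of the
    covariant derivative of \<open>Y\<close> along \<open>X\<close>.\<close>
  let ?v = "dd ?Y z (?X z) + \<Gamma> z (?X z) (?Y z)"
  have "w = (if \<alpha> = 0 then lift_components k ?v y else 0)"
  proof (rule vec_eqI, rule euclidean_eqI)
    fix n b assume n: "n \<le> k"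
    show "w $ idx n \<bullet> b = (if \<alpha> = 0 then lift_components k ?v y else 0) $ idx n \<bullet> b"
      unfolding w_eq[OF n] first[OF n] second[OF n] using n \<Gamma>_symmetric[OF zT, of "?Y z" "?X z"]
      by (auto simp: lift_components_idx inner_add_left algebra_simps)
  qed
  then show ?thesis unfolding w by (simp add: J.chart_vec_0[OF jet_atlasI[OF U] u(1)] y_def z_def)
qed

end

section \<open>Global lifts and the Levi-Civita connection of the Sasaki metric\<close>

locale jet_connection = jet_manifold A k \<iota>
  for A :: "('a, 'e::euclidean_space) atlas" and k :: nat and \<iota> :: "'i::finite \<Rightarrow> nat" +
  fixes g :: "'a metric_field" and D :: "'a conn"
  assumes LC: "levi_civita A g D" and metric: "riemannian_metric A g" and k_pos: "k \<ge> 1"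
begin

abbreviation "K \<equiv> Kmap A D k \<iota>"
abbreviation "L \<equiv> lift A D k \<iota>"
abbreviation "G \<equiv> sasaki A g D k \<iota>"

lemma D_closed: "X \<in> vector_fields A \<Longrightarrow> Y \<in> vector_fields A \<Longrightarrow> D X Y \<in> vector_fields A"
  using affine_connectionD(1)[of A D] LC by (simp add: levi_civita_def)

lemma jet_frame_chart:
  assumes "(U, \<phi>) \<in> A" "u \<in> jet_dom U"
  obtains T \<Gamma> E where "jet_frame A D U \<phi> T \<Gamma> E k \<iota>" "\<phi> (jet_proj u) \<in> T"
proof -
  have p: "jet_proj u \<in> U" using assms(2) by (simp add: jet_dom_def)
  obtain T \<Gamma> E where F: "frame A D U \<phi> T \<Gamma> E" "\<phi> (jet_proj u) \<in> T" by (rule frame_exists[OF LC assms(1) p])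
  then have "jet_frame A D U \<phi> T \<Gamma> E k \<iota>"
    using jet_index_axioms k_pos by (simp add: jet_frame_def jet_frame_axioms_def)
  then show thesis using that F(2) by blast
qed

lemma jet_frame_at:
  assumes "u \<in> jets A k"
  obtains U \<phi> T \<Gamma> E where "jet_frame A D U \<phi> T \<Gamma> E k \<iota>" "u \<in> jet_dom U" "\<phi> (jet_proj u) \<in> T"
proof -
  obtain U \<phi> where U: "(U, \<phi>) \<in> A" "jet_proj u \<in> U" by (rule carrE[OF jets_rep(4)[OF assms]])
  then have u: "u \<in> jet_dom U" using assms by (simp add: jet_dom_def)
  show thesis by (rule jet_frame_chart[OF U(1) u]) (rule that[OF _ u])
qed

lemma K_tangent:
  assumes u: "u \<in> jets A k" and W: "W \<in> tangent_space JA u" "W' \<in> tangent_space JA u"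
  shows "\<alpha> \<le> k \<Longrightarrow> K \<alpha> u W \<in> tangent_space A (jet_proj u)"
    and "\<alpha> \<le> k \<Longrightarrow> K \<alpha> u (tv_add W W') = tv_add (K \<alpha> u W) (K \<alpha> u W')"
    and "(\<And>\<beta>. \<beta> \<le> k \<Longrightarrow> K \<beta> u W = K \<beta> u W') \<Longrightarrow> W = W'"
proof -
  obtain U \<phi> T \<Gamma> E where F: "jet_frame A D U \<phi> T \<Gamma> E k \<iota>" "u \<in> jet_dom U" "\<phi> (jet_proj u) \<in> T"
    by (rule jet_frame_at[OF u])
  note KT = jet_frame.Kmap_tangent[OF F W]
  show "\<alpha> \<le> k \<Longrightarrow> K \<alpha> u W \<in> tangent_space A (jet_proj u)" by (rule KT(1))
  show "\<alpha> \<le> k \<Longrightarrow> K \<alpha> u (tv_add W W') = tv_add (K \<alpha> u W) (K \<alpha> u W')" by (rule KT(2))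
  show "(\<And>\<beta>. \<beta> \<le> k \<Longrightarrow> K \<beta> u W = K \<beta> u W') \<Longrightarrow> W = W'" by (rule KT(3))
qed

text \<open>The condition in \<open>lift\<close> at a single jet, where joint injectivity of
  \<open>K\<close> gives uniqueness and a frame gives a formula.\<close>

definition is_lift :: "nat \<Rightarrow> 'a vfield \<Rightarrow> 'a jet \<Rightarrow> 'a jet tvec \<Rightarrow> bool" where
  "is_lift \<alpha> X u W \<longleftrightarrow> W \<in> tangent_space JA u \<and> K \<alpha> u W = X (jet_proj u) \<and>
    (\<forall>\<beta>\<le>k. \<beta> \<noteq> \<alpha> \<longrightarrow> K \<beta> u W = tv_zero)"

lemma is_lift_unique:
  assumes "u \<in> jets A k" "is_lift \<alpha> X u W" "is_lift \<alpha> X u W'"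
  shows "W = W'"
  using assms by (intro K_tangent(3)[of u W W']) (auto simp: is_lift_def, metis)

lemma is_lift_frame:
  assumes F: "jet_frame A D U \<phi> T \<Gamma> E k \<iota>" and u: "u \<in> jet_dom U" "\<phi> (jet_proj u) \<in> T"
    and \<alpha>: "\<alpha> \<le> k" and X: "X \<in> vector_fields A"
  shows "is_lift \<alpha> X u (jtv U \<phi> u (jet_frame.lift_components \<Gamma> k \<iota> \<alpha>
    (components A U \<phi> X (jet_chart \<iota> \<phi> u $ idx 0)) (jet_chart \<iota> \<phi> u)))"
proof -
  interpret F: jet_frame A D U \<phi> T \<Gamma> E k \<iota> by (rule F)
  have "X (jet_proj u) = chart_vec A U \<phi> (jet_proj u) (components A U \<phi> X (jet_chart \<iota> \<phi> u $ idx 0))"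
    unfolding jet_chart_0[OF F.jet_domD(2)[OF u(1)]] by (rule components[OF X F.U F.jet_domD(1)[OF u(1)]])
  then show ?thesis
    unfolding is_lift_def using F.Kmap_lift_components[OF u] F.jtv_tangent[OF u(1)] \<alpha> by simp
qed

text \<open>The pointwise lifts are unique, so the local formulas of different frames fit together;
  smoothness is then read off from \<open>lift_components\<close> in one frame per point.\<close>

lemma lift_exists:
  assumes \<alpha>: "\<alpha> \<le> k" and X: "X \<in> vector_fields A"
  obtains V where "V \<in> vector_fields JA" "\<And>u. u \<in> jets A k \<Longrightarrow> is_lift \<alpha> X u (V u)"
proof -
  define V where "V u = (if u \<in> jets A k then (THE W. is_lift \<alpha> X u W) else tv_zero)" for u
  have V_eq: "V u = W" if "u \<in> jets A k" "is_lift \<alpha> X u W" for u W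
    using that is_lift_unique by (auto simp: V_def)
  have V_lift: "is_lift \<alpha> X u (V u)" if u: "u \<in> jets A k" for u
  proof -
    obtain U \<phi> T \<Gamma> E where F: "jet_frame A D U \<phi> T \<Gamma> E k \<iota>" "u \<in> jet_dom U" "\<phi> (jet_proj u) \<in> T"
      by (rule jet_frame_at[OF u])
    show ?thesis using is_lift_frame[OF F \<alpha> X] V_eq[OF u] by metis
  qed
  have "(\<lambda>u. V u f) \<in> smooth_fun JA" if f: "f \<in> smooth_fun JA" for f
  proof (rule J.smooth_fun_localI)
    fix u assume "u \<in> carr JA"
    then have u: "u \<in> jets A k" by (simp add: carr_jets)
    obtain U \<phi> T \<Gamma> E where F: "jet_frame A D U \<phi> T \<Gamma> E k \<iota>" "u \<in> jet_dom U" "\<phi> (jet_proj u) \<in> T"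
      by (rule jet_frame_at[OF u])
    interpret F: jet_frame A D U \<phi> T \<Gamma> E k \<iota> by (rule F)
    let ?inv = "inv_into (jet_dom U) (jet_chart \<iota> \<phi>)"
    let ?l = "\<lambda>y. F.lift_components \<alpha> (components A U \<phi> X (y $ idx 0)) y"
    have o: "open (over T)" by (rule open_over[OF F.open_T])
    have sub: "over T \<subseteq> over (\<phi> ` U)" using F.over_T_chart(4) by blast
    have "smooth_on (over T) (f \<circ> ?inv)"
      by (rule smooth_on_subset[OF _ sub])
        (use J.smooth_funD[OF f jet_atlasI[OF F.U]] in \<open>simp add: jet_chart_image[OF F.U order_refl]\<close>)
    then have "smooth_on (over T) (\<lambda>y. dd (f \<circ> ?inv) y (?l y))"
      by (rule smooth_on_dd[OF o _ F.smooth_on_lift_components[OF X]])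
    moreover have "dd (f \<circ> ?inv) y (?l y) = ((\<lambda>u. V u f) \<circ> ?inv) y" if y: "y \<in> over T" for y
    proof -
      note i = F.over_T_chart[OF y]
      have "\<phi> (jet_proj (?inv y)) \<in> T" using y unfolding i(3) by (simp add: over_def)
      then have "V (?inv y) = jtv U \<phi> (?inv y) (?l y)"
        using V_eq[OF F.jet_domD(2)[OF i(1)] is_lift_frame[OF F(1) i(1) _ \<alpha> X]] i(2) by simp
      then show ?thesis using f i(2) by (simp add: chart_vec_def)
    qed
    ultimately have "smooth_on (over T) ((\<lambda>u. V u f) \<circ> ?inv)"
      by (rule iffD1[OF smooth_on_cong[OF o], rotated])
    then show "\<exists>W \<Phi> S. (W, \<Phi>) \<in> JA \<and> u \<in> W \<and> open S \<and> \<Phi> u \<in> S \<and> S \<subseteq> \<Phi> ` W \<and> smooth_on S ((\<lambda>u. V u f) \<circ> inv_into W \<Phi>)"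
      using jet_atlasI[OF F.U] F(2) o F.chart_over_T[OF F(2,3)] sub jet_chart_image[OF F.U order_refl] by metis
  qed
  then have "V \<in> vector_fields JA"
    using V_lift by (auto simp: vector_fields_def carr_jets is_lift_def) (simp add: V_def)
  then show thesis using that V_lift by blast
qed

lemma L_props:
  assumes \<alpha>: "\<alpha> \<le> k" and X: "X \<in> vector_fields A"
  shows "L \<alpha> X \<in> vector_fields JA" "u \<in> jets A k \<Longrightarrow> is_lift \<alpha> X u (L \<alpha> X u)"
proof -
  obtain V where V: "V \<in> vector_fields JA" "\<And>u. u \<in> jets A k \<Longrightarrow> is_lift \<alpha> X u (V u)"
    by (rule lift_exists[OF assms]) (rule that, assumption+)
  have "L \<alpha> X = V" unfolding lift_def
  proof (rule the_equality)
    show "V \<in> vector_fields JA \<and> (\<forall>u\<in>jets A k. K \<alpha> u (V u) = X (jet_proj u) \<and> (\<forall>\<beta>\<le>k. \<beta> \<noteq> \<alpha> \<longrightarrow> K \<beta> u (V u) = tv_zero))"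
      using V by (auto simp: is_lift_def)
    fix V' assume V': "V' \<in> vector_fields JA \<and> (\<forall>u\<in>jets A k. K \<alpha> u (V' u) = X (jet_proj u) \<and> (\<forall>\<beta>\<le>k. \<beta> \<noteq> \<alpha> \<longrightarrow> K \<beta> u (V' u) = tv_zero))"
    show "V' = V"
    proof
      fix u
      show "V' u = V u"
      proof (cases "u \<in> jets A k")
        case True
        have "is_lift \<alpha> X u (V' u)" using V' True J.vector_fieldD(1)[of V' u] by (simp add: is_lift_def carr_jets)
        then show ?thesis using is_lift_unique[OF True _ V(2)[OF True]] by simp
      next
        case False
        then show ?thesis using V V' J.vector_fieldD(2) by (simp add: carr_jets)
      qed
    qed
  qed
  then show "L \<alpha> X \<in> vector_fields JA" "u \<in> jets A k \<Longrightarrow> is_lift \<alpha> X u (L \<alpha> X u)" using V by simp_all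
qed

lemma K_lift:
  assumes "\<alpha> \<le> k" "X \<in> vector_fields A" "u \<in> jets A k" "\<beta> \<le> k"
  shows "K \<beta> u (L \<alpha> X u) = (if \<beta> = \<alpha> then X (jet_proj u) else tv_zero)"
  using L_props(2)[OF assms(1-3)] assms(4) by (auto simp: is_lift_def)

lemma L_tangent:
  assumes "\<alpha> \<le> k" "X \<in> vector_fields A" "u \<in> jets A k"
  shows "L \<alpha> X u \<in> tangent_space JA u"
  using L_props(2)[OF assms] by (simp add: is_lift_def)

lemma bracket_lift:
  assumes \<alpha>: "\<alpha> \<le> k" and X: "X \<in> vector_fields A" and Y: "Y \<in> vector_fields A" and u: "u \<in> jets A k"
    and B: "lie_bracket (L \<alpha> X) (L k Y) u \<in> tangent_space JA u"
  shows "lie_bracket (L \<alpha> X) (L k Y) u = (if \<alpha> = 0 then L k (D X Y) u else tv_zero)"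
proof -
  obtain U \<phi> T \<Gamma> E where F: "jet_frame A D U \<phi> T \<Gamma> E k \<iota>" "u \<in> jet_dom U" "\<phi> (jet_proj u) \<in> T"
    by (rule jet_frame_at[OF u])
  interpret F: jet_frame A D U \<phi> T \<Gamma> E k \<iota> by (rule F)
  have eq: "L \<alpha> X u = jtv U \<phi> u (F.lift_components \<alpha> (components A U \<phi> X (jet_chart \<iota> \<phi> u $ idx 0)) (jet_chart \<iota> \<phi> u))"
    if "\<alpha> \<le> k" "X \<in> vector_fields A" "u \<in> jet_dom U" "\<phi> (jet_proj u) \<in> T" for \<alpha> X u
    using is_lift_unique[OF F.jet_domD(2)[OF that(3)] L_props(2)[OF that(1,2) F.jet_domD(2)[OF that(3)]]
        is_lift_frame[OF F(1) that(3,4,1,2)]] .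
  note p = F.jet_domD(1)[OF F(2)]
  have c: "components A U \<phi> (D X Y) (\<phi> (jet_proj u)) = dd (components A U \<phi> Y) (\<phi> (jet_proj u)) (components A U \<phi> X (\<phi> (jet_proj u)))
      + \<Gamma> (\<phi> (jet_proj u)) (components A U \<phi> X (\<phi> (jet_proj u))) (components A U \<phi> Y (\<phi> (jet_proj u)))"
    by (rule components_eq[where Z = "D X Y", OF F.U p F.D_eq[OF X Y p F(3)]])
  show ?thesis
    using F.bracket_lift_components[OF \<alpha> X Y L_props(1)[OF \<alpha> X] L_props(1)[OF order_refl Y]
        eq[OF \<alpha> X] eq[OF order_refl Y] F(2,3) B] eq[OF order_refl D_closed[OF X Y] F(2,3)]
    unfolding c[symmetric] jet_chart_0[OF u] by simp
qed

lemma g_props: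
  assumes "v \<in> tangent_space A p" "w \<in> tangent_space A p" "v' \<in> tangent_space A p"
  shows "g p v w = g p w v" "g p (tv_add v v') w = g p v w + g p v' w" "g p (tv_scale c v) w = c * g p v w"
    "v \<noteq> tv_zero \<Longrightarrow> g p v v > 0"
  using metric tangent_space_carr[OF assms(1)] assms unfolding riemannian_metric_def by blast+

lemma g_zero:
  assumes "w \<in> tangent_space A p"
  shows "g p tv_zero w = 0" "g p w tv_zero = 0"
proof -
  have z: "tv_zero \<in> tangent_space A p" using tangent_space_zero[OF tangent_space_carr[OF assms]] .
  have "tv_scale 0 tv_zero = (tv_zero :: 'a tvec)" by (simp add: tv_scale_def tv_zero_def)
  then show "g p tv_zero w = 0" using g_props(3)[OF z assms z, of 0] by simp
  then show "g p w tv_zero = 0" using g_props(1)[OF assms z z] by simp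
qed

text \<open>Positive definiteness tested on global fields: the frame extends the difference of the
  two vectors to a global field, with which both have the same product.\<close>

lemma tangent_eqI:
  assumes v: "v \<in> tangent_space A p" "v' \<in> tangent_space A p"
    and eq: "\<And>Z. Z \<in> vector_fields A \<Longrightarrow> g p v (Z p) = g p v' (Z p)"
  shows "v = v'"
proof -
  obtain U \<phi> where U: "(U, \<phi>) \<in> A" "p \<in> U" by (rule carrE[OF tangent_space_carr[OF v(1)]])
  define z where "z = tv_add v (tv_scale (-1) v')"
  have s: "tv_scale (-1) v' \<in> tangent_space A p" by (rule tangent_space_scale[OF v(2)])
  have z: "z \<in> tangent_space A p" unfolding z_def by (rule tangent_space_add[OF v(1) s])
  obtain w where w: "z = chart_vec A U \<phi> p w" by (rule tangent_spaceE[OF z U])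
  obtain T \<Gamma> E where F: "frame A D U \<phi> T \<Gamma> E" "\<phi> p \<in> T" by (rule frame_exists[OF LC U])
  have E: "E w \<in> vector_fields A" "E w p = z"
    using frame.E_field[OF F(1)] frame.E_eq[OF F(1) U(2) F(2)] w by simp_all
  have "g p z z = g p v z - g p v' z"
    using g_props(2)[OF v(1) z s] g_props(3)[OF v(2) z v(2), of "-1"] by (simp add: z_def)
  also have "\<dots> = 0" using eq[OF E(1)] E(2) by simp
  finally have "z = tv_zero" using g_props(4)[OF z z z] by fastforce
  then have "z f = 0" for f by (simp add: tv_zero_def)
  then show ?thesis by (intro ext) (simp add: z_def tv_add_def tv_scale_def)
qed

lemma G_props:
  assumes u: "u \<in> jets A k" and W: "W \<in> tangent_space JA u" "W' \<in> tangent_space JA u" "W'' \<in> tangent_space JA u"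
  shows "G u W W' = G u W' W" "G u (tv_add W W'') W' = G u W W' + G u W'' W'"
proof -
  have *: "K \<alpha> u W \<in> tangent_space A (jet_proj u)" "K \<alpha> u W' \<in> tangent_space A (jet_proj u)"
    "K \<alpha> u W'' \<in> tangent_space A (jet_proj u)" "K \<alpha> u (tv_add W W'') = tv_add (K \<alpha> u W) (K \<alpha> u W'')"
    if "\<alpha> \<le> k" for \<alpha>
    using K_tangent(1)[OF u _ _ that] K_tangent(2)[OF u W(1,3) that] W by blast+
  show "G u W W' = G u W' W" unfolding sasaki_def
    by (intro sum.cong refl g_props(1)) (use * in auto)
  show "G u (tv_add W W'') W' = G u W W' + G u W'' W'" unfolding sasaki_def sum.distrib[symmetric]
    by (intro sum.cong refl) (use * g_props(2) in auto)
qed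

text \<open>All levels of a lift except \<open>\<alpha>\<close> vanish, so a single summand of the
  Sasaki metric survives. Products with lifts thus recover each \<open>K \<alpha>\<close>.\<close>

lemma G_lift:
  assumes u: "u \<in> jets A k" and W: "W \<in> tangent_space JA u" and \<alpha>: "\<alpha> \<le> k" and Z: "Z \<in> vector_fields A"
  shows "G u W (L \<alpha> Z u) = g (jet_proj u) (K \<alpha> u W) (Z (jet_proj u))"
proof -
  have "G u W (L \<alpha> Z u) = (\<Sum>\<beta>\<le>k. if \<beta> = \<alpha> then g (jet_proj u) (K \<alpha> u W) (Z (jet_proj u)) else 0)"
    unfolding sasaki_def
    by (intro sum.cong refl) (use K_lift[OF \<alpha> Z u] g_zero(2)[OF K_tangent(1)[OF u W W]] in auto)
  then show ?thesis using \<alpha> by (simp add: sum.delta)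
qed

lemma G_lift_lift:
  assumes u: "u \<in> jets A k" and "\<alpha> \<le> k" "\<beta> \<le> k" "X \<in> vector_fields A" "Y \<in> vector_fields A"
  shows "G u (L \<alpha> X u) (L \<beta> Y u) = (if \<alpha> = \<beta> then g (jet_proj u) (X (jet_proj u)) (Y (jet_proj u)) else 0)"
proof -
  have "Y (jet_proj u) \<in> tangent_space A (jet_proj u)" by (rule vector_fieldD(1)[OF assms(5) jets_rep(4)[OF u]])
  then show ?thesis
    using G_lift[OF u L_tangent[OF assms(2,4) u] assms(3,5)] K_lift[OF assms(2,4) u assms(3)] g_zero(1) by simp
qed

text \<open>The product of two lifts is 0 or the pullback of a function on \<open>A\<close>, and on
  pullbacks a lift of positive level acts as zero, since its projection vanishes.\<close>

lemma lift_derivative: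
  assumes u: "u \<in> jets A k" and "\<alpha> \<le> k" "\<beta> \<le> k" "\<gamma> \<le> k" "X \<in> vector_fields A" "Y \<in> vector_fields A" "Z \<in> vector_fields A"
  shows "L \<alpha> X u (\<lambda>q. G q (L \<beta> Y q) (L \<gamma> Z q))
    = (if \<alpha> = 0 \<and> \<beta> = \<gamma> then X (jet_proj u) (\<lambda>p. g p (Y p) (Z p)) else 0)"
proof -
  let ?h = "\<lambda>p. g p (Y p) (Z p)"
  have h: "?h \<in> smooth_fun A" using metric assms(6,7) by (auto simp: riemannian_metric_def)
  note LX = L_tangent[OF assms(2,5) u]
  have "L \<alpha> X u (\<lambda>q. G q (L \<beta> Y q) (L \<gamma> Z q)) = L \<alpha> X u (\<lambda>q. if \<beta> = \<gamma> then ?h (jet_proj q) else 0)"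
    by (rule J.tangent_cong[OF LX]) (simp add: carr_jets G_lift_lift assms)
  moreover have "L \<alpha> X u (\<lambda>q. ?h (jet_proj q)) = K 0 u (L \<alpha> X u) ?h"
    using h by (simp add: Kmap_def pushforward_def comp_def)
  moreover have "K 0 u (L \<alpha> X u) ?h = (if \<alpha> = 0 then X (jet_proj u) ?h else 0)"
    using K_lift[OF assms(2,5) u, of 0] by (simp add: tv_zero_def)
  ultimately show ?thesis using J.tangent_const[OF LX] by (cases "\<beta> = \<gamma>") simp_all
qed

lemma metric_compatible:
  assumes "X \<in> vector_fields A" "Y \<in> vector_fields A" "Z \<in> vector_fields A" "p \<in> carr A"
  shows "X p (\<lambda>q. g q (Y q) (Z q)) = g p (D X Y p) (Z p) + g p (D X Z p) (Y p)"
proof -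
  have "X p (\<lambda>q. g q (Y q) (Z q)) = g p (D X Y p) (Z p) + g p (Y p) (D X Z p)"
    using LC assms unfolding levi_civita_def by blast
  moreover have "g p (Y p) (D X Z p) = g p (D X Z p) (Y p)"
    using g_props(1) vector_fieldD(1)[OF _ assms(4)] assms D_closed by metis
  ultimately show ?thesis by simp
qed

text \<open>Metric compatibility is used for the three cyclic choices of fields, and
  torsion-freeness trades transposed covariant derivatives for brackets. Torsion-freeness also shows
  that a bracket is a difference of tangent vectors.\<close>

lemma koszul:
  assumes Dk: "levi_civita JA G Dk" and u: "u \<in> jets A k"
    and P: "P \<in> vector_fields JA" and Q: "Q \<in> vector_fields JA" and R: "R \<in> vector_fields JA"
  shows "lie_bracket P Q u \<in> tangent_space JA u"
    and "2 * G u (Dk P Q u) (R u) = P u (\<lambda>q. G q (Q q) (R q)) + Q u (\<lambda>q. G q (P q) (R q)) - R u (\<lambda>q. G q (P q) (Q q))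
      + G u (lie_bracket P Q u) (R u) - G u (lie_bracket P R u) (Q u) - G u (lie_bracket Q R u) (P u)"
proof -
  have aff: "affine_connection JA Dk" using Dk by (simp add: levi_civita_def)
  have uc: "u \<in> carr JA" using u by (simp add: carr_jets)
  note T = J.vector_fieldD(1)[OF _ uc]
  have tor: "lie_bracket P Q u = tv_add (Dk P Q u) (tv_scale (-1) (Dk Q P u))"
    "Dk P Q u = tv_add (Dk Q P u) (lie_bracket P Q u)" "lie_bracket P Q u \<in> tangent_space JA u"
    if P: "P \<in> vector_fields JA" and Q: "Q \<in> vector_fields JA" for P Q
  proof -
    have "lie_bracket P Q = vf_add (Dk P Q) (vf_scale (\<lambda>p. -1) (Dk Q P))" using Dk P Q by (simp add: levi_civita_def)
    from fun_cong[OF this, of u] show 1: "lie_bracket P Q u = tv_add (Dk P Q u) (tv_scale (-1) (Dk Q P u))"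
      by (simp add: vf_add_def vf_scale_def)
    show "Dk P Q u = tv_add (Dk Q P u) (lie_bracket P Q u)" unfolding 1 by (simp add: tv_add_def tv_scale_def)
    show "lie_bracket P Q u \<in> tangent_space JA u" unfolding 1
      by (intro J.tangent_space_add J.tangent_space_scale T affine_connectionD(1)[OF aff] P Q)
  qed
  show "lie_bracket P Q u \<in> tangent_space JA u" by (rule tor(3)[OF P Q])
  have DT: "Dk P Q u \<in> tangent_space JA u" if "P \<in> vector_fields JA" "Q \<in> vector_fields JA" for P Q
    by (rule T[OF affine_connectionD(1)[OF aff that]])
  have swap: "G u (Dk P Q u) (R u) = G u (Dk Q P u) (R u) + G u (lie_bracket P Q u) (R u)"
    if "P \<in> vector_fields JA" "Q \<in> vector_fields JA" "R \<in> vector_fields JA" for P Q R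
    using G_props(2)[OF u DT[OF that(2,1)] T[OF that(3)] tor(3)[OF that(1,2)]] tor(2)[OF that(1,2)] by simp
  have sym: "G u (Dk P Q u) (R u) = G u (R u) (Dk P Q u)"
    if "P \<in> vector_fields JA" "Q \<in> vector_fields JA" "R \<in> vector_fields JA" for P Q R
    using G_props(1)[OF u DT[OF that(1,2)] T[OF that(3)] T[OF that(3)]] .
  have compat: "P u (\<lambda>q. G q (Q q) (R q)) = G u (Dk P Q u) (R u) + G u (Q u) (Dk P R u)"
    if "P \<in> vector_fields JA" "Q \<in> vector_fields JA" "R \<in> vector_fields JA" for P Q R
    using Dk that uc unfolding levi_civita_def by blast
  show "2 * G u (Dk P Q u) (R u) = P u (\<lambda>q. G q (Q q) (R q)) + Q u (\<lambda>q. G q (P q) (R q)) - R u (\<lambda>q. G q (P q) (Q q))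
      + G u (lie_bracket P Q u) (R u) - G u (lie_bracket P R u) (Q u) - G u (lie_bracket Q R u) (P u)"
    using compat[OF P Q R] compat[OF Q P R] compat[OF R P Q] swap[OF P Q R] swap[OF P R Q] swap[OF Q R P]
      sym[OF P R Q] sym[OF Q R P] sym[OF R Q P] by linarith
qed

lemma lie_bracket_swap: "lie_bracket P Q u = tv_scale (-1) (lie_bracket Q P u)"
  by (simp add: lie_bracket_def tv_scale_def)

context
  fixes Dk :: "'a jet conn" and X Y :: "'a vfield"
  assumes Dk: "levi_civita JA G Dk" and X: "X \<in> vector_fields A" and Y: "Y \<in> vector_fields A"
begin

lemma bracket:
  assumes "\<alpha> \<le> k" "X' \<in> vector_fields A" "Y' \<in> vector_fields A" "u \<in> jets A k"
  shows "lie_bracket (L \<alpha> X') (L k Y') u = (if \<alpha> = 0 then L k (D X' Y') u else tv_zero)"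
  \<comment> \<open>Tangency of the bracket does not involve the third field of
    \<open>koszul\<close>, so the first lift is repeated in its place.\<close>
  by (rule bracket_lift[OF assms koszul(1)[OF Dk assms(4) L_props(1)[OF assms(1,2)] L_props(1)[OF order_refl assms(3)]
      L_props(1)[OF assms(1,2)]]])

text \<open>Follows from additivity of the metric, with the zero vector written as a sum of two zero
  vectors.\<close>

lemma G_zero: "u \<in> jets A k \<Longrightarrow> \<alpha> \<le> k \<Longrightarrow> Z \<in> vector_fields A \<Longrightarrow> G u tv_zero (L \<alpha> Z u) = 0"
proof -
  assume u: "u \<in> jets A k" and *: "\<alpha> \<le> k" "Z \<in> vector_fields A"
  have z: "tv_zero \<in> tangent_space JA u" by (rule J.tangent_space_zero) (simp add: carr_jets u)
  show ?thesis
    using G_props(2)[OF u z L_tangent[OF * u] z] by (simp add: tv_add_def tv_zero_def)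
qed

lemma Dk_tangent: "\<alpha> \<le> k \<Longrightarrow> u \<in> jets A k \<Longrightarrow> Dk (L \<alpha> X) (L k Y) u \<in> tangent_space JA u"
  using affine_connectionD(1)[of JA Dk] Dk L_props(1)[OF _ X] L_props(1)[OF order_refl Y] J.vector_fieldD(1)
  by (simp add: levi_civita_def carr_jets)

text \<open>Tested against the top lift of \<open>Z\<close>, each bracket in the Koszul formula has
  a top lift as its second field. For \<open>\<alpha> \<ge> 1\<close> every term vanishes. For
  \<open>\<alpha> = 0\<close> the derivative of \<open>g(Y, Z)\<close> along \<open>X\<close>
  remains together with \<open>g(D X Y, Z) - g(D X Z, Y)\<close>, which sum to
  \<open>2 g(D X Y, Z)\<close> by compatibility with the metric.\<close>

lemma K_top_connection:
  assumes \<alpha>: "\<alpha> \<le> k" and u: "u \<in> jets A k"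
  shows "K k u (Dk (L \<alpha> X) (L k Y) u) = (if \<alpha> = 0 then D X Y (jet_proj u) else tv_zero)"
proof (rule tangent_eqI)
  let ?p = "jet_proj u"
  note DT = Dk_tangent[OF \<alpha> u] and p = jets_rep(4)[OF u]
  have DXY: "D X Y ?p \<in> tangent_space A ?p" by (rule vector_fieldD(1)[OF D_closed[OF X Y] p])
  show "K k u (Dk (L \<alpha> X) (L k Y) u) \<in> tangent_space A ?p" by (rule K_tangent(1)[OF u DT DT order_refl])
  show "(if \<alpha> = 0 then D X Y ?p else tv_zero) \<in> tangent_space A ?p" using DXY tangent_space_zero[OF p] by simp
  fix Z assume Z: "Z \<in> vector_fields A"
  have "2 * g ?p (K k u (Dk (L \<alpha> X) (L k Y) u)) (Z ?p) = 2 * G u (Dk (L \<alpha> X) (L k Y) u) (L k Z u)"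
    by (simp add: G_lift[OF u DT order_refl Z])
  also have "\<dots> = (if \<alpha> = 0 then X ?p (\<lambda>p. g p (Y p) (Z p)) + g ?p (D X Y ?p) (Z ?p) - g ?p (D X Z ?p) (Y ?p) else 0)"
    unfolding koszul(2)[OF Dk u L_props(1)[OF \<alpha> X] L_props(1)[OF order_refl Y] L_props(1)[OF order_refl Z]]
    using k_pos by (simp add: lift_derivative u \<alpha> X Y Z bracket G_zero G_lift_lift D_closed)
  also have "\<dots> = 2 * g ?p (if \<alpha> = 0 then D X Y ?p else tv_zero) (Z ?p)"
    using metric_compatible[OF X Y Z p] g_zero(1)[OF vector_fieldD(1)[OF Z p]] by simp
  finally show "g ?p (K k u (Dk (L \<alpha> X) (L k Y) u)) (Z ?p) = g ?p (if \<alpha> = 0 then D X Y ?p else tv_zero) (Z ?p)" by simp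
qed

text \<open>Tested against the lift of \<open>Z\<close> at level \<open>\<mu>\<close>, the Koszul
  formula has no surviving term unless \<open>\<mu> = 0\<close>. In that case it reduces to minus
  the derivative of \<open>g(X, Y)\<close> along \<open>Z\<close> plus the two terms that equal this
  derivative by compatibility.\<close>

lemma K_lower_connection:
  assumes \<mu>: "\<mu> < k" and u: "u \<in> jets A k"
  shows "K \<mu> u (Dk (L k X) (L k Y) u) = tv_zero"
proof (rule tangent_eqI)
  let ?p = "jet_proj u"
  note DT = Dk_tangent[OF order_refl u] and p = jets_rep(4)[OF u]
  have \<mu>': "\<mu> \<le> k" using \<mu> by simp
  show "K \<mu> u (Dk (L k X) (L k Y) u) \<in> tangent_space A ?p" by (rule K_tangent(1)[OF u DT DT \<mu>'])
  show "tv_zero \<in> tangent_space A ?p" by (rule tangent_space_zero[OF p])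
  fix Z assume Z: "Z \<in> vector_fields A"
  \<comment> \<open>Here the top lift is the first field, whereas \<open>bracket\<close> has it
    second; antisymmetry accounts for the minus sign.\<close>
  have br: "G u (lie_bracket (L k X) (L \<mu> Z) u) (L k Y u) = - (if \<mu> = 0 then g ?p (D Z X ?p) (Y ?p) else 0)"
    if X: "X \<in> vector_fields A" and Y: "Y \<in> vector_fields A" for X Y
  proof -
    have "G u (lie_bracket (L k X) (L \<mu> Z) u) (L k Y u) + G u (lie_bracket (L \<mu> Z) (L k X) u) (L k Y u) = 0"
    proof -
      have T: "lie_bracket (L k X) (L \<mu> Z) u \<in> tangent_space JA u" "lie_bracket (L \<mu> Z) (L k X) u \<in> tangent_space JA u"
        using koszul(1)[OF Dk u] L_props(1)[OF order_refl X] L_props(1)[OF \<mu>' Z] by blast+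
      have "tv_add (lie_bracket (L k X) (L \<mu> Z) u) (lie_bracket (L \<mu> Z) (L k X) u) = tv_zero"
        unfolding lie_bracket_swap[of "L k X" "L \<mu> Z"] by (simp add: tv_add_def tv_scale_def tv_zero_def)
      then show ?thesis
        using G_props(2)[OF u T(1) L_tangent[OF order_refl Y u] T(2)] G_zero[OF u order_refl Y] by simp
    qed
    then show ?thesis using bracket[OF \<mu>' Z X u] G_zero[OF u order_refl Y]
      G_lift_lift[OF u order_refl order_refl D_closed[OF Z X] Y] by (cases "\<mu> = 0") simp_all
  qed
  have "2 * g ?p (K \<mu> u (Dk (L k X) (L k Y) u)) (Z ?p) = 2 * G u (Dk (L k X) (L k Y) u) (L \<mu> Z u)"
    by (simp add: G_lift[OF u DT \<mu>' Z])
  also have "\<dots> = (if \<mu> = 0 then - Z ?p (\<lambda>p. g p (X p) (Y p)) + g ?p (D Z X ?p) (Y ?p) + g ?p (D Z Y ?p) (X ?p) else 0)"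
    unfolding koszul(2)[OF Dk u L_props(1)[OF order_refl X] L_props(1)[OF order_refl Y] L_props(1)[OF \<mu>' Z]]
    using k_pos \<mu> \<mu>' by (simp add: lift_derivative u X Y Z bracket[of k] G_zero br)
  also have "\<dots> = 0" using metric_compatible[OF Z X Y p] by simp
  finally show "g ?p (K \<mu> u (Dk (L k X) (L k Y) u)) (Z ?p) = g ?p tv_zero (Z ?p)"
    using g_zero(1)[OF vector_fieldD(1)[OF Z p]] by simp
qed

end

end

theorem proposition24:
  fixes A :: "('a, 'e::euclidean_space) atlas"
    and g :: "'a metric_field"
    and D :: "'a conn"
    and k :: nat
    and \<iota> :: "'i::finite \<Rightarrow> nat"
    and Dk :: "'a jet conn"
    and X Y :: "'a vfield"
  assumes "smooth_manifold A" and "riemannian_metric A g" and "levi_civita A g D"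
    and "k \<ge> 1" and "bij_betw \<iota> UNIV {0..k}"
    and "levi_civita (jet_atlas A k \<iota>) (sasaki A g D k \<iota>) Dk"
    and "X \<in> vector_fields A" and "Y \<in> vector_fields A"
  shows
    "(\<forall>u\<in>jets A k.
        Kmap A D k \<iota> k u (Dk (lift A D k \<iota> k X) (lift A D k \<iota> k Y) u) = tv_zero) \<and>
     (\<forall>\<alpha>\<in>{1..k-1}. \<forall>u\<in>jets A k.
        Kmap A D k \<iota> k u (Dk (lift A D k \<iota> \<alpha> X) (lift A D k \<iota> k Y) u) = tv_zero) \<and>
     (\<forall>u\<in>jets A k.
        Kmap A D k \<iota> k u (Dk (lift A D k \<iota> 0 X) (lift A D k \<iota> k Y) u) = D X Y (jet_proj u)) \<and>
     (\<forall>\<mu><k. \<forall>u\<in>jets A k.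
        Kmap A D k \<iota> \<mu> u (Dk (lift A D k \<iota> k X) (lift A D k \<iota> k Y) u) = tv_zero)"
proof -
  have "jet_connection A k \<iota> g D"
    using assms manifold_locale[OF assms(1)]
    by (simp add: jet_connection_def jet_connection_axioms_def jet_manifold_def jet_index_def)
  note top = jet_connection.K_top_connection[OF this assms(6-8)]
    and lower = jet_connection.K_lower_connection[OF this assms(6-8)]
  \<comment> \<open>Levels from 1 to \<open>k - 1\<close> fall under the nonzero case of
    \<open>top\<close>, and \<open>k \<ge> 1\<close> puts level \<open>k\<close> there as
    well.\<close>
  show ?thesis using top[of k] top[of 0] top lower assms(4) by auto
qed

end
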